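(* Let $q\neq 1$ be a positive real number, let $n,p$ be positive integers, and let $\xi=e^{2\pi i/p}$. Let $(c,\lambda/\mu)$ be a placed skew shape with $n$ boxes and let $\tilde H^{(c,\lambda/\mu)}$ be the simple calibrated $H_{\infty,1,n}$-module with basis $\{v_L\}$ indexed by standard tableaux $L$ of shape $\lambda/\mu$ described in the context. Let $K_{(c,\lambda/\mu)}$ be its inertia group for the action of $\mathbb{Z}/p\mathbb{Z}$, i.e. the stabilizer of $(c,\lambda/\mu)$ in $\mathbb{Z}/p\mathbb{Z}=\langle g\rangle$, acting on $\tilde H^{(c,\lambda/\mu)}$ by $h v_L=v_{hL}$; let $\kappa$ be the smallest integer with $1\le\kappa\le p$ and $g^\kappa(c,\lambda/\mu)=(c,\lambda/\mu)$. For $0\le j\le|K_{(c,\lambda/\mu)}|-1$ let $$p_j=\sum_{\ell=0}^{|K_{(c,\lambda/\mu)}|-1}\xi^{-j\ell\kappa}g^{\ell\kappa}.$$ Then $$\tilde H^{(c,\lambda/\mu,j)}=p_j\tilde H^{(c,\lambda/\mu)}$$ is a simple calibrated $H_{\infty,p,n}$-module.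
   Context: **Algebras.** The affine braid group $\mathcal{B}_{\infty,1,n}$ has generators $T_2,\ldots,T_n,X^{\varepsilon_1}$ and relations: $T_iT_j=T_jT_i$ if $|i-j|>1$; $T_iT_{i+1}T_i=T_{i+1}T_iT_{i+1}$ for $2\le i\le n-1$; $X^{\varepsilon_1}T_2X^{\varepsilon_1}T_2=T_2X^{\varepsilon_1}T_2X^{\varepsilon_1}$; $X^{\varepsilon_1}T_i=T_iX^{\varepsilon_1}$ for $3\le i\le n$. Put $X^{\varepsilon_i}=T_iX^{\varepsilon_{i-1}}T_i$ ($2\le i\le n$), $L=\sum_{i}\mathbb{Z}\varepsilon_i$, $X^\lambda=\prod_i(X^{\varepsilon_i})^{\lambda_i}$ for $\lambda=\sum\lambda_i\varepsilon_i\in L$, and $L_p=\sum_{i\ge2}\mathbb{Z}(\varepsilon_i-\varepsilon_{i-1})+\sum_ip\mathbb{Z}\varepsilon_i$. $H_{\infty,1,n}$ is the quotient of $\mathbb{C}\mathcal{B}_{\infty,1,n}$ by $T_i^2=(q-q^{-1})T_i+1$, $2\le i\le n$, and $H_{\infty,p,n}$ is its subalgebra generated by $T_2,\ldots,T_n$ and $X^\lambda$, $\lambda\in L_p$; it acts on $H_{\infty,1,n}$-modules by restriction. $\mathbb{Z}/p\mathbb{Z}=\langle g\rangle$ acts on $H_{\infty,1,n}$ by $g(X^{\varepsilon_1})=\xi X^{\varepsilon_1}$, $g(T_i)=T_i$, and on modules by twisting: ${}^gM$ is $M$ with action $h\circ m=g^{-1}(h)m$. The inertia group of $M$ is $\{h: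 {}^hM\cong M\}$. A finite dimensional $H_{\infty,p,n}$-module is calibrated if it has a basis of simultaneous eigenvectors for all $X^\lambda$, $\lambda\in L_p$ (for $H_{\infty,1,n}$: for all $X^\lambda$, $\lambda\in L$). **Placed skew shapes.** Let $\alpha=2\pi/\ln(q^2)$; $x\mapsto q^{2x}=e^{\ln(q^2)x}$ is a bijection $\mathbb{R}+i(\mathbb{R}/\alpha\mathbb{Z})\to\mathbb{C}^*$. A placed skew shape with $n$ boxes is a "book" with pages indexed by $\beta\in[0,1)+i(\mathbb{R}/\alpha\mathbb{Z})$, each page carrying a (possibly empty) skew shape $\lambda^{(\beta)}/\mu^{(\beta)}$ drawn (rows downwards, columns to the right, as for matrices) on graph paper whose northwest–southeast diagonals are indexed consecutively by $\mathbb{Z}$ increasing from southwest to northeast, with $n$ boxes in total; $\lambda/\mu$ denotes the disjoint union of the pages. The content of a box $b$ on page $\beta$ is $c(b)=\beta+(\text{index of the diagonal containing } b)$. Two such books are regarded as equal if there is a content-preserving bijection of boxes which, on each connected component of each page, is a translation. A standard tableau $L$ of shape $\lambda/\mu$ is a filling of the boxes with $1,\ldots,n$, each used once, increasing left to right in rows and top to bottom in columns on each page; $L(i)$ is the box containing $i$. **The module.** $\tilde H^{(c,\lambda/\mu)}$ has basis $\{v_L\}$, $L$ ranging over standard tableaux of shape $\lambda/\mu$, with action $X^{\varepsilon_i}v_L=q^{2c(L(i))}v_L$ and $T_iv_L=(T_i)_{LL}v_L+(q^{-1}+(T_i)_{LL})v_{s_iL}$, where $(T_i)_{LL}=\dfrac{q-q^{-1}}{1-q^{2(c(L(i-1))-c(L(i)))}}$,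 $s_iL$ is $L$ with $i-1$ and $i$ interchanged, and $v_{s_iL}=0$ if $s_iL$ is not standard. It is a simple calibrated $H_{\infty,1,n}$-module. **Group action.** $g(c,\lambda/\mu)=(c-i\alpha/p,\lambda/\mu)$ (here $i=\sqrt{-1}$): the skew shape on page $\beta$ is moved to page $\beta-i\alpha/p$. For a standard tableau $L$, $gL$ is the same filling viewed as a standard tableau of $g(c,\lambda/\mu)$; if $h\in K_{(c,\lambda/\mu)}$ then $hL$ is again a standard tableau of $(c,\lambda/\mu)$. *)

theory Defs
  imports Complex_Main "HOL-Library.Poly_Mapping" "HOL-Library.Real_Mod"
    "HOL-Algebra.QuotRing" "HOL-Algebra.Generated_Rings" "HOL-Algebra.Module"
begin

section \<open>Groups given by generators and relations\<close>

text \<open>A letter \<open>(s, True)\<close> stands for the generator \<open>s\<close> and \<open>(s, False)\<close> for its inverse.\<close>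

type_synonym 's word = "('s \<times> bool) list"

definition words :: "'s set \<Rightarrow> 's word set" where
  "words S = lists (S \<times> UNIV)"

inductive pres_eq :: "'s set \<Rightarrow> ('s word \<Rightarrow> 's word \<Rightarrow> bool) \<Rightarrow> 's word \<Rightarrow> 's word \<Rightarrow> bool"
  for S :: "'s set" and r :: "'s word \<Rightarrow> 's word \<Rightarrow> bool" where
  relator: "r u v \<Longrightarrow> u \<in> words S \<Longrightarrow> v \<in> words S \<Longrightarrow> pres_eq S r u v"
| cancel: "s \<in> S \<Longrightarrow> pres_eq S r [(s, b), (s, \<not> b)] []"
| refl: "u \<in> words S \<Longrightarrow> pres_eq S r u u"
| sym: "pres_eq S r u v \<Longrightarrow> pres_eq S r v u"
| trans: "pres_eq S r u v \<Longrightarrow> pres_eq S r v w \<Longrightarrow> pres_eq S r u w"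
| append: "pres_eq S r u v \<Longrightarrow> pres_eq S r u' v' \<Longrightarrow> pres_eq S r (u @ u') (v @ v')"

definition pres_class :: "'s set \<Rightarrow> ('s word \<Rightarrow> 's word \<Rightarrow> bool) \<Rightarrow> 's word \<Rightarrow> 's word set" where
  "pres_class S r w = {u. pres_eq S r w u}"

definition presented_group :: "'s set \<Rightarrow> ('s word \<Rightarrow> 's word \<Rightarrow> bool) \<Rightarrow> 's word set monoid" where
  "presented_group S r =
     \<lparr>carrier = pres_class S r ` words S,
      mult = (\<lambda>A B. \<Union>u\<in>A. \<Union>v\<in>B. pres_class S r (u @ v)),
      one = pres_class S r []\<rparr>"

lemma pres_eq_words: "pres_eq S r u v \<Longrightarrow> u \<in> words S \<and> v \<in> words S"
  by (induction rule: pres_eq.induct) (auto simp: words_def)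

lemma pres_class_eq_iff:
  assumes "u \<in> words S" shows "pres_class S r u = pres_class S r v \<longleftrightarrow> pres_eq S r u v"
proof
  assume "pres_class S r u = pres_class S r v"
  then have "u \<in> pres_class S r v" using pres_eq.refl[OF assms] by (auto simp: pres_class_def)
  then show "pres_eq S r u v" by (auto simp: pres_class_def intro: pres_eq.sym)
next
  assume "pres_eq S r u v"
  then show "pres_class S r u = pres_class S r v"
    unfolding pres_class_def by (blast intro: pres_eq.sym pres_eq.trans)
qed

lemma pres_mult:
  assumes "u \<in> words S" "v \<in> words S"
  shows "pres_class S r u \<otimes>\<^bsub>presented_group S r\<^esub> pres_class S r v = pres_class S r (u @ v)"
proof -
  have "pres_class S r (u' @ v') = pres_class S r (u @ v)"
    if "u' \<in> pres_class S r u" "v' \<in> pres_class S r v" for u' v'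
  proof -
    have "pres_eq S r (u @ v) (u' @ v')"
      using that by (intro pres_eq.append) (simp_all add: pres_class_def)
    moreover have "u @ v \<in> words S" using assms by (auto simp: words_def)
    ultimately show ?thesis by (simp add: pres_class_eq_iff[symmetric])
  qed
  then have "pres_class S r u \<otimes>\<^bsub>presented_group S r\<^esub> pres_class S r v
     = (\<Union>u'\<in>pres_class S r u. \<Union>v'\<in>pres_class S r v. pres_class S r (u @ v))"
    by (simp add: presented_group_def)
  moreover have "u \<in> pres_class S r u" "v \<in> pres_class S r v"
    using assms by (simp_all add: pres_class_def pres_eq.refl)
  ultimately show ?thesis by auto
qed

lemma words_append: "u @ v \<in> words S \<longleftrightarrow> u \<in> words S \<and> v \<in> words S"
  by (auto simp: words_def)

lemma pres_inv:
  "u \<in> words S \<Longrightarrow> pres_eq S r (rev (map (\<lambda>(s, b). (s, \<not> b)) u) @ u) []"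
proof (induction u)
  case Nil then show ?case by (auto simp: words_def intro: pres_eq.refl)
next
  case (Cons x u)
  obtain s b where x: "x = (s, b)" by force
  have s: "s \<in> S" and u: "u \<in> words S" using Cons.prems x by (auto simp: words_def)
  let ?u = "rev (map (\<lambda>(s, b). (s, \<not> b)) u)"
  have uw: "?u \<in> words S" using u by (auto simp: words_def)
  have 1: "pres_eq S r ([(s, \<not> b), (s, b)] @ u) ([] @ u)"
    using pres_eq.append[OF pres_eq.cancel[OF s, of r "\<not> b"] pres_eq.refl[OF u, of r]] by simp
  have "pres_eq S r (?u @ ([(s, \<not> b), (s, b)] @ u)) (?u @ ([] @ u))"
    using pres_eq.append[OF pres_eq.refl[OF uw, of r] 1] by simp
  then show ?case using pres_eq.trans[OF _ Cons.IH[OF u]] x by simp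
qed

lemma group_presented_group: "group (presented_group S r)"
proof (rule groupI)
  let ?G = "presented_group S r"
  have car: "carrier ?G = pres_class S r ` words S" and one: "\<one>\<^bsub>?G\<^esub> = pres_class S r []"
    by (simp_all add: presented_group_def)
  have nil: "[] \<in> words S" by (simp add: words_def)
  show "\<one>\<^bsub>?G\<^esub> \<in> carrier ?G" using nil by (auto simp: car one)
  show "x \<otimes>\<^bsub>?G\<^esub> y \<in> carrier ?G" if "x \<in> carrier ?G" "y \<in> carrier ?G" for x y
    using that by (auto simp: car pres_mult words_append)
  show "x \<otimes>\<^bsub>?G\<^esub> y \<otimes>\<^bsub>?G\<^esub> z = x \<otimes>\<^bsub>?G\<^esub> (y \<otimes>\<^bsub>?G\<^esub> z)"
    if "x \<in> carrier ?G" "y \<in> carrier ?G" "z \<in> carrier ?G" for x y z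
    using that by (auto simp: car pres_mult words_append)
  show "\<one>\<^bsub>?G\<^esub> \<otimes>\<^bsub>?G\<^esub> x = x" if "x \<in> carrier ?G" for x
    using that nil by (auto simp: car one pres_mult)
  show "\<exists>y\<in>carrier ?G. y \<otimes>\<^bsub>?G\<^esub> x = \<one>\<^bsub>?G\<^esub>" if x: "x \<in> carrier ?G" for x
  proof -
    obtain u where u: "u \<in> words S" "x = pres_class S r u" using x car by auto
    let ?u = "rev (map (\<lambda>(s, b). (s, \<not> b)) u)"
    have uw: "?u \<in> words S" using u by (auto simp: words_def)
    then show ?thesis
      using u pres_inv[OF u(1), of r]
      by (intro bexI[of _ "pres_class S r ?u"])
         (auto simp: car one pres_mult pres_class_eq_iff words_append)
  qed
qed


section \<open>The affine braid group\<close>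

datatype braid_gen = Tgen nat | Xgen

definition braid_gens :: "nat \<Rightarrow> braid_gen set" where
  "braid_gens n = insert Xgen (Tgen ` {2..n})"

abbreviation pos_word :: "'s list \<Rightarrow> 's word" where
  "pos_word ss \<equiv> map (\<lambda>s. (s, True)) ss"

inductive braid_rel :: "nat \<Rightarrow> braid_gen word \<Rightarrow> braid_gen word \<Rightarrow> bool" for n :: nat where
  far: "i \<in> {2..n} \<Longrightarrow> j \<in> {2..n} \<Longrightarrow> \<bar>int i - int j\<bar> > 1 \<Longrightarrow>
     braid_rel n (pos_word [Tgen i, Tgen j]) (pos_word [Tgen j, Tgen i])"
| braid: "2 \<le> i \<Longrightarrow> i + 1 \<le> n \<Longrightarrow>
     braid_rel n (pos_word [Tgen i, Tgen (i + 1), Tgen i])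
                 (pos_word [Tgen (i + 1), Tgen i, Tgen (i + 1)])"
| XTXT: "2 \<le> n \<Longrightarrow>
     braid_rel n (pos_word [Xgen, Tgen 2, Xgen, Tgen 2]) (pos_word [Tgen 2, Xgen, Tgen 2, Xgen])"
| XT: "3 \<le> i \<Longrightarrow> i \<le> n \<Longrightarrow>
     braid_rel n (pos_word [Xgen, Tgen i]) (pos_word [Tgen i, Xgen])"

definition braid_group :: "nat \<Rightarrow> braid_gen word set monoid" where
  "braid_group n = presented_group (braid_gens n) (braid_rel n)"

definition braid_elt :: "nat \<Rightarrow> braid_gen \<Rightarrow> braid_gen word set" where
  "braid_elt n s = pres_class (braid_gens n) (braid_rel n) [(s, True)]"

text \<open>\<open>braid_Xeps n i\<close> is \<open>X\<close> to the power \<open>\<epsilon>\<^sub>i\<close>; the value at \<open>i = 0\<close> is a dummy.\<close>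

fun braid_Xeps :: "nat \<Rightarrow> nat \<Rightarrow> braid_gen word set" where
  "braid_Xeps n 0 = \<one>\<^bsub>braid_group n\<^esub>"
| "braid_Xeps n (Suc 0) = braid_elt n Xgen"
| "braid_Xeps n (Suc (Suc i)) =
     braid_elt n (Tgen (Suc (Suc i))) \<otimes>\<^bsub>braid_group n\<^esub> braid_Xeps n (Suc i)
       \<otimes>\<^bsub>braid_group n\<^esub> braid_elt n (Tgen (Suc (Suc i)))"

text \<open>An element of the lattice \<open>L\<close> is given by its coordinates \<open>\<lambda>\<^sub>1, \<dots>, \<lambda>\<^sub>n\<close>, extended by \<open>0\<close>.\<close>

definition lattice_L :: "nat \<Rightarrow> (nat \<Rightarrow> int) set" where
  "lattice_L n = {lam. \<forall>i. i \<notin> {1..n} \<longrightarrow> lam i = 0}"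

definition eps :: "nat \<Rightarrow> nat \<Rightarrow> int" where
  "eps i = (\<lambda>k. if k = i then 1 else 0)"

definition lattice_Lp :: "nat \<Rightarrow> nat \<Rightarrow> (nat \<Rightarrow> int) set" where
  "lattice_Lp p n =
     {lam. \<exists>a b. lam = (\<lambda>k. (\<Sum>i=2..n. a i * (eps i k - eps (i - 1) k))
                            + (\<Sum>i=1..n. b i * int p * eps i k))}"

definition braid_X :: "nat \<Rightarrow> (nat \<Rightarrow> int) \<Rightarrow> braid_gen word set" where
  "braid_X n lam =
     foldr (\<lambda>i x. (braid_Xeps n i [^]\<^bsub>braid_group n\<^esub> lam i) \<otimes>\<^bsub>braid_group n\<^esub> x)
       [1..<Suc n] \<one>\<^bsub>braid_group n\<^esub>"


section \<open>Affine Hecke algebras\<close>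

definition group_algebra :: "('g, 'm) monoid_scheme \<Rightarrow> ('g \<Rightarrow>\<^sub>0 complex) ring" where
  "group_algebra G =
     \<lparr>carrier = {f. Poly_Mapping.keys f \<subseteq> carrier G},
      mult = (\<lambda>f h. \<Sum>a\<in>Poly_Mapping.keys f. \<Sum>b\<in>Poly_Mapping.keys h.
                Poly_Mapping.single (a \<otimes>\<^bsub>G\<^esub> b) (Poly_Mapping.lookup f a * Poly_Mapping.lookup h b)),
      one = Poly_Mapping.single \<one>\<^bsub>G\<^esub> 1,
      zero = 0,
      add = (+)\<rparr>"

type_synonym hecke_elt = "(braid_gen word set \<Rightarrow>\<^sub>0 complex) set"

definition hecke_ideal :: "nat \<Rightarrow> real \<Rightarrow> (braid_gen word set \<Rightarrow>\<^sub>0 complex) set" where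
  "hecke_ideal n q =
     genideal (group_algebra (braid_group n))
       {Poly_Mapping.single (braid_elt n (Tgen i) \<otimes>\<^bsub>braid_group n\<^esub> braid_elt n (Tgen i)) 1
          - (Poly_Mapping.single (braid_elt n (Tgen i)) (of_real (q - inverse q))
             + Poly_Mapping.single \<one>\<^bsub>braid_group n\<^esub> 1) | i. i \<in> {2..n}}"

definition hecke :: "nat \<Rightarrow> real \<Rightarrow> hecke_elt ring" where
  "hecke n q = group_algebra (braid_group n) Quot hecke_ideal n q"

definition hecke_of :: "nat \<Rightarrow> real \<Rightarrow> (braid_gen word set \<Rightarrow>\<^sub>0 complex) \<Rightarrow> hecke_elt" where
  "hecke_of n q f = hecke_ideal n q +>\<^bsub>group_algebra (braid_group n)\<^esub> f"

definition hecke_scalar :: "nat \<Rightarrow> real \<Rightarrow> complex \<Rightarrow> hecke_elt" where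
  "hecke_scalar n q z = hecke_of n q (Poly_Mapping.single \<one>\<^bsub>braid_group n\<^esub> z)"

definition hecke_T :: "nat \<Rightarrow> real \<Rightarrow> nat \<Rightarrow> hecke_elt" where
  "hecke_T n q i = hecke_of n q (Poly_Mapping.single (braid_elt n (Tgen i)) 1)"

definition hecke_X :: "nat \<Rightarrow> real \<Rightarrow> (nat \<Rightarrow> int) \<Rightarrow> hecke_elt" where
  "hecke_X n q lam = hecke_of n q (Poly_Mapping.single (braid_X n lam) 1)"

lemma ring_group_algebra:
  assumes "group G" shows "ring (group_algebra G)"
proof -
  interpret group G by fact
  define m where "m = (\<lambda>f h::'a \<Rightarrow>\<^sub>0 complex. \<Sum>a\<in>Poly_Mapping.keys f. \<Sum>b\<in>Poly_Mapping.keys h.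
     Poly_Mapping.single (a \<otimes>\<^bsub>G\<^esub> b) (Poly_Mapping.lookup f a * Poly_Mapping.lookup h b))"
  have mA: "m f h = (\<Sum>a\<in>A. \<Sum>b\<in>B.
     Poly_Mapping.single (a \<otimes>\<^bsub>G\<^esub> b) (Poly_Mapping.lookup f a * Poly_Mapping.lookup h b))"
    if "finite A" "finite B" "Poly_Mapping.keys f \<subseteq> A" "Poly_Mapping.keys h \<subseteq> B" for f h A B
    unfolding m_def
    using that by (intro sum.mono_neutral_cong_left sum.mono_neutral_left) (auto simp: in_keys_iff)
  have addl: "m (f + f') h = m f h + m f' h" for f f' h
    using keys_add[of f f']
    by (simp add: mA[where A="Poly_Mapping.keys f \<union> Poly_Mapping.keys f'" and B="Poly_Mapping.keys h"]
       lookup_add algebra_simps single_add sum.distrib)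
  have addr: "m h (f + f') = m h f + m h f'" for f f' h
    using keys_add[of f f']
    by (simp add: mA[where B="Poly_Mapping.keys f \<union> Poly_Mapping.keys f'" and A="Poly_Mapping.keys h"]
       lookup_add algebra_simps single_add sum.distrib)
  have z: "m 0 f = 0" "m f 0 = 0" for f by (simp_all add: m_def)
  have ss: "m (Poly_Mapping.single a x) (Poly_Mapping.single b y) = Poly_Mapping.single (a \<otimes>\<^bsub>G\<^esub> b) (x * y)" for a b x y
    by (subst mA[where A="{a}" and B="{b}"]) auto
  have dec: "f = (\<Sum>a\<in>Poly_Mapping.keys f. Poly_Mapping.single a (Poly_Mapping.lookup f a))" for f :: "'a \<Rightarrow>\<^sub>0 complex"
    by (intro poly_mapping_eqI) (simp add: lookup_sum lookup_single when_def in_keys_iff sum.delta)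
  have mk: "Poly_Mapping.keys (m f h) \<subseteq> carrier G"
    if f: "Poly_Mapping.keys f \<subseteq> carrier G" and h: "Poly_Mapping.keys h \<subseteq> carrier G" for f h
    unfolding m_def using f h
    by (intro order.trans[OF keys_sum] UN_least) (auto split: if_splits)
  have bigl: "P f" if add: "\<And>f f'. P f \<Longrightarrow> P f' \<Longrightarrow> P (f + f')" and zero: "P 0"
     and sing: "\<And>a x. a \<in> carrier G \<Longrightarrow> P (Poly_Mapping.single a x)" and f: "Poly_Mapping.keys f \<subseteq> carrier G" for P and f :: "'a \<Rightarrow>\<^sub>0 complex"
  proof -
    have "P (\<Sum>a\<in>A. Poly_Mapping.single a (Poly_Mapping.lookup f a))" if "finite A" "A \<subseteq> carrier G" for A
      using that
    proof (induction A rule: finite_induct)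
      case empty show ?case using zero by simp
    next
      case (insert x F)
      show ?case unfolding sum.insert[OF insert.hyps(1,2)]
        by (rule add[OF sing insert.IH]) (use insert.prems in auto)
    qed
    from this[OF finite_keys f] show ?thesis by (simp only: dec[symmetric])
  qed
  have assoc: "m (m f h) k = m f (m h k)" if f: "Poly_Mapping.keys f \<subseteq> carrier G"
     and h: "Poly_Mapping.keys h \<subseteq> carrier G" and k: "Poly_Mapping.keys k \<subseteq> carrier G" for f h k
  proof -
    have 1: "m (m (Poly_Mapping.single a x) (Poly_Mapping.single b y)) k = m (Poly_Mapping.single a x) (m (Poly_Mapping.single b y) k)"
      if "a \<in> carrier G" "b \<in> carrier G" for a b x y
      by (rule bigl[OF _ _ _ k]) (simp_all add: addr z ss m_assoc mult.assoc that)
    have 2: "m (m (Poly_Mapping.single a x) h) k = m (Poly_Mapping.single a x) (m h k)"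
      if "a \<in> carrier G" for a x
      by (rule bigl[OF _ _ _ h]) (simp_all add: addr addl z 1 that)
    show ?thesis
      by (rule bigl[OF _ _ _ f]) (simp_all add: addl z 2)
  qed
  have one: "m (Poly_Mapping.single \<one>\<^bsub>G\<^esub> 1) f = f" "m f (Poly_Mapping.single \<one>\<^bsub>G\<^esub> 1) = f" if f: "Poly_Mapping.keys f \<subseteq> carrier G" for f
    by (rule bigl[OF _ _ _ f]; simp add: addl addr z ss)+
  have eq: "group_algebra G = \<lparr>carrier = {f. Poly_Mapping.keys f \<subseteq> carrier G}, mult = m,
      one = Poly_Mapping.single \<one>\<^bsub>G\<^esub> 1, zero = 0, add = (+)\<rparr>"
    by (simp add: group_algebra_def m_def)
  show ?thesis
  proof (rule ringI)
    show "abelian_group (group_algebra G)"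
    proof (rule abelian_groupI)
      show "\<exists>y\<in>carrier (group_algebra G). y \<oplus>\<^bsub>group_algebra G\<^esub> x = \<zero>\<^bsub>group_algebra G\<^esub>"
        if "x \<in> carrier (group_algebra G)" for x
        using that by (intro bexI[of _ "- x"]) (auto simp: eq)
      show "x \<oplus>\<^bsub>group_algebra G\<^esub> y \<in> carrier (group_algebra G)"
        if "x \<in> carrier (group_algebra G)" "y \<in> carrier (group_algebra G)" for x y
        using that keys_add[of x y] by (auto simp: eq)
    qed (auto simp: eq algebra_simps)
    show "monoid (group_algebra G)"
      by (rule monoidI) (auto simp: eq assoc one intro: subsetD[OF mk])
  qed (auto simp: eq addl addr)
qed

lemma ring_hecke: "ring (hecke n q)"
proof -
  interpret B: group "braid_group n" unfolding braid_group_def by (rule group_presented_group)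
  interpret A: ring "group_algebra (braid_group n)" by (rule ring_group_algebra) (rule B.is_group)
  have c: "braid_elt n (Tgen i) \<in> carrier (braid_group n)" if "i \<in> {2..n}" for i
    using that by (auto simp: braid_elt_def braid_group_def presented_group_def words_def braid_gens_def)
  have "ideal (hecke_ideal n q) (group_algebra (braid_group n))"
    unfolding hecke_ideal_def
  proof (rule A.genideal_ideal, safe)
    fix i assume i: "i \<in> {2..n}"
    show "Poly_Mapping.single (braid_elt n (Tgen i) \<otimes>\<^bsub>braid_group n\<^esub> braid_elt n (Tgen i)) 1
          - (Poly_Mapping.single (braid_elt n (Tgen i)) (of_real (q - inverse q))
             + Poly_Mapping.single \<one>\<^bsub>braid_group n\<^esub> 1) \<in> carrier (group_algebra (braid_group n))"
      unfolding group_algebra_def using c[OF i]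
      by (auto dest!: subsetD[OF keys_diff] subsetD[OF keys_add] split: if_splits)
  qed
  then show ?thesis unfolding hecke_def by (rule ideal.quotient_is_ring)
qed

text \<open>The unital subring generated by a set containing the scalars is the subalgebra generated by it.\<close>

definition hecke_p :: "nat \<Rightarrow> real \<Rightarrow> nat \<Rightarrow> hecke_elt ring" where
  "hecke_p n q p =
     (hecke n q)\<lparr>carrier := generate_ring (hecke n q)
        (range (hecke_scalar n q) \<union> hecke_T n q ` {2..n} \<union> hecke_X n q ` lattice_Lp p n)\<rparr>"

text \<open>The automorphism \<open>g\<close>; it is determined on the carrier by its values on the generators.\<close>

definition hecke_g :: "nat \<Rightarrow> real \<Rightarrow> nat \<Rightarrow> hecke_elt \<Rightarrow> hecke_elt" where
  "hecke_g n q p = (SOME \<sigma>. \<sigma> \<in> ring_iso (hecke n q) (hecke n q)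
      \<and> (\<forall>z. \<sigma> (hecke_scalar n q z) = hecke_scalar n q z)
      \<and> \<sigma> (hecke_X n q (eps 1)) =
          hecke_scalar n q (cis (2 * pi / real p)) \<otimes>\<^bsub>hecke n q\<^esub> hecke_X n q (eps 1)
      \<and> (\<forall>i\<in>{2..n}. \<sigma> (hecke_T n q i) = hecke_T n q i))"


section \<open>Left modules\<close>

text \<open>The library locale for modules asks for a commutative ring of scalars.\<close>

locale left_module = R?: ring R + M?: abelian_group M
  for R :: "('a, 'm) ring_scheme" and M :: "('a, 'b, 'k) module_scheme" +
  assumes smult_closed:
      "a \<in> carrier R \<Longrightarrow> x \<in> carrier M \<Longrightarrow> a \<odot>\<^bsub>M\<^esub> x \<in> carrier M"
    and smult_l_distr:
      "a \<in> carrier R \<Longrightarrow> b \<in> carrier R \<Longrightarrow> x \<in> carrier M \<Longrightarrow>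
       (a \<oplus>\<^bsub>R\<^esub> b) \<odot>\<^bsub>M\<^esub> x = a \<odot>\<^bsub>M\<^esub> x \<oplus>\<^bsub>M\<^esub> b \<odot>\<^bsub>M\<^esub> x"
    and smult_r_distr:
      "a \<in> carrier R \<Longrightarrow> x \<in> carrier M \<Longrightarrow> y \<in> carrier M \<Longrightarrow>
       a \<odot>\<^bsub>M\<^esub> (x \<oplus>\<^bsub>M\<^esub> y) = a \<odot>\<^bsub>M\<^esub> x \<oplus>\<^bsub>M\<^esub> a \<odot>\<^bsub>M\<^esub> y"
    and smult_assoc:
      "a \<in> carrier R \<Longrightarrow> b \<in> carrier R \<Longrightarrow> x \<in> carrier M \<Longrightarrow>
       (a \<otimes>\<^bsub>R\<^esub> b) \<odot>\<^bsub>M\<^esub> x = a \<odot>\<^bsub>M\<^esub> (b \<odot>\<^bsub>M\<^esub> x)"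
    and smult_one:
      "x \<in> carrier M \<Longrightarrow> \<one>\<^bsub>R\<^esub> \<odot>\<^bsub>M\<^esub> x = x"

definition simple_module :: "('a, 'm) ring_scheme \<Rightarrow> ('a, 'b, 'k) module_scheme \<Rightarrow> bool" where
  "simple_module R M \<longleftrightarrow> left_module R M \<and> carrier M \<noteq> {\<zero>\<^bsub>M\<^esub>}
     \<and> (\<forall>N. submodule N R M \<longrightarrow> N = {\<zero>\<^bsub>M\<^esub>} \<or> N = carrier M)"

definition module_isomorphic ::
    "('a, 'm) ring_scheme \<Rightarrow> ('a, 'b, 'k) module_scheme \<Rightarrow> ('a, 'c, 'l) module_scheme \<Rightarrow> bool" where
  "module_isomorphic R M N \<longleftrightarrow> (\<exists>f. bij_betw f (carrier M) (carrier N)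
     \<and> (\<forall>x\<in>carrier M. \<forall>y\<in>carrier M. f (x \<oplus>\<^bsub>M\<^esub> y) = f x \<oplus>\<^bsub>N\<^esub> f y)
     \<and> (\<forall>a\<in>carrier R. \<forall>x\<in>carrier M. f (a \<odot>\<^bsub>M\<^esub> x) = a \<odot>\<^bsub>N\<^esub> f x))"

text \<open>
  Below, \<open>\<iota>\<close> is the structure map from the complex numbers to the ring acting on \<open>M\<close>, which makes
  \<open>M\<close> a complex vector space.
\<close>

definition coords ::
    "(complex \<Rightarrow> 'a) \<Rightarrow> ('a, 'b, 'k) module_scheme \<Rightarrow> 'i set \<Rightarrow> ('i \<Rightarrow> 'b) \<Rightarrow> 'b \<Rightarrow> ('i \<Rightarrow> complex) \<Rightarrow> bool"
  where "coords \<iota> M I v m a \<longleftrightarrow>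
     a \<in> extensional I \<and> m = (\<Oplus>\<^bsub>M\<^esub>i\<in>I. \<iota> (a i) \<odot>\<^bsub>M\<^esub> v i)"

definition finite_basis ::
    "(complex \<Rightarrow> 'a) \<Rightarrow> ('a, 'b, 'k) module_scheme \<Rightarrow> 'i set \<Rightarrow> ('i \<Rightarrow> 'b) \<Rightarrow> bool" where
  "finite_basis \<iota> M I v \<longleftrightarrow> finite I \<and> v \<in> I \<rightarrow> carrier M
     \<and> (\<forall>m\<in>carrier M. \<exists>!a. coords \<iota> M I v m a)"

text \<open>The linear map sending the basis vector \<open>v i\<close> to \<open>w i\<close>.\<close>

definition linear_ext ::
    "(complex \<Rightarrow> 'a) \<Rightarrow> ('a, 'b, 'k) module_scheme \<Rightarrow> 'i set \<Rightarrow> ('i \<Rightarrow> 'b) \<Rightarrow> ('i \<Rightarrow> 'b) \<Rightarrow> 'b \<Rightarrow> 'b" where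
  "linear_ext \<iota> M I v w m =
     (\<Oplus>\<^bsub>M\<^esub>i\<in>I. \<iota> ((THE a. coords \<iota> M I v m a) i) \<odot>\<^bsub>M\<^esub> w i)"

definition calibrated ::
    "(complex \<Rightarrow> 'a) \<Rightarrow> 'a set \<Rightarrow> ('a, 'b, 'k) module_scheme \<Rightarrow> bool" where
  "calibrated \<iota> Xs M \<longleftrightarrow> (\<exists>B. finite_basis \<iota> M B (\<lambda>b. b)
     \<and> (\<forall>b\<in>B. \<forall>x\<in>Xs. \<exists>z. x \<odot>\<^bsub>M\<^esub> b = \<iota> z \<odot>\<^bsub>M\<^esub> b))"

definition twisted_module ::
    "('a, 'm) ring_scheme \<Rightarrow> ('a \<Rightarrow> 'a) \<Rightarrow> ('a, 'b, 'k) module_scheme \<Rightarrow> ('a, 'b, 'k) module_scheme" where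
  "twisted_module R \<sigma> M = M\<lparr>smult := \<lambda>a m. inv_into (carrier R) \<sigma> a \<odot>\<^bsub>M\<^esub> m\<rparr>"

text \<open>The element \<open>g\<^sup>k\<close> of the cyclic group of order \<open>p\<close> is represented by \<open>k < p\<close>.\<close>

definition inertia_group ::
    "nat \<Rightarrow> real \<Rightarrow> nat \<Rightarrow> (hecke_elt, 'b, 'k) module_scheme \<Rightarrow> nat set" where
  "inertia_group n q p M =
     {k. k < p \<and> module_isomorphic (hecke n q) (twisted_module (hecke n q) (hecke_g n q p ^^ k) M) M}"


section \<open>Placed skew shapes\<close>

text \<open>
  A box is a page together with the row and the column of the box on that page. A class of
  imaginary parts modulo \<open>\<alpha>\<close> is represented by its element in the interval from \<open>0\<close> (included)
  to \<open>\<bar>\<alpha>\<bar>\<close> (excluded); note that \<open>\<alpha>\<close> is negative if \<open>q < 1\<close>.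
\<close>

type_synonym box = "complex \<times> int \<times> int"

definition alpha :: "real \<Rightarrow> real" where
  "alpha q = 2 * pi / ln (q\<^sup>2)"

definition pages :: "real \<Rightarrow> complex set" where
  "pages q = {\<beta>. 0 \<le> Re \<beta> \<and> Re \<beta> < 1 \<and> 0 \<le> Im \<beta> \<and> Im \<beta> < \<bar>alpha q\<bar>}"

definition is_partition :: "(nat \<Rightarrow> nat) \<Rightarrow> bool" where
  "is_partition lam \<longleftrightarrow> antimono lam \<and> finite {i. lam i \<noteq> 0}"

definition skew_shape :: "(int \<times> int) set \<Rightarrow> bool" where
  "skew_shape Y \<longleftrightarrow> (\<exists>lam mu r0 s0. is_partition lam \<and> is_partition mu \<and> (\<forall>i. mu i \<le> lam i)
     \<and> Y = {(r0 + int i, s0 + int j) | i j. mu i \<le> j \<and> j < lam i})"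

definition placed_skew_shape :: "real \<Rightarrow> nat \<Rightarrow> box set \<Rightarrow> bool" where
  "placed_skew_shape q n S \<longleftrightarrow> finite S \<and> card S = n
     \<and> (\<forall>(\<beta>, r, s)\<in>S. \<beta> \<in> pages q)
     \<and> (\<forall>\<beta>\<in>pages q. skew_shape {(r, s). (\<beta>, r, s) \<in> S})"

fun content :: "box \<Rightarrow> complex" where
  "content (\<beta>, r, s) = \<beta> + of_int (s - r)"

fun adjacent :: "box \<Rightarrow> box \<Rightarrow> bool" where
  "adjacent (\<beta>, r, s) (\<beta>', r', s') \<longleftrightarrow> \<beta> = \<beta>' \<and> \<bar>r - r'\<bar> + \<bar>s - s'\<bar> = 1"

definition same_component :: "box set \<Rightarrow> box \<Rightarrow> box \<Rightarrow> bool" where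
  "same_component S b b' \<longleftrightarrow> (b, b') \<in> {(x, y). x \<in> S \<and> y \<in> S \<and> adjacent x y}\<^sup>*"

text \<open>Pages are complex numbers, so the difference of two boxes is the displacement between them.\<close>

definition translation_on_components :: "box set \<Rightarrow> (box \<Rightarrow> box) \<Rightarrow> bool" where
  "translation_on_components S f \<longleftrightarrow> (\<forall>b\<in>S. \<forall>b'\<in>S. same_component S b b' \<longrightarrow>
     fst (snd (f b)) - fst (snd b) = fst (snd (f b')) - fst (snd b')
     \<and> snd (snd (f b)) - snd (snd b) = snd (snd (f b')) - snd (snd b'))"

definition book_identification :: "box set \<Rightarrow> box set \<Rightarrow> (box \<Rightarrow> box) \<Rightarrow> bool" where
  "book_identification S S' f \<longleftrightarrow> bij_betw f S S'
     \<and> (\<forall>b\<in>S. content (f b) = content b)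
     \<and> translation_on_components S f"

definition book_eq :: "box set \<Rightarrow> box set \<Rightarrow> bool" where
  "book_eq S S' \<longleftrightarrow> (\<exists>f. book_identification S S' f)"

fun shift_box :: "real \<Rightarrow> nat \<Rightarrow> box \<Rightarrow> box" where
  "shift_box q p (\<beta>, r, s) = (Complex (Re \<beta>) ((Im \<beta> - alpha q / real p) rmod \<bar>alpha q\<bar>), r, s)"

definition shape_g :: "real \<Rightarrow> nat \<Rightarrow> box set \<Rightarrow> box set" where
  "shape_g q p S = shift_box q p ` S"

definition kappa :: "real \<Rightarrow> nat \<Rightarrow> box set \<Rightarrow> nat" where
  "kappa q p S = (LEAST k. 1 \<le> k \<and> k \<le> p \<and> book_eq ((shape_g q p ^^ k) S) S)"


section \<open>Standard tableaux\<close>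

definition standard_tableaux :: "nat \<Rightarrow> box set \<Rightarrow> (nat \<Rightarrow> box) set" where
  "standard_tableaux n S = {L. L \<in> extensional {1..n} \<and> bij_betw L {1..n} S
     \<and> (\<forall>i\<in>{1..n}. \<forall>j\<in>{1..n}. \<forall>\<beta> r s r' s'. L i = (\<beta>, r, s) \<and> L j = (\<beta>, r', s')
          \<and> (r = r' \<and> s < s' \<or> s = s' \<and> r < r') \<longrightarrow> i < j)}"

definition swap_tab :: "nat \<Rightarrow> (nat \<Rightarrow> box) \<Rightarrow> (nat \<Rightarrow> box)" where
  "swap_tab i L = L(i - 1 := L i, i := L (i - 1))"

text \<open>For \<open>g\<^sup>k\<close> in the stabilizer of \<open>S\<close>, the identification of \<open>g\<^sup>k S\<close> with \<open>S\<close> is unique on boxes.\<close>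

definition tab_g :: "real \<Rightarrow> nat \<Rightarrow> nat \<Rightarrow> box set \<Rightarrow> nat \<Rightarrow> (nat \<Rightarrow> box) \<Rightarrow> (nat \<Rightarrow> box)" where
  "tab_g q p n S k L =
     (let f = (SOME f. book_identification ((shape_g q p ^^ k) S) S f)
      in restrict (\<lambda>i. f ((shift_box q p ^^ k) (L i))) {1..n})"


section \<open>The calibrated modules\<close>

text \<open>\<open>qpow q x\<close> is \<open>q\<close> to the power \<open>2 x\<close>.\<close>

definition qpow :: "real \<Rightarrow> complex \<Rightarrow> complex" where
  "qpow q x = exp (of_real (ln (q\<^sup>2)) * x)"

definition T_diag :: "real \<Rightarrow> nat \<Rightarrow> (nat \<Rightarrow> box) \<Rightarrow> complex" where
  "T_diag q i L = of_real (q - inverse q) / (1 - qpow q (content (L (i - 1)) - content (L i)))"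

text \<open>\<open>M\<close> is the module of the placed skew shape \<open>S\<close>, with basis vectors \<open>v L\<close>.\<close>

definition skew_module ::
    "nat \<Rightarrow> real \<Rightarrow> box set \<Rightarrow> (hecke_elt, 'b, 'k) module_scheme \<Rightarrow> ((nat \<Rightarrow> box) \<Rightarrow> 'b) \<Rightarrow> bool" where
  "skew_module n q S M v \<longleftrightarrow> left_module (hecke n q) M
     \<and> finite_basis (hecke_scalar n q) M (standard_tableaux n S) v
     \<and> (\<forall>L\<in>standard_tableaux n S. \<forall>i\<in>{1..n}.
          hecke_X n q (eps i) \<odot>\<^bsub>M\<^esub> v L = hecke_scalar n q (qpow q (content (L i))) \<odot>\<^bsub>M\<^esub> v L)
     \<and> (\<forall>L\<in>standard_tableaux n S. \<forall>i\<in>{2..n}.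
          hecke_T n q i \<odot>\<^bsub>M\<^esub> v L =
            hecke_scalar n q (T_diag q i L) \<odot>\<^bsub>M\<^esub> v L
            \<oplus>\<^bsub>M\<^esub> hecke_scalar n q (of_real (inverse q) + T_diag q i L) \<odot>\<^bsub>M\<^esub>
                (if swap_tab i L \<in> standard_tableaux n S then v (swap_tab i L) else \<zero>\<^bsub>M\<^esub>))"

definition module_g ::
    "nat \<Rightarrow> real \<Rightarrow> nat \<Rightarrow> box set \<Rightarrow> (hecke_elt, 'b, 'k) module_scheme \<Rightarrow> ((nat \<Rightarrow> box) \<Rightarrow> 'b)
      \<Rightarrow> nat \<Rightarrow> 'b \<Rightarrow> 'b" where
  "module_g n q p S M v k =
     linear_ext (hecke_scalar n q) M (standard_tableaux n S) v (\<lambda>L. v (tab_g q p n S k L))"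

definition proj ::
    "nat \<Rightarrow> real \<Rightarrow> nat \<Rightarrow> box set \<Rightarrow> (hecke_elt, 'b, 'k) module_scheme \<Rightarrow> ((nat \<Rightarrow> box) \<Rightarrow> 'b)
      \<Rightarrow> nat \<Rightarrow> 'b \<Rightarrow> 'b" where
  "proj n q p S M v j m =
     (\<Oplus>\<^bsub>M\<^esub>l\<in>{..<card (inertia_group n q p M)}.
        hecke_scalar n q (cis (2 * pi / real p) powi (- (int j * int l * int (kappa q p S))))
          \<odot>\<^bsub>M\<^esub> module_g n q p S M v (l * kappa q p S) m)"

definition proj_module ::
    "nat \<Rightarrow> real \<Rightarrow> nat \<Rightarrow> box set \<Rightarrow> (hecke_elt, 'b, 'k) module_scheme \<Rightarrow> ((nat \<Rightarrow> box) \<Rightarrow> 'b)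
      \<Rightarrow> nat \<Rightarrow> (hecke_elt, 'b, 'k) module_scheme" where
  "proj_module n q p S M v j = M\<lparr>carrier := proj n q p S M v j ` carrier M\<rparr>"

end

theory Submission
  imports Defs
begin

text \<open>
  The joint eigenvalues of the \<open>X\<^sup>\<lambda>\<close> on \<open>v L\<close> record the contents of \<open>L\<close>, and the sequence of
  contents of a standard tableau determines both the tableau and its book. Since twisting by
  \<open>g\<close> divides the eigenvalues of every \<open>X\<close> by \<open>\<xi>\<close>, the inertia group is the stabilizer of the
  book, consisting of the multiples of \<open>\<kappa>\<close>. For \<open>\<lambda>\<close> in \<open>L\<^sub>p\<close> two tableaux have the same
  eigenvalues precisely if their weights differ by a common \<open>p\<close>-th root of unity, that is, if
  they lie in one orbit of \<open>g\<^sup>\<kappa>\<close>. This group acts freely on the tableaux, so the images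
  \<open>p\<^sub>j v L\<close> of representatives \<open>L\<close> of the orbits are eigenvectors for distinct characters and form a
  basis. A nonzero submodule therefore contains some \<open>p\<^sub>j v L\<close>; as \<open>T\<^sub>i\<close> commutes with
  \<open>g\<^sup>\<kappa>\<close> and all standard tableaux are connected by transpositions \<open>s\<^sub>i\<close> with nonzero matrix
  coefficient, it contains all of them.
\<close>

section \<open>Books and standard tableaux\<close>

text \<open>Three notions of symmetry have to be matched: \<open>kappa\<close> is defined through
  equality of books, the inertia group through isomorphism of modules, and the subalgebra sees only
  the X^\<lambda> with \<lambda> in L_p. The weights q^(2c) of a tableau are their common language.
  Since \<alpha> ln(q^2) = 2 \<pi>, moving the pages by -i \<alpha>/p multiplies all weights by
  \<xi>^-1, and a common factor does not change ratios of weights, on which alone the diagonal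
  coefficients of the T_i depend. Convexity of skew shapes is what allows a book to be read off from
  contents: an identification of books is a translation only on each component, but boxes on equal
  or neighbouring diagonals of one page always lie in one component. Two objects are given by
  choice, the identification behind \<open>tab_g\<close> and the automorphism
  \<open>hecke_g\<close>. The first choice is harmless because weights determine tableaux. For the
  second an automorphism has to be exhibited; it scales a braid according to the exponent sum of X
  in it.\<close>

text \<open>Convexity for the product order is the property of skew shapes that the arguments rest
  on. In this form it passes to shifted books at once, without carrying partitions along, and it
  also covers a single box placed anywhere on a page.\<close>

definition book :: "real \<Rightarrow> box set \<Rightarrow> bool" where
  "book q S \<longleftrightarrow> finite S \<and> (\<forall>\<beta> r s. (\<beta>, r, s) \<in> S \<longrightarrow> \<beta> \<in> pages q)
     \<and> (\<forall>\<beta> r s r' s' r'' s''. (\<beta>, r, s) \<in> S \<and> (\<beta>, r'', s'') \<in> S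
          \<and> r \<le> r' \<and> r' \<le> r'' \<and> s \<le> s' \<and> s' \<le> s'' \<longrightarrow> (\<beta>, r', s') \<in> S)"

lemma book_finite: "book q S \<Longrightarrow> finite S"
  by (simp add: book_def)

lemma book_page: "book q S \<Longrightarrow> (\<beta>, r, s) \<in> S \<Longrightarrow> \<beta> \<in> pages q"
  unfolding book_def by blast

lemma book_convex:
  assumes "book q S" "(\<beta>, r, s) \<in> S" "(\<beta>, r'', s'') \<in> S" "r \<le> r'" "r' \<le> r''" "s \<le> s'" "s' \<le> s''"
  shows "(\<beta>, r', s') \<in> S"
  using assms unfolding book_def by blast

text \<open>Both ends of a row move weakly left as one goes down. So a middle row starts no further
  right than the upper one and ends no further left than the lower one.\<close>

lemma skew_shape_convex:
  assumes "skew_shape Y" "(r, s) \<in> Y" "(r'', s'') \<in> Y"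
    "r \<le> r'" "r' \<le> r''" "s \<le> s'" "s' \<le> s''"
  shows "(r', s') \<in> Y"
proof -
  obtain lam mu r0 s0 where l: "antimono lam" "antimono mu"
    and Y: "Y = {(r0 + int i, s0 + int j) | i j. mu i \<le> j \<and> j < lam i}"
    using assms(1) unfolding skew_shape_def is_partition_def by auto
  obtain i j where 1: "r = r0 + int i" "s = s0 + int j" "mu i \<le> j" using assms(2) Y by auto
  obtain i2 j2 where 2: "r'' = r0 + int i2" "s'' = s0 + int j2" "j2 < lam i2" using assms(3) Y by auto
  define i1 j1 where ij: "i1 = nat (r' - r0)" "j1 = nat (s' - s0)"
  have e: "r' = r0 + int i1" "s' = s0 + int j1" "i \<le> i1" "i1 \<le> i2" "j \<le> j1" "j1 \<le> j2"
    using assms 1 2 by (auto simp: ij)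
  have "mu i1 \<le> mu i" "lam i2 \<le> lam i1" using l e by (auto simp: antimono_def)
  then have "mu i1 \<le> j1" "j1 < lam i1" using 1 2 e by auto
  then show ?thesis unfolding Y using e by blast
qed

lemma placed_skew_shape_book:
  assumes "placed_skew_shape q n S" shows "book q S"
  unfolding book_def
proof (intro conjI allI impI)
  show "finite S" using assms by (simp add: placed_skew_shape_def)
  show pg: "\<beta> \<in> pages q" if "(\<beta>, r, s) \<in> S" for \<beta> r s
    using assms that by (auto simp: placed_skew_shape_def)
  show "(\<beta>, r', s') \<in> S" if h: "(\<beta>, r, s) \<in> S \<and> (\<beta>, r'', s'') \<in> S
          \<and> r \<le> r' \<and> r' \<le> r'' \<and> s \<le> s' \<and> s' \<le> s''" for \<beta> r s r' s' r'' s''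
  proof -
    have "skew_shape {(r, s). (\<beta>, r, s) \<in> S}"
      using assms h pg by (auto simp: placed_skew_shape_def)
    from skew_shape_convex[OF this, of r s r'' s'' r' s'] show ?thesis using h by auto
  qed
qed

text \<open>Pages have real part in [0,1), so the floor of the real part of a content is the index
  of the diagonal and the rest is the page.\<close>

lemma content_inj:
  assumes "\<beta> \<in> pages q" "\<beta>' \<in> pages q" "content (\<beta>, r, s) = content (\<beta>', r', s')"
  shows "\<beta> = \<beta>' \<and> s - r = s' - r'"
proof -
  have re: "Re \<beta> + of_int (s - r) = Re \<beta>' + of_int (s' - r')" and im: "Im \<beta> = Im \<beta>'"
    using assms(3) by (auto simp: complex_eq_iff)
  have "\<lfloor>Re \<beta> + of_int (s - r)\<rfloor> = s - r" "\<lfloor>Re \<beta>' + of_int (s' - r')\<rfloor> = s' - r'"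
    using assms(1,2) by (auto simp: pages_def floor_eq_iff)
  with re have "s - r = s' - r'" by metis
  with re im show ?thesis by (auto simp: complex_eq_iff)
qed

text \<open>Boxes on equal or neighbouring diagonals are comparable, so on such diagonals the
  antidiagonal index \<open>r + s\<close> orders the boxes as any standard tableau does.\<close>

lemma near_diagonals_comparable:
  fixes r s r' s' :: int
  assumes "\<bar>(s - r) - (s' - r')\<bar> \<le> 1" "r + s < r' + s'"
  shows "r \<le> r' \<and> s \<le> s'"
  using assms by arith

section \<open>Order of entries in a standard tableau and position of their boxes\<close>

lemma tableau_bij: "L \<in> standard_tableaux n S \<Longrightarrow> bij_betw L {1..n} S"
  by (simp add: standard_tableaux_def)

lemma tableau_extensional: "L \<in> standard_tableaux n S \<Longrightarrow> L \<in> extensional {1..n}"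
  by (simp add: standard_tableaux_def)

lemma tableau_row_column:
  assumes "L \<in> standard_tableaux n S" "i \<in> {1..n}" "j \<in> {1..n}" "L i = (\<beta>, r, s)" "L j = (\<beta>, r', s')"
    "r = r' \<and> s < s' \<or> s = s' \<and> r < r'"
  shows "i < j"
  using assms unfolding standard_tableaux_def by blast

text \<open>Standardness compares only boxes in a common row or column. Convexity puts the corner
  \<open>(r, s')\<close> into the shape, and the entry there lies between the two.\<close>

lemma tableau_less:
  assumes "book q S" "L \<in> standard_tableaux n S" "i \<in> {1..n}" "j \<in> {1..n}"
    and "L i = (\<beta>, r, s)" "L j = (\<beta>, r', s')" "r \<le> r'" "s \<le> s'" "(r, s) \<noteq> (r', s')"
  shows "i < j"
proof -
  note bij = tableau_bij[OF assms(2)] and std = tableau_row_column[OF assms(2)]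
  have in_S: "(\<beta>, r, s) \<in> S" "(\<beta>, r', s') \<in> S"
    using bij assms(3-6) by (metis bij_betwE)+
  have "(\<beta>, r, s') \<in> S" using book_convex[OF assms(1) in_S] assms by auto
  then obtain k where k: "k \<in> {1..n}" "L k = (\<beta>, r, s')" using bij by (metis bij_betw_def imageE)
  show ?thesis
  proof (cases "s < s'")
    case True
    then have "i < k" using std[OF assms(3) k(1) assms(5) k(2)] by simp
    show ?thesis
    proof (cases "r < r'")
      case True
      then have "k < j" using std[OF k(1) assms(4) k(2) assms(6)] by simp
      with \<open>i < k\<close> show ?thesis by simp
    next
      case False
      with \<open>s < s'\<close> show ?thesis using std[OF assms(3,4,5,6)] assms(7) by simp
    qed
  next
    case False
    then show ?thesis using std[OF assms(3,4,5,6)] assms(7-9) by auto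
  qed
qed

text \<open>On such diagonals any two distinct boxes are comparable, and \<open>r + s\<close>
  separates them: equal sums make the difference of the diagonals even, hence zero. Comparison of
  entries thereby becomes integer arithmetic.\<close>

lemma tableau_near_less_iff:
  assumes "book q S" "L \<in> standard_tableaux n S" "i \<in> {1..n}" "j \<in> {1..n}"
    and "L i = (\<beta>, r, s)" "L j = (\<beta>, r', s')" "\<bar>(s - r) - (s' - r')\<bar> \<le> 1"
  shows "i < j \<longleftrightarrow> r + s < r' + s'"
proof -
  have lt: "r + s < r' + s' \<Longrightarrow> i < j"
    using near_diagonals_comparable[OF assms(7)] tableau_less[OF assms(1-6)] by auto
  have gt: "r' + s' < r + s \<Longrightarrow> j < i"
    using near_diagonals_comparable[of s' r' s r] assms(7)
      tableau_less[OF assms(1,2,4,3,6,5)] by auto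
  have eq: "r + s = r' + s' \<Longrightarrow> i = j"
  proof -
    assume e: "r + s = r' + s'"
    with assms(7) have "r = r' \<and> s = s'" by arith
    then have "L i = L j" using assms by simp
    moreover have "inj_on L {1..n}" using assms(2) by (auto simp: standard_tableaux_def bij_betw_def)
    ultimately show "i = j" using assms(3,4) by (meson inj_onD)
  qed
  show ?thesis
  proof
    assume "i < j"
    show "r + s < r' + s'"
    proof (rule ccontr)
      assume "\<not> r + s < r' + s'"
      then show False using gt eq \<open>i < j\<close> by (cases "r' + s' < r + s") auto
    qed
  qed (rule lt)
qed

lemma tableau_surj:
  assumes "L \<in> standard_tableaux n S" "b \<in> S"
  obtains i where "i \<in> {1..n}" "L i = b"
  using assms by (auto simp: standard_tableaux_def bij_betw_def)

lemma tableau_in: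
  assumes "L \<in> standard_tableaux n S" "i \<in> {1..n}"
  shows "L i \<in> S"
  using assms by (auto simp: standard_tableaux_def bij_betw_def)

lemma tableau_inj:
  assumes "L \<in> standard_tableaux n S" shows "inj_on L {1..n}"
  using assms by (auto simp: standard_tableaux_def bij_betw_def)

section \<open>Books and tableaux recovered from their sequences of contents\<close>

lemma same_content_split:
  assumes "book q S" "book q S'" "(\<beta>, r, s) \<in> S" "b \<in> S'" "content b = content (\<beta>, r, s)"
  obtains u t where "b = (\<beta>, u, t)" "t - u = s - r"
proof -
  obtain \<beta>' u t where b: "b = (\<beta>', u, t)" by (cases b)
  have "\<beta>' \<in> pages q" "\<beta> \<in> pages q" using assms b unfolding book_def by blast+
  with content_inj[of \<beta>' q \<beta> u t r s] assms(5) b that show ?thesis by auto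
qed

text \<open>Contents fix the diagonals, so only the distance along them can differ between the two
  books. If it were larger in \<open>S'\<close>, another box of \<open>S'\<close> on the diagonal of
  \<open>j\<close> would carry an entry strictly between \<open>i\<close> and \<open>j\<close>; the
  box of \<open>S\<close> with that entry would then lie strictly between two neighbours.\<close>

lemma tableaux_adjacent_step:
  assumes S: "book q S" and S': "book q S'"
    and L: "L \<in> standard_tableaux n S" and L': "L' \<in> standard_tableaux n S'"
    and cont: "\<And>i. i \<in> {1..n} \<Longrightarrow> content (L' i) = content (L i)"
    and i: "i \<in> {1..n}" "L i = (\<beta>, r, s)" and j: "j \<in> {1..n}" "L j = (\<beta>, r', s')"
    and adj: "\<bar>r - r'\<bar> + \<bar>s - s'\<bar> = 1" and less: "r + s < r' + s'"
    and L'i: "L' i = (\<beta>, u, t)" and L'j: "L' j = (\<beta>, u', t')"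
  shows "u' - u = r' - r \<and> t' - t = s' - s"
proof -
  have "(\<beta>, r, s) \<in> S" "(\<beta>, r', s') \<in> S" using tableau_in[OF L] i j by metis+
  have in_S': "(\<beta>, u, t) \<in> S'" "(\<beta>, u', t') \<in> S'" using tableau_in[OF L'] i j L'i L'j by metis+
  have d: "t - u = s - r" 
    by (rule same_content_split[OF S S' \<open>(\<beta>, r, s) \<in> S\<close> in_S'(1)]) (use cont[OF i(1)] i L'i in auto)
  have d': "t' - u' = s' - r'"
    by (rule same_content_split[OF S S' \<open>(\<beta>, r', s') \<in> S\<close> in_S'(2)]) (use cont[OF j(1)] j L'j in auto)
  have st: "r' = r \<and> s' = s + 1 \<or> r' = r + 1 \<and> s' = s" using adj less by arith
  have ij: "i < j" using tableau_near_less_iff[OF S L i(1) j(1) i(2) j(2)] st by auto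
  then have ht: "u + t < u' + t'"
    using tableau_near_less_iff[OF S' L' i(1) j(1) L'i L'j] st d d' by auto
  have "u' + t' \<le> u + t + 1"
  proof (rule ccontr)
    assume far: "\<not> u' + t' \<le> u + t + 1"
    \<comment> \<open>The neighbour of \<open>L' i\<close> in the direction that leads from
      \<open>L i\<close> to \<open>L j\<close>; it lies on the diagonal of \<open>L' j\<close> and
      in the rectangle spanned by \<open>L' i\<close> and \<open>L' j\<close>.\<close>
    define x y where xy: "x = u + (r' - r)" "y = t + (s' - s)"
    have "u \<le> x \<and> x \<le> u' \<and> t \<le> y \<and> y \<le> t'" using far st d d' unfolding xy by auto
    then have "(\<beta>, x, y) \<in> S'" using book_convex[OF S' in_S'] by auto
    then obtain k where k: "k \<in> {1..n}" "L' k = (\<beta>, x, y)" using tableau_surj[OF L'] by metis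
    have ik: "i < k" using tableau_near_less_iff[OF S' L' i(1) k(1) L'i k(2)] st xy d by auto
    have kj: "k < j" using tableau_near_less_iff[OF S' L' k(1) j(1) k(2) L'j] st xy d d' far by auto
    obtain z w where zw: "L k = (\<beta>, z, w)" "w - z = y - x"
      by (rule same_content_split[OF S' S \<open>(\<beta>, x, y) \<in> S'\<close> tableau_in[OF L k(1)]])
         (use cont[OF k(1)] k in auto)
    have "r + s < z + w" using ik tableau_near_less_iff[OF S L i(1) k(1) i(2) zw(1)] st xy d zw by auto
    moreover have "z + w < r' + s'"
      using kj tableau_near_less_iff[OF S L k(1) j(1) zw(1) j(2)] st xy d zw by auto
    ultimately show False using st by auto
  qed
  then show ?thesis using ht d d' st by auto
qed

text \<open>The identification matches boxes with the same entry. Adjacent boxes undergo the same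
  displacement, and this propagates along chains of adjacent boxes, that is, over a
  component.\<close>

lemma identification_of_same_contents:
  assumes S: "book q S" and S': "book q S'"
    and L: "L \<in> standard_tableaux n S" and L': "L' \<in> standard_tableaux n S'"
    and cont: "\<And>i. i \<in> {1..n} \<Longrightarrow> content (L' i) = content (L i)"
  shows "book_eq S S'"
proof -
  have bij: "bij_betw L {1..n} S" and bij': "bij_betw L' {1..n} S'"
    using L L' by (auto simp: standard_tableaux_def)
  define f where "f b = L' (inv_into {1..n} L b)" for b
  have fL: "f (L i) = L' i" if "i \<in> {1..n}" for i
    using that bij by (simp add: f_def bij_betw_def)
  have fbij: "bij_betw f S S'"
    using bij_betw_trans[OF bij_betw_inv_into[OF bij] bij'] by (simp add: f_def[abs_def] o_def)
  have fcont: "content (f b) = content b" if "b \<in> S" for b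
    using that by (rule tableau_surj[OF L]) (use fL cont in auto)
  have unit: "fst (snd (f b)) - fst (snd b) = fst (snd (f b')) - fst (snd b')
     \<and> snd (snd (f b)) - snd (snd b) = snd (snd (f b')) - snd (snd b')"
    if b: "b \<in> S" "b' \<in> S" "adjacent b b'" for b b'
  proof -
    obtain \<beta> r s r' s' where e: "b = (\<beta>, r, s)" "b' = (\<beta>, r', s')"
      and adj: "\<bar>r - r'\<bar> + \<bar>s - s'\<bar> = 1"
      using b(3) by (cases b; cases b') auto
    obtain i where i: "i \<in> {1..n}" "L i = b" using tableau_surj[OF L b(1)] .
    obtain j where j: "j \<in> {1..n}" "L j = b'" using tableau_surj[OF L b(2)] .
    obtain u t where ut: "L' i = (\<beta>, u, t)"
      by (rule same_content_split[OF S S' _ tableau_in[OF L' i(1)]]) (use b cont i e in auto)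
    obtain u' t' where ut': "L' j = (\<beta>, u', t')"
      by (rule same_content_split[OF S S' _ tableau_in[OF L' j(1)]]) (use b cont j e in auto)
    have "r + s \<noteq> r' + s'" using adj by arith
    \<comment> \<open>The preceding lemma expects the upper left one of the two neighbours first,
      hence the two cases.\<close>
    then have "u' - u = r' - r \<and> t' - t = s' - s"
    proof (cases "r + s < r' + s'")
      case True
      then show ?thesis using tableaux_adjacent_step[OF S S' L L' cont i(1) _ j(1) _ adj] i j e ut ut'
        by auto
    next
      case False
      have "\<bar>r' - r\<bar> + \<bar>s' - s\<bar> = 1" using adj by arith
      moreover have "r' + s' < r + s" using False \<open>r + s \<noteq> r' + s'\<close> by simp
      ultimately have "u - u' = r - r' \<and> t - t' = s - s'"
        using tableaux_adjacent_step[OF S S' L L' cont j(1) _ i(1), of \<beta> r' s' r s u' t' u t]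
          i j e ut ut' by simp
      then show ?thesis by linarith
    qed
    then show ?thesis using fL[OF i(1)] fL[OF j(1)] i j e ut ut' by auto
  qed
  have "translation_on_components S f"
    unfolding translation_on_components_def same_component_def
  proof (intro ballI impI)
    fix b b' assume "b \<in> S" "b' \<in> S" and "(b, b') \<in> {(x, y). x \<in> S \<and> y \<in> S \<and> adjacent x y}\<^sup>*"
    from this(3) show "fst (snd (f b)) - fst (snd b) = fst (snd (f b')) - fst (snd b')
       \<and> snd (snd (f b)) - snd (snd b) = snd (snd (f b')) - snd (snd b')"
    proof (induction rule: rtrancl_induct)
      case (step y z)
      then have "y \<in> S" "z \<in> S" "adjacent y z" by auto
      from unit[OF this] step.IH show ?case by simp
    qed simp
  qed
  then show ?thesis using fbij fcont by (auto simp: book_eq_def book_identification_def)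
qed

text \<open>A staircase path joins the two boxes: every step goes right or down towards the target
  diagonal and stays in the rectangle spanned by the endpoints, which convexity keeps inside the
  shape.\<close>

lemma near_diagonals_same_component:
  assumes "book q S" "(\<beta>, r, s) \<in> S" "(\<beta>, r', s') \<in> S"
    "\<bar>(s - r) - (s' - r')\<bar> \<le> 1" "r + s \<le> r' + s'"
  shows "same_component S (\<beta>, r, s) (\<beta>, r', s')"
  using assms
proof (induction "nat (r' + s' - (r + s))" arbitrary: r s rule: less_induct)
  case less
  show ?case
  proof (cases "r + s = r' + s'")
    case True
    then have "r = r' \<and> s = s'" using less.prems by arith
    then show ?thesis by (simp add: same_component_def)
  next
    case False
    \<comment> \<open>A step down lowers the diagonal index by one and is taken when the target
      diagonal is lower; otherwise a step to the right is taken. The distance between the diagonals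
      thus stays at most one.\<close>
    define x y where "x = (if s' - r' < s - r then r + 1 else r)"
      and "y = (if s' - r' < s - r then s else s + 1)"
    have xy: "r \<le> x" "x \<le> r'" "s \<le> y" "y \<le> s'" "x + y = r + s + 1"
      "\<bar>(y - x) - (s' - r')\<bar> \<le> 1" "\<bar>r - x\<bar> + \<bar>s - y\<bar> = 1" "x + y \<le> r' + s'"
      using less.prems(4,5) False unfolding x_def y_def by (auto split: if_splits)
    have inS: "(\<beta>, x, y) \<in> S" using book_convex[OF less.prems(1-3)] xy by blast
    have "same_component S (\<beta>, x, y) (\<beta>, r', s')"
      by (rule less.hyps) (use xy inS less.prems False in auto)
    moreover have "adjacent (\<beta>, r, s) (\<beta>, x, y)" using xy by simp
    ultimately show ?thesis using inS less.prems(2) unfolding same_component_def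
      by (blast intro: converse_rtrancl_into_rtrancl)
  qed
qed

text \<open>Rows and columns of a convex shape have no gaps, so increase along unit steps chains to
  increase along whole rows and columns.\<close>

lemma tableau_of_unit_steps:
  assumes S: "book q S" and ext: "L \<in> extensional {1..n}" and bij: "bij_betw L {1..n} S"
    and step: "\<And>i j \<beta> r s r' s'. i \<in> {1..n} \<Longrightarrow> j \<in> {1..n} \<Longrightarrow> L i = (\<beta>, r, s) \<Longrightarrow>
       L j = (\<beta>, r', s') \<Longrightarrow> r' = r \<and> s' = s + 1 \<or> r' = r + 1 \<and> s' = s \<Longrightarrow> i < j"
  shows "L \<in> standard_tableaux n S"
proof -
  have "i < j" if "i \<in> {1..n}" "j \<in> {1..n}" "L i = (\<beta>, r, s)" "L j = (\<beta>, r', s')"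
    "r = r' \<and> s < s' \<or> s = s' \<and> r < r'" for i j \<beta> r s r' s'
    using that
  proof (induction "nat (r' + s' - (r + s))" arbitrary: i r s rule: less_induct)
    case less
    define x y where "x = (if r = r' then r else r + 1)" and "y = (if r = r' then s + 1 else s)"
    have xy: "x = r \<and> y = s + 1 \<or> x = r + 1 \<and> y = s" "r \<le> x" "x \<le> r'" "s \<le> y" "y \<le> s'"
      "x + y = r + s + 1"
      using less.prems(5) unfolding x_def y_def by auto
    have "(\<beta>, r, s) \<in> S" "(\<beta>, r', s') \<in> S" using less.prems bij by (metis bij_betwE)+
    then have "(\<beta>, x, y) \<in> S" using book_convex[OF S] xy by blast
    then obtain k where k: "k \<in> {1..n}" "L k = (\<beta>, x, y)" using bij by (metis bij_betw_def imageE)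
    have ik: "i < k" using step[OF less.prems(1) k(1) less.prems(3) k(2)] xy by simp
    show ?case
    proof (cases "(x, y) = (r', s')")
      case True
      then have "k = j" using inj_onD[OF bij_betw_imp_inj_on[OF bij], of k j] k less.prems by simp
      with ik show ?thesis by simp
    next
      case False
      have "k < j" by (rule less.hyps[OF _ k(1) less.prems(2) k(2) less.prems(4)])
        (use False xy less.prems(5) in \<open>auto simp: x_def y_def split: if_splits\<close>)
      with ik show ?thesis by simp
    qed
  qed
  then show ?thesis using ext bij unfolding standard_tableaux_def by blast
qed

text \<open>The danger is that adjacent boxes of \<open>S'\<close> come from different components of
  \<open>S\<close>, about whose relative position the identification says nothing. Equality of
  contents excludes this: the preimages lie on one page and on neighbouring diagonals, hence in one
  component, and their displacement is preserved.\<close>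

lemma tableau_of_identification:
  assumes S: "book q S" and S': "book q S'" and f: "book_identification S S' f"
    and L: "L \<in> standard_tableaux n S"
  shows "restrict (\<lambda>i. f (L i)) {1..n} \<in> standard_tableaux n S'"
proof (rule tableau_of_unit_steps[OF S'])
  have bij: "bij_betw L {1..n} S" using L by (auto simp: standard_tableaux_def)
  have fb: "bij_betw f S S'" and fc: "\<And>b. b \<in> S \<Longrightarrow> content (f b) = content b"
    and tr: "translation_on_components S f"
    using f by (auto simp: book_identification_def)
  have "bij_betw (f \<circ> L) {1..n} S'" by (rule bij_betw_trans[OF bij fb])
  then show "bij_betw (restrict (\<lambda>i. f (L i)) {1..n}) {1..n} S'"
    by (rule bij_betw_cong[THEN iffD1, rotated]) auto
  fix i j \<beta> r s r' s'
  assume ij: "i \<in> {1..n}" "j \<in> {1..n}"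
    and "restrict (\<lambda>i. f (L i)) {1..n} i = (\<beta>, r, s)" "restrict (\<lambda>i. f (L i)) {1..n} j = (\<beta>, r', s')"
    and st: "r' = r \<and> s' = s + 1 \<or> r' = r + 1 \<and> s' = s"
  then have fi: "f (L i) = (\<beta>, r, s)" and fj: "f (L j) = (\<beta>, r', s')" by auto
  have in_S: "L i \<in> S" "L j \<in> S" using tableau_in[OF L] ij by auto
  then have in_S': "(\<beta>, r, s) \<in> S'" "(\<beta>, r', s') \<in> S'" using fb fi fj by (metis bij_betwE)+
  obtain u t where i: "L i = (\<beta>, u, t)" "t - u = s - r"
    by (rule same_content_split[OF S' S in_S'(1) in_S(1)]) (use fc[OF in_S(1)] fi in auto)
  obtain u' t' where j: "L j = (\<beta>, u', t')" "t' - u' = s' - r'"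
    by (rule same_content_split[OF S' S in_S'(2) in_S(2)]) (use fc[OF in_S(2)] fj in auto)
  have "same_component S (L i) (L j) \<or> same_component S (L j) (L i)"
    using near_diagonals_same_component[OF S, of \<beta> u t u' t']
      near_diagonals_same_component[OF S, of \<beta> u' t' u t] in_S i j st
    by (cases "u + t \<le> u' + t'") auto
  then have "u' - u = r' - r \<and> t' - t = s' - s"
    using tr in_S fi fj i j unfolding translation_on_components_def by fastforce
  then show "i < j" using tableau_less[OF S L ij i(1) j(1)] st by auto
qed auto

text \<open>At the first disagreement \<open>i\<close> the two boxes lie on one diagonal, which is
  linearly ordered. The box that \<open>L'\<close> gives to \<open>i\<close> occurs in
  \<open>L\<close> no earlier than \<open>i\<close>, since all earlier entries agree, and vice
  versa; so neither box precedes the other.\<close>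

lemma tableau_determined_by_contents:
  assumes S: "book q S" and L: "L \<in> standard_tableaux n S" and L': "L' \<in> standard_tableaux n S"
    and cont: "\<And>i. i \<in> {1..n} \<Longrightarrow> content (L' i) = content (L i)"
  shows "L' = L"
proof -
  have "L' i = L i" if "i \<in> {1..n}" for i
    using that
  proof (induction i rule: less_induct)
    case (less i)
    have later: "i \<le> k" if "k \<in> {1..n}" "(A k = B i \<and> A = L \<and> B = L') \<or> (A k = B i \<and> A = L' \<and> B = L)" for k A B
    proof (rule ccontr)
      assume "\<not> i \<le> k"
      then have "L' k = L k" using less.IH that by auto
      then show False using that less.prems \<open>\<not> i \<le> k\<close> tableau_inj[OF L] tableau_inj[OF L']
        by (metis inj_onD nle_le)
    qed
    obtain \<beta> r s where b: "L i = (\<beta>, r, s)" by (cases "L i")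
    have inS: "(\<beta>, r, s) \<in> S" using tableau_in[OF L less.prems] b by simp
    obtain u t where b': "L' i = (\<beta>, u, t)" "t - u = s - r"
      by (rule same_content_split[OF S S inS tableau_in[OF L' less.prems]])
         (use cont[OF less.prems] b in auto)
    obtain k where k: "k \<in> {1..n}" "L k = L' i" using tableau_surj[OF L tableau_in[OF L' less.prems]] .
    obtain k' where k': "k' \<in> {1..n}" "L' k' = L i" using tableau_surj[OF L' tableau_in[OF L less.prems]] .
    have "i \<le> k" "i \<le> k'" using later k k' by blast+
    have "\<not> k < i" "\<not> k' < i" using \<open>i \<le> k\<close> \<open>i \<le> k'\<close> by auto
    then have "\<not> u + t < r + s" "\<not> r + s < u + t"
      using tableau_near_less_iff[OF S L k(1) less.prems, of \<beta> u t r s]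
        tableau_near_less_iff[OF S L' k'(1) less.prems, of \<beta> r s u t] k k' b b' by auto
    then show ?case using b b' by auto
  qed
  then show ?thesis
    using L L' by (intro extensionalityI[of _ "{1..n}"]) (auto simp: standard_tableaux_def)
qed

section \<open>Adjacent transpositions of entries\<close>

lemma swap_tableau_content:
  assumes S: "book q S" and L: "L \<in> standard_tableaux n S" and i: "i \<in> {2..n}"
    and sw: "swap_tab i L \<in> standard_tableaux n S"
  shows "content (L (i - 1)) \<noteq> content (L i) + 1"
proof
  assume c: "content (L (i - 1)) = content (L i) + 1"
  have i': "i - 1 \<in> {1..n}" "i \<in> {1..n}" "i - 1 < i" using i by auto
  obtain \<beta> r s where b: "L i = (\<beta>, r, s)" by (cases "L i")
  obtain \<beta>' r' s' where b': "L (i - 1) = (\<beta>', r', s')" by (cases "L (i - 1)")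
  have "\<beta> \<in> pages q" "\<beta>' \<in> pages q" using tableau_in[OF L] i' b b' S unfolding book_def by metis+
  moreover have "content (\<beta>', r', s') = content (\<beta>, r, s + 1)" using c b b' by simp
  ultimately have d: "\<beta>' = \<beta>" "s' - r' = s + 1 - r" using content_inj by blast+
  \<comment> \<open>Boxes on neighbouring diagonals occur in the same order in every standard
    tableau, but \<open>L\<close> and its swap order them oppositely.\<close>
  have "r' + s' < r + s"
    using tableau_near_less_iff[OF S L i'(1,2), of \<beta> r' s' r s] b b' d i' by auto
  moreover have "r + s < r' + s'"
    using tableau_near_less_iff[OF S sw i'(1,2), of \<beta> r s r' s'] b b' d i' by (auto simp: swap_tab_def)
  ultimately show False by simp
qed

lemma swap_tab_standard:
  assumes L: "L \<in> standard_tableaux n S" and i: "i \<in> {2..n}"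
    and inc: "\<And>\<beta> r s r' s'. L (i - 1) = (\<beta>, r, s) \<Longrightarrow> L i = (\<beta>, r', s') \<Longrightarrow>
        \<not> (r = r' \<and> s < s' \<or> s = s' \<and> r < r')"
  shows "swap_tab i L \<in> standard_tableaux n S"
proof -
  note bij = tableau_bij[OF L] and ext = tableau_extensional[OF L] and std = tableau_row_column[OF L]
  define \<tau> where "\<tau> k = (if k = i - 1 then i else if k = i then i - 1 else k)" for k
  have i': "i - 1 \<in> {1..n}" "i \<in> {1..n}" "i - 1 \<noteq> i" using i by auto
  have sw: "swap_tab i L = L \<circ> \<tau>"
    using i' by (auto simp: swap_tab_def \<tau>_def fun_eq_iff)
  have \<tau>: "bij_betw \<tau> {1..n} {1..n}"
    using i' by (intro bij_betwI[of _ _ _ \<tau>]) (auto simp: \<tau>_def)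
  have "bij_betw (swap_tab i L) {1..n} S" unfolding sw by (rule bij_betw_trans[OF \<tau> bij])
  moreover have "swap_tab i L \<in> extensional {1..n}"
    using ext i' by (auto simp: swap_tab_def extensional_def)
  moreover have "k < l" if kl: "k \<in> {1..n}" "l \<in> {1..n}" and e: "swap_tab i L k = (\<beta>, r, s)"
     "swap_tab i L l = (\<beta>, r', s')" "r = r' \<and> s < s' \<or> s = s' \<and> r < r'" for k l \<beta> r s r' s'
  proof -
    have "\<tau> k \<in> {1..n}" "\<tau> l \<in> {1..n}" using \<tau> kl by (metis bij_betwE)+
    then have lt: "\<tau> k < \<tau> l" using std e by (simp add: sw)
    have "\<not> (\<tau> k = i - 1 \<and> \<tau> l = i)" using inc e by (auto simp: sw)
    with lt i' show "k < l" unfolding \<tau>_def by (auto split: if_splits)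
  qed
  ultimately show ?thesis unfolding standard_tableaux_def by blast
qed

lemma increasing_self_map_id:
  assumes "\<And>i. i \<in> {1..n} \<Longrightarrow> \<sigma> i \<in> {1..n::nat}" "\<And>i. i \<in> {2..n} \<Longrightarrow> \<sigma> (i - 1) < \<sigma> i" "i \<in> {1..n}"
  shows "\<sigma> i = i"
proof -
  have lo: "i \<in> {1..n} \<longrightarrow> i \<le> \<sigma> i" for i
  proof (induction i)
    case (Suc i)
    show ?case
    proof (cases "i = 0")
      case True then show ?thesis using assms(1)[of "Suc i"] by auto
    next
      case False then show ?thesis using assms(2)[of "Suc i"] Suc by auto
    qed
  qed auto
  \<comment> \<open>The upper bound is obtained downwards from \<open>n\<close>, hence the induction
    on the distance \<open>k\<close> to \<open>n\<close>.\<close>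
  have hi: "k < n \<longrightarrow> \<sigma> (n - k) \<le> n - k" for k
  proof (induction k)
    case 0 then show ?case using assms(1)[of n] by auto
  next
    case (Suc k) 
    show ?case
    proof
      assume k: "Suc k < n"
      then have "\<sigma> (n - Suc k) < \<sigma> (n - k)" "\<sigma> (n - k) \<le> n - k" using Suc assms(2)[of "n - k"] by auto
      then show "\<sigma> (n - Suc k) \<le> n - Suc k" by linarith
    qed
  qed
  show ?thesis using lo[of i] hi[of "n - i"] assms(3) by auto
qed

text \<open>A descent of \<open>L'\<^sup>-\<^sup>1 L\<close> at \<open>i\<close> makes \<open>s\<^sub>i L\<close> standard and closer to \<open>L'\<close>; the distance is
  measured by \<open>\<Sum>i * (n - \<sigma> i)\<close>, where \<open>\<sigma> = L'\<^sup>-\<^sup>1 L\<close>.\<close>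

lemma tableaux_connected:
  assumes L: "L \<in> standard_tableaux n S" and L': "L' \<in> standard_tableaux n S" and "P L"
    and step: "\<And>L i. L \<in> standard_tableaux n S \<Longrightarrow> P L \<Longrightarrow> i \<in> {2..n} \<Longrightarrow>
       swap_tab i L \<in> standard_tableaux n S \<Longrightarrow> P (swap_tab i L)"
  shows "P L'"
proof -
  define \<sigma> where "\<sigma> L i = inv_into {1..n} L' (L i)" for L :: "nat \<Rightarrow> box" and i :: nat
  note bij' = tableau_bij[OF L'] and std' = tableau_row_column[OF L']
  have \<sigma>: "\<sigma> L i \<in> {1..n}" "L' (\<sigma> L i) = L i" if "L \<in> standard_tableaux n S" "i \<in> {1..n}" for L i
    using tableau_in[OF that] bij' unfolding \<sigma>_def bij_betw_def
    by (metis inv_into_into, metis f_inv_into_f)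
  have "L \<in> standard_tableaux n S \<Longrightarrow> P L \<Longrightarrow> P L'" for L
  proof (induction "\<Sum>i\<in>{1..n}. i * (n - \<sigma> L i)" arbitrary: L rule: less_induct)
    case less
    note L = less.prems(1)
    show ?case
    proof (cases "\<exists>i\<in>{2..n}. \<sigma> L i < \<sigma> L (i - 1)")
      case False
      have "\<sigma> L (i - 1) < \<sigma> L i" if "i \<in> {2..n}" for i
      proof -
        have i: "i - 1 \<in> {1..n}" "i \<in> {1..n}" "i - 1 \<noteq> i" using that by auto
        have "\<sigma> L (i - 1) \<noteq> \<sigma> L i" using i \<sigma>(2)[OF L] tableau_inj[OF L] by (metis inj_onD)
        then show ?thesis using False that by force
      qed
      then have "\<sigma> L i = i" if "i \<in> {1..n}" for i
        using increasing_self_map_id[of n "\<sigma> L" i] \<sigma>(1)[OF L] that by blast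
      then have "L i = L' i" if "i \<in> {1..n}" for i using that \<sigma>(2)[OF L that] by simp
      then have "L = L'"
        using L L' by (intro extensionalityI[of _ "{1..n}"]) (auto simp: standard_tableaux_def)
      with less.prems show ?thesis by simp
    next
      case True
      then obtain i where i: "i \<in> {2..n}" and desc: "\<sigma> L i < \<sigma> L (i - 1)" by blast
      have i': "i - 1 \<in> {1..n}" "i \<in> {1..n}" "i - 1 \<noteq> i" using i by auto
      have sw: "swap_tab i L \<in> standard_tableaux n S"
      proof (rule swap_tab_standard[OF L i])
        fix \<beta> r s r' s' assume e: "L (i - 1) = (\<beta>, r, s)" "L i = (\<beta>, r', s')"
        show "\<not> (r = r' \<and> s < s' \<or> s = s' \<and> r < r')"
        proof
          assume "r = r' \<and> s < s' \<or> s = s' \<and> r < r'"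
          then have "\<sigma> L (i - 1) < \<sigma> L i"
            using std'[of "\<sigma> L (i - 1)" "\<sigma> L i"] \<sigma>[OF L i'(1)] \<sigma>[OF L i'(2)] e by metis
          with desc show False by simp
        qed
      qed
      define D where "D = {1..n} - {i - 1, i}"
      have split: "(\<Sum>k\<in>{1..n}. f k) = f (i - 1) + f i + (\<Sum>k\<in>D. f k)" for f :: "nat \<Rightarrow> nat"
      proof -
        have "{1..n} = insert (i - 1) (insert i D)" unfolding D_def using i' by auto
        moreover have "finite D" "i - 1 \<notin> insert i D" "i \<notin> D" using i' by (auto simp: D_def)
        ultimately show ?thesis by simp
      qed
      have D: "(\<Sum>k\<in>D. k * (n - \<sigma> (swap_tab i L) k)) = (\<Sum>k\<in>D. k * (n - \<sigma> L k))"
        by (intro sum.cong) (auto simp: D_def \<sigma>_def swap_tab_def)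
      have sws: "\<sigma> (swap_tab i L) (i - 1) = \<sigma> L i" "\<sigma> (swap_tab i L) i = \<sigma> L (i - 1)"
        using i' by (auto simp: \<sigma>_def swap_tab_def)
      obtain m where m: "i = Suc m" using i by (cases i) auto
      have "(n - \<sigma> L (i - 1)) < (n - \<sigma> L i)" using desc \<sigma>(1)[OF L i'(1)] by auto
      then have "(i - 1) * (n - \<sigma> L i) + i * (n - \<sigma> L (i - 1))
          < (i - 1) * (n - \<sigma> L (i - 1)) + i * (n - \<sigma> L i)"
        unfolding m by simp
      then have "(\<Sum>k\<in>{1..n}. k * (n - \<sigma> (swap_tab i L) k)) < (\<Sum>k\<in>{1..n}. k * (n - \<sigma> L k))"
        unfolding split D sws by simp
      then show ?thesis using less.hyps sw step[OF L less.prems(2) i sw] by blast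
    qed
  qed
  then show ?thesis using assms by blast
qed

text \<open>The sum \<open>r + s\<close> increases strictly along rows and columns, so numbering the
  boxes of all pages together in order of \<open>r + s\<close> gives a standard tableau.\<close>

lemma standard_tableaux_nonempty:
  assumes "finite S" "card S = n" shows "standard_tableaux n S \<noteq> {}"
proof -
  obtain ys where ys: "set ys = S" "distinct ys" using assms finite_distinct_list by blast
  define key :: "box \<Rightarrow> int" where "key = (\<lambda>(\<beta>, r, s). r + s)"
  define xs where "xs = sort_key key ys"
  have xs: "set xs = S" "distinct xs" "sorted (map key xs)" "length xs = n"
    using ys assms distinct_card[OF ys(2)] by (simp_all add: xs_def)
  define L where "L = restrict (\<lambda>i. xs ! (i - 1)) {1..n}"
  have "bij_betw (\<lambda>i. i - 1) {1..n} {..<n}"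
    by (intro bij_betwI[of _ _ _ Suc]) auto
  from bij_betw_trans[OF this bij_betw_nth[OF xs(2), of "{..<n}" S]] xs
  have "bij_betw (\<lambda>i. xs ! (i - 1)) {1..n} S" by (simp add: o_def)
  then have "bij_betw L {1..n} S"
    by (rule bij_betw_cong[THEN iffD1, rotated]) (auto simp: L_def)
  moreover have "i < j" if ij: "i \<in> {1..n}" "j \<in> {1..n}" "L i = (\<beta>, r, s)" "L j = (\<beta>, r', s')"
     "r = r' \<and> s < s' \<or> s = s' \<and> r < r'" for i j \<beta> r s r' s'
  proof (rule ccontr)
    assume "\<not> i < j"
    then have "j - 1 \<le> i - 1" "i - 1 < n" using ij by auto
    then have "map key xs ! (j - 1) \<le> map key xs ! (i - 1)"
      using xs by (intro sorted_nth_mono) auto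
    then have "key (L j) \<le> key (L i)" using xs ij \<open>i - 1 < n\<close> \<open>j - 1 \<le> i - 1\<close> by (auto simp: L_def)
    then show False using ij by (auto simp: key_def)
  qed
  ultimately have "L \<in> standard_tableaux n S" unfolding standard_tableaux_def L_def by auto
  then show ?thesis by blast
qed

section \<open>The action of the cyclic group on books\<close>

lemma ln_square_nonzero:
  fixes q :: real assumes "0 < q" "q \<noteq> 1" shows "ln (q\<^sup>2) \<noteq> 0"
  using assms by (simp add: ln_realpow)

lemma alpha_nonzero: "0 < q \<Longrightarrow> q \<noteq> 1 \<Longrightarrow> alpha q \<noteq> 0"
  using ln_square_nonzero[of q] unfolding alpha_def by simp

lemma qpow_nonzero [simp]: "qpow q x \<noteq> 0"
  by (simp add: qpow_def)

lemma qpow_diff: "qpow q (x - y) = qpow q x / qpow q y"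
  by (simp add: qpow_def right_diff_distrib exp_diff)

lemma qpow_polar: "qpow q x = of_real (exp (ln (q\<^sup>2) * Re x)) * cis (ln (q\<^sup>2) * Im x)"
  unfolding qpow_def by (simp add: exp_eq_polar)

text \<open>The modulus of q^(2x) determines the real part of x, the argument determines the
  imaginary part up to the period \<alpha>.\<close>

lemma qpow_eqD:
  assumes q: "0 < q" "q \<noteq> 1" and eq: "qpow q x = qpow q y"
  shows "Re x = Re y \<and> (\<exists>m::int. Im x = Im y + of_int m * alpha q)"
proof -
  define l where "l = ln (q\<^sup>2)"
  have l: "l \<noteq> 0" using ln_square_nonzero[OF q] by (simp add: l_def)
  have "norm (qpow q x) = norm (qpow q y)" using eq by simp
  then have "exp (l * Re x) = exp (l * Re y)" by (simp add: qpow_polar norm_mult l_def)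
  then have re: "Re x = Re y" using l by simp
  with eq have "cis (l * Im x) = cis (l * Im y)" by (simp add: qpow_polar l_def)
  then have "sin (l * Im x) = sin (l * Im y) \<and> cos (l * Im x) = cos (l * Im y)"
    by (simp add: complex_eq_iff)
  then obtain m :: int where "l * Im x = l * Im y + 2 * pi * of_int m" using sin_cos_eq_iff by blast
  then have "Im x = Im y + of_int m * alpha q" using l by (simp add: alpha_def l_def[symmetric] field_simps)
  with re show ?thesis by blast
qed

lemma residue_unique:
  fixes a b m :: real
  assumes "0 \<le> a" "a < \<bar>m\<bar>" "0 \<le> b" "b < \<bar>m\<bar>" "a = b + of_int k * m"
  shows "a = b"
  using rmod_unique[of b m a k] rmod_idem[of a m] assms by auto

text \<open>Although q^(2x) is periodic on the complex numbers, pages have imaginary part in one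
  fundamental interval of length \<open>\<bar>alpha q\<bar>\<close>. Two books are allowed so that a
  shifted book can be compared with the original one.\<close>

lemma content_eq_of_qpow_eq:
  assumes q: "0 < q" "q \<noteq> 1" and "book q S" "b \<in> S" "book q S'" "b' \<in> S'"
    and eq: "qpow q (content b) = qpow q (content b')"
  shows "content b = content b'"
proof -
  obtain \<beta> r s \<beta>' r' s' where b: "b = (\<beta>, r, s)" "b' = (\<beta>', r', s')" by (cases b; cases b') auto
  have "\<beta> \<in> pages q" "\<beta>' \<in> pages q" using assms b unfolding book_def by metis+
  moreover obtain m where "Im (content b) = Im (content b') + of_int m * alpha q"
    using qpow_eqD[OF q eq] by blast
  ultimately have "Im (content b) = Im (content b')"
    using residue_unique[of "Im \<beta>" "alpha q" "Im \<beta>'" m] b by (auto simp: pages_def)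
  then show ?thesis using qpow_eqD[OF q eq] by (simp add: complex_eq_iff)
qed

lemma qpow_shift_box:
  assumes q: "0 < q" "q \<noteq> 1"
  shows "qpow q (content (shift_box q p b)) = cis (- (2 * pi / real p)) * qpow q (content b)"
proof -
  obtain \<beta> r s where b: "b = (\<beta>, r, s)" by (cases b)
  define l where "l = ln (q\<^sup>2)"
  have l: "l \<noteq> 0" using ln_square_nonzero[OF q] by (simp add: l_def)
  \<comment> \<open>The number of periods removed by \<open>rmod\<close>. The modulus there is
    \<open>\<bar>alpha q\<bar>\<close>, and \<open>k'\<close> restores the sign, since \<alpha> is
    negative for \<open>q < 1\<close>.\<close>
  define k where "k = \<lfloor>(Im \<beta> - alpha q / real p) / \<bar>alpha q\<bar>\<rfloor>"
  define k' where "k' = (if alpha q < 0 then k else - k)"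
  have "(Im \<beta> - alpha q / real p) rmod \<bar>alpha q\<bar> = Im \<beta> - alpha q / real p + alpha q * of_int k'"
    unfolding rmod_def by (simp add: k_def k'_def)
  then have im: "Im (content (shift_box q p b)) = Im (content b) - alpha q / real p + alpha q * of_int k'"
    and re: "Re (content (shift_box q p b)) = Re (content b)"
    by (simp_all add: b)
  have la: "l * alpha q = 2 * pi" using l by (simp add: alpha_def l_def)
  have "l * Im (content (shift_box q p b))
      = l * Im (content b) - l * alpha q / real p + (l * alpha q) * of_int k'"
    unfolding im by (simp add: algebra_simps)
  also have "\<dots> = l * Im (content b) + (- (2 * pi / real p)) + 2 * pi * of_int k'"
    unfolding la by simp
  finally have "cis (l * Im (content (shift_box q p b)))
      = cis (l * Im (content b)) * cis (- (2 * pi / real p)) * cis (2 * pi * of_int k')"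
    by (simp only: cis_mult)
  moreover have "cis (2 * pi * of_int k') = 1" by (simp add: complex_eq_iff)
  ultimately show ?thesis unfolding qpow_polar re l_def[symmetric] by (simp add: mult_ac)
qed

lemma qpow_shift_box_iterate:
  assumes q: "0 < q" "q \<noteq> 1"
  shows "qpow q (content ((shift_box q p ^^ k) b)) = cis (- (2 * pi / real p)) ^ k * qpow q (content b)"
  by (induction k) (simp_all add: qpow_shift_box[OF q] mult_ac)

section \<open>Shifted books and shifted tableaux\<close>

lemma shift_box_coordinates:
  assumes q: "0 < q" "q \<noteq> 1" and "\<beta> \<in> pages q"
  obtains \<beta>' where "\<beta>' \<in> pages q" "\<And>r s. shift_box q p (\<beta>, r, s) = (\<beta>', r, s)"
proof
  show "Complex (Re \<beta>) ((Im \<beta> - alpha q / real p) rmod \<bar>alpha q\<bar>) \<in> pages q"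
    using assms(3) alpha_nonzero[OF q] rmod_nonneg[of "\<bar>alpha q\<bar>"] rmod_less[of "\<bar>alpha q\<bar>"]
    by (auto simp: pages_def)
qed simp

lemma shift_box_page_inj:
  assumes q: "0 < q" "q \<noteq> 1" and \<beta>: "\<beta> \<in> pages q" "\<beta>' \<in> pages q"
    and eq: "shift_box q p (\<beta>, r, s) = (\<gamma>, u, t)" "shift_box q p (\<beta>', r', s') = (\<gamma>, u', t')"
  shows "\<beta> = \<beta>'"
proof -
  have re: "Re \<beta> = Re \<beta>'" and im: "(Im \<beta> - alpha q / real p) rmod \<bar>alpha q\<bar> = (Im \<beta>' - alpha q / real p) rmod \<bar>alpha q\<bar>"
    using eq by (auto simp: complex_eq_iff)
  from im have "[Im \<beta>' - alpha q / real p = Im \<beta> - alpha q / real p] (rmod \<bar>alpha q\<bar>)"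
    by (simp add: rcong_def)
  then obtain m where "Im \<beta> = Im \<beta>' + of_int m * \<bar>alpha q\<bar>"
    unfolding rcong_altdef by (auto simp: algebra_simps)
  then have "Im \<beta> = Im \<beta>'"
    using residue_unique[of "Im \<beta>" "\<bar>alpha q\<bar>" "Im \<beta>'" m] \<beta> by (auto simp: pages_def)
  with re show ?thesis by (simp add: complex_eq_iff)
qed

lemma shift_tableau:
  assumes q: "0 < q" "q \<noteq> 1" and S: "book q S" and L: "L \<in> standard_tableaux n S"
  shows "restrict (\<lambda>i. shift_box q p (L i)) {1..n} \<in> standard_tableaux n (shape_g q p S)"
proof -
  have pg: "\<beta> \<in> pages q" if "(\<beta>, r, s) \<in> S" for \<beta> r s using S that by (rule book_page)
  have inj: "inj_on (shift_box q p) S"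
  proof (rule inj_onI)
    fix b b' assume b: "b \<in> S" "b' \<in> S" "shift_box q p b = shift_box q p b'"
    obtain \<beta> r s \<beta>' r' s' where e: "b = (\<beta>, r, s)" "b' = (\<beta>', r', s')" by (cases b; cases b') auto
    obtain \<gamma> u t where "shift_box q p b = (\<gamma>, u, t)" by (cases "shift_box q p b")
    then have "\<beta> = \<beta>'" using b e shift_box_page_inj[OF q pg pg] by metis
    then show "b = b'" using b e by simp
  qed
  have "bij_betw (shift_box q p \<circ> L) {1..n} (shape_g q p S)"
    unfolding shape_g_def by (rule bij_betw_trans[OF tableau_bij[OF L] inj_on_imp_bij_betw[OF inj]])
  then have "bij_betw (restrict (\<lambda>i. shift_box q p (L i)) {1..n}) {1..n} (shape_g q p S)"
    by (rule bij_betw_cong[THEN iffD1, rotated]) auto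
  moreover have "i < j" if ij: "i \<in> {1..n}" "j \<in> {1..n}"
    and e: "restrict (\<lambda>i. shift_box q p (L i)) {1..n} i = (\<gamma>, r, s)"
      "restrict (\<lambda>i. shift_box q p (L i)) {1..n} j = (\<gamma>, r', s')"
    and o: "r = r' \<and> s < s' \<or> s = s' \<and> r < r'" for i j \<gamma> r s r' s'
  proof -
    obtain \<beta> u t where i: "L i = (\<beta>, u, t)" by (cases "L i")
    obtain \<beta>' u' t' where j: "L j = (\<beta>', u', t')" by (cases "L j")
    have "\<beta> \<in> pages q" "\<beta>' \<in> pages q" using pg tableau_in[OF L] ij i j by metis+
    moreover have 1: "shift_box q p (\<beta>, u, t) = (\<gamma>, r, s)" "shift_box q p (\<beta>', u', t') = (\<gamma>, r', s')"
      using e ij i j by auto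
    ultimately have "\<beta> = \<beta>'" using shift_box_page_inj[OF q] by metis
    moreover have "u = r" "t = s" "u' = r'" "t' = s'" using 1 by auto
    ultimately show "i < j" using tableau_row_column[OF L ij] i j o by metis
  qed
  ultimately show ?thesis unfolding standard_tableaux_def by auto
qed

lemma shape_g_book:
  assumes q: "0 < q" "q \<noteq> 1" and S: "book q S"
  shows "book q (shape_g q p S)"
  unfolding book_def
proof (intro conjI allI impI)
  have pg: "\<beta> \<in> pages q" if "(\<beta>, r, s) \<in> S" for \<beta> r s using S that by (rule book_page)
  have img: "\<exists>\<beta>'. (\<beta>', r, s) \<in> S \<and> (\<forall>r s. shift_box q p (\<beta>', r, s) = (\<beta>, r, s)) \<and> \<beta>' \<in> pages q \<and> \<beta> \<in> pages q"
    if mem: "(\<beta>, r, s) \<in> shape_g q p S" for \<beta> r s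
  proof -
    obtain b where "b \<in> S" "shift_box q p b = (\<beta>, r, s)" using mem by (auto simp: shape_g_def)
    moreover obtain \<beta>' u t where b: "b = (\<beta>', u, t)" by (cases b)
    moreover obtain \<beta>'' where "\<beta>'' \<in> pages q" "\<And>r s. shift_box q p (\<beta>', r, s) = (\<beta>'', r, s)"
      using shift_box_coordinates[OF q pg, of \<beta>' u t] b \<open>b \<in> S\<close> by metis
    ultimately show ?thesis using pg[of \<beta>' u t] by (metis Pair_inject)
  qed
  show "finite (shape_g q p S)" using book_finite[OF S] by (simp add: shape_g_def)
  show "\<beta> \<in> pages q" if "(\<beta>, r, s) \<in> shape_g q p S" for \<beta> r s using img[OF that] by blast
  show "(\<beta>, r', s') \<in> shape_g q p S" if h: "(\<beta>, r, s) \<in> shape_g q p S \<and> (\<beta>, r'', s'') \<in> shape_g q p S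
          \<and> r \<le> r' \<and> r' \<le> r'' \<and> s \<le> s' \<and> s' \<le> s''" for \<beta> r s r' s' r'' s''
  proof -
    obtain \<beta>1 where 1: "(\<beta>1, r, s) \<in> S" "\<And>r s. shift_box q p (\<beta>1, r, s) = (\<beta>, r, s)" "\<beta>1 \<in> pages q"
      using img h by metis
    obtain \<beta>2 where 2: "(\<beta>2, r'', s'') \<in> S" "\<And>r s. shift_box q p (\<beta>2, r, s) = (\<beta>, r, s)" "\<beta>2 \<in> pages q"
      using img h by metis
    have "\<beta>1 = \<beta>2" using shift_box_page_inj[OF q 1(3) 2(3) 1(2) 2(2)] .
    then have "(\<beta>1, r', s') \<in> S" using book_convex[OF S 1(1)] 2(1) h by auto
    then show ?thesis unfolding shape_g_def using 1(2) by force
  qed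
qed

lemma shape_g_iterate_book:
  assumes q: "0 < q" "q \<noteq> 1" and S: "book q S"
  shows "book q ((shape_g q p ^^ k) S)"
  by (induction k) (simp_all add: S shape_g_book[OF q])

lemma shift_tableau_iterate:
  assumes q: "0 < q" "q \<noteq> 1" and S: "book q S" and L: "L \<in> standard_tableaux n S"
  shows "restrict (\<lambda>i. (shift_box q p ^^ k) (L i)) {1..n} \<in> standard_tableaux n ((shape_g q p ^^ k) S)"
proof (induction k)
  case 0
  have "restrict L {1..n} = L" using tableau_extensional[OF L] by (simp add: extensional_restrict)
  then show ?case using L by simp
next
  case (Suc k)
  have "restrict (\<lambda>i. (shift_box q p ^^ Suc k) (L i)) {1..n}
    = restrict (\<lambda>i. shift_box q p (restrict (\<lambda>i. (shift_box q p ^^ k) (L i)) {1..n} i)) {1..n}"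
    by (auto simp: restrict_def fun_eq_iff)
  then show ?case
    using shift_tableau[OF q shape_g_iterate_book[OF q S] Suc.IH, of p] by (simp only: funpow.simps o_apply)
qed

section \<open>Weights and the stabilizer of a book\<close>

definition weight :: "real \<Rightarrow> (nat \<Rightarrow> box) \<Rightarrow> nat \<Rightarrow> complex" where
  "weight q L i = qpow q (content (L i))"

lemma tableau_determined_by_weights:
  assumes q: "0 < q" "q \<noteq> 1" and S: "book q S"
    and L: "L \<in> standard_tableaux n S" and L': "L' \<in> standard_tableaux n S"
    and "\<And>i. i \<in> {1..n} \<Longrightarrow> weight q L' i = weight q L i"
  shows "L' = L"
proof (rule tableau_determined_by_contents[OF S L L'])
  fix i assume i: "i \<in> {1..n}"
  then show "content (L' i) = content (L i)"
    using content_eq_of_qpow_eq[OF q S tableau_in[OF L' i] S tableau_in[OF L i]] assms(6)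
    by (simp add: weight_def)
qed

text \<open>A single pair of tableaux suffices: \<open>L'\<close> and the \<open>k\<close>-fold
  shift of \<open>L\<close> have the same contents, hence their books agree.\<close>

lemma book_eq_of_rotated_weights:
  assumes q: "0 < q" "q \<noteq> 1" and S: "book q S"
    and L: "L \<in> standard_tableaux n S" and L': "L' \<in> standard_tableaux n S"
    and w: "\<And>i. i \<in> {1..n} \<Longrightarrow> weight q L' i = cis (- (2 * pi / real p)) ^ k * weight q L i"
  shows "book_eq ((shape_g q p ^^ k) S) S"
proof -
  note Sk = shape_g_iterate_book[OF q S, where p = p and k = k] and Lk = shift_tableau_iterate[OF q S L, where p = p and k = k]
  show ?thesis
  proof (rule identification_of_same_contents[OF Sk S Lk L'])
    fix i assume i: "i \<in> {1..n}"
    show "content (L' i) = content (restrict (\<lambda>i. (shift_box q p ^^ k) (L i)) {1..n} i)"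
      by (rule content_eq_of_qpow_eq[OF q S tableau_in[OF L' i] Sk tableau_in[OF Lk i]])
        (use w[OF i] i in \<open>simp add: weight_def qpow_shift_box_iterate[OF q]\<close>)
  qed
qed

text \<open>Any identification preserves contents, so the weights of the image do not depend on the
  one that is chosen.\<close>

lemma tab_g_tableau:
  assumes q: "0 < q" "q \<noteq> 1" and S: "book q S" and L: "L \<in> standard_tableaux n S"
    and st: "book_eq ((shape_g q p ^^ k) S) S"
  shows "tab_g q p n S k L \<in> standard_tableaux n S"
    and "i \<in> {1..n} \<Longrightarrow> weight q (tab_g q p n S k L) i = cis (- (2 * pi / real p)) ^ k * weight q L i"
proof -
  define f where "f = (SOME f. book_identification ((shape_g q p ^^ k) S) S f)"
  have f: "book_identification ((shape_g q p ^^ k) S) S f"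
    using st someI_ex[of "book_identification ((shape_g q p ^^ k) S) S"] by (simp add: book_eq_def f_def)
  note Sk = shape_g_iterate_book[OF q S, where p = p and k = k] and Lk = shift_tableau_iterate[OF q S L, where p = p and k = k]
  have t: "tab_g q p n S k L = restrict (\<lambda>i. f (restrict (\<lambda>i. (shift_box q p ^^ k) (L i)) {1..n} i)) {1..n}"
    by (auto simp: tab_g_def Let_def f_def restrict_def fun_eq_iff)
  show "tab_g q p n S k L \<in> standard_tableaux n S"
    unfolding t by (rule tableau_of_identification[OF Sk S f Lk])
  show "weight q (tab_g q p n S k L) i = cis (- (2 * pi / real p)) ^ k * weight q L i" if i: "i \<in> {1..n}"
    using f tableau_in[OF Lk i] i
    by (simp add: weight_def t book_identification_def qpow_shift_box_iterate[OF q])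
qed

text \<open>Replaces equality of books by a statement about weights, from which closure under
  addition and periodicity modulo \<open>p\<close> are immediate, without composing
  identifications.\<close>

lemma stabilizer_iff:
  assumes q: "0 < q" "q \<noteq> 1" and S: "book q S" "card S = n"
  shows "book_eq ((shape_g q p ^^ k) S) S \<longleftrightarrow> (\<forall>L\<in>standard_tableaux n S. \<exists>L'\<in>standard_tableaux n S.
     \<forall>i\<in>{1..n}. weight q L' i = cis (- (2 * pi / real p)) ^ k * weight q L i)"
proof
  assume "book_eq ((shape_g q p ^^ k) S) S"
  with tab_g_tableau[OF q S(1)] show "\<forall>L\<in>standard_tableaux n S. \<exists>L'\<in>standard_tableaux n S.
     \<forall>i\<in>{1..n}. weight q L' i = cis (- (2 * pi / real p)) ^ k * weight q L i" by blast
next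
  assume "\<forall>L\<in>standard_tableaux n S. \<exists>L'\<in>standard_tableaux n S.
     \<forall>i\<in>{1..n}. weight q L' i = cis (- (2 * pi / real p)) ^ k * weight q L i"
  moreover obtain L where "L \<in> standard_tableaux n S"
    using standard_tableaux_nonempty[OF book_finite[OF S(1)] S(2)] by blast
  ultimately show "book_eq ((shape_g q p ^^ k) S) S"
    using book_eq_of_rotated_weights[OF q S(1)] by meson
qed

lemma root_of_unity_power [simp]: "1 \<le> p \<Longrightarrow> cis (- (2 * pi / real p)) ^ p = 1"
  unfolding DeMoivre by (simp add: complex_eq_iff)

text \<open>Division with remainder, as for subgroups of a cyclic group. The least element exists
  because \<open>p\<close> itself stabilizes the book.\<close>

lemma stabilizer_eq_multiples_kappa:
  assumes q: "0 < q" "q \<noteq> 1" and S: "book q S" "card S = n" and p: "1 \<le> p"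
  shows "1 \<le> kappa q p S" and "kappa q p S dvd p"
    and "book_eq ((shape_g q p ^^ k) S) S \<longleftrightarrow> kappa q p S dvd k"
proof -
  define z where "z = cis (- (2 * pi / real p))"
  have zp: "z ^ p = 1" using p by (simp add: z_def)
  define st where "st k \<longleftrightarrow> book_eq ((shape_g q p ^^ k) S) S" for k
  have st: "st k \<longleftrightarrow> (\<forall>L\<in>standard_tableaux n S. \<exists>L'\<in>standard_tableaux n S.
     \<forall>i\<in>{1..n}. weight q L' i = z ^ k * weight q L i)" for k
    unfolding st_def z_def by (rule stabilizer_iff[OF q S])
  have zper: "z ^ (a + b * p) = z ^ a" for a b
    by (simp add: power_add power_mult mult.commute[of b p] zp)
  have per: "st (a + b * p) \<longleftrightarrow> st a" for a b
    unfolding st zper by simp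
  have stadd: "st (a + b)" if "st a" "st b" for a b
  proof -
    have "\<exists>L''\<in>standard_tableaux n S. \<forall>i\<in>{1..n}. weight q L'' i = z ^ (a + b) * weight q L i"
      if L: "L \<in> standard_tableaux n S" for L
    proof -
      obtain L' where L': "L' \<in> standard_tableaux n S" "\<forall>i\<in>{1..n}. weight q L' i = z ^ b * weight q L i"
        using \<open>st b\<close> L unfolding st by blast
      obtain L'' where L'': "L'' \<in> standard_tableaux n S" "\<forall>i\<in>{1..n}. weight q L'' i = z ^ a * weight q L' i"
        using \<open>st a\<close> L' unfolding st by blast
      show ?thesis by (rule bexI[OF _ L''(1)]) (use L' L'' in \<open>simp add: power_add\<close>)
    qed
    then show ?thesis unfolding st by blast
  qed
  have st0: "st 0" unfolding st by auto
  have stm: "st (m * a)" if "st a" for m a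
    by (induction m) (simp_all add: st0 stadd[OF that])
  have stp: "st p" using per[of 0 1] st0 by simp
  have ex: "1 \<le> p \<and> p \<le> p \<and> book_eq ((shape_g q p ^^ p) S) S" using stp p by (simp add: st_def)
  define c where "c = kappa q p S"
  have c: "1 \<le> c" "c \<le> p" "st c"
    using LeastI[of "\<lambda>k. 1 \<le> k \<and> k \<le> p \<and> book_eq ((shape_g q p ^^ k) S) S", OF ex]
    by (auto simp: c_def kappa_def st_def)
  have least: "c \<le> m" if "1 \<le> m" "m \<le> p" "st m" for m
    unfolding c_def kappa_def by (rule Least_le) (use that in \<open>auto simp: st_def\<close>)
  have iff: "st k \<longleftrightarrow> c dvd k" for k
  proof
    assume "c dvd k" then show "st k" using stm[OF c(3)] by (auto simp: dvd_def mult.commute)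
  next
    assume k: "st k"
    \<comment> \<open>Exponents are natural numbers, so instead of subtracting the multiple
      \<open>k div c * c\<close> one adds it \<open>p - 1\<close> times; modulo \<open>p\<close>
      this leaves the remainder \<open>k mod c\<close>.\<close>
    have "st (k + (p - 1) * (k div c * c))"
      by (rule stadd[OF k stm[OF stm[OF c(3)]]])
    moreover have "k + (p - 1) * (k div c * c) = k mod c + (k div c * c) * p"
    proof -
      have "k = k mod c + k div c * c" by simp
      then have "k + (p - 1) * (k div c * c) = k mod c + (1 + (p - 1)) * (k div c * c)"
        by (simp only: distrib_right)
      then show ?thesis using p by (simp add: mult.commute)
    qed
    ultimately have m: "st (k mod c)" using per by simp
    have "k mod c < c" using c(1) by simp
    then have "k mod c = 0" using least[OF _ _ m] c(2) by fastforce
    then show "c dvd k" by auto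
  qed
  show "1 \<le> kappa q p S" using c by (simp add: c_def)
  show "kappa q p S dvd p" using iff stp by (simp add: c_def)
  show "book_eq ((shape_g q p ^^ k) S) S \<longleftrightarrow> kappa q p S dvd k" using iff by (simp add: c_def st_def)
qed

section \<open>The free action of the stabilizer on tableaux\<close>

lemma rotated_weights_kappa:
  assumes q: "0 < q" "q \<noteq> 1" and S: "book q S" "card S = n" and p: "1 \<le> p"
    and L: "L \<in> standard_tableaux n S" and L': "L' \<in> standard_tableaux n S"
    and w: "\<And>i. i \<in> {1..n} \<Longrightarrow> weight q L' i = cis (- (2 * pi / real p)) ^ k * weight q L i"
  shows "kappa q p S dvd k"
  using book_eq_of_rotated_weights[OF q S(1) L L' w] stabilizer_eq_multiples_kappa(3)[OF q S p] by blast

text \<open>For each exponent the identification is chosen anew, so the last equation does not hold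
  by unfolding; it holds because both sides are standard tableaux of \<open>S\<close> with the same
  weights.\<close>

lemma tab_g_iterate:
  assumes q: "0 < q" "q \<noteq> 1" and S: "book q S" "card S = n" and p: "1 \<le> p"
    and L: "L \<in> standard_tableaux n S"
  shows "(tab_g q p n S (kappa q p S) ^^ l) L \<in> standard_tableaux n S" (is ?A)
    and "i \<in> {1..n} \<Longrightarrow> weight q ((tab_g q p n S (kappa q p S) ^^ l) L) i
        = cis (- (2 * pi / real p)) ^ (l * kappa q p S) * weight q L i"
    and "tab_g q p n S (l * kappa q p S) L = (tab_g q p n S (kappa q p S) ^^ l) L"
proof -
  have k: "book_eq ((shape_g q p ^^ (l * kappa q p S)) S) S" for l
    using stabilizer_eq_multiples_kappa(3)[OF q S p] by simp
  then have k1: "book_eq ((shape_g q p ^^ kappa q p S) S) S" by (metis mult_1)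
  have *: "?A \<and> (\<forall>i\<in>{1..n}. weight q ((tab_g q p n S (kappa q p S) ^^ l) L) i
        = cis (- (2 * pi / real p)) ^ (l * kappa q p S) * weight q L i)"
    by (induction l) (use L in \<open>simp_all add: tab_g_tableau[OF q S(1) _ k1] power_add mult_ac\<close>)
  then show ?A and w: "\<And>i. i \<in> {1..n} \<Longrightarrow> weight q ((tab_g q p n S (kappa q p S) ^^ l) L) i
        = cis (- (2 * pi / real p)) ^ (l * kappa q p S) * weight q L i" by blast+
  show "tab_g q p n S (l * kappa q p S) L = (tab_g q p n S (kappa q p S) ^^ l) L"
    by (rule tableau_determined_by_weights[OF q S(1)])
      (use * tab_g_tableau[OF q S(1) L k] in auto)
qed

lemma tab_g_period:
  assumes q: "0 < q" "q \<noteq> 1" and S: "book q S" "card S = n" and p: "1 \<le> p"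
    and L: "L \<in> standard_tableaux n S"
  shows "(tab_g q p n S (kappa q p S) ^^ (p div kappa q p S)) L = L"
proof -
  have "p div kappa q p S * kappa q p S = p"
    using stabilizer_eq_multiples_kappa(2)[OF q S p] by simp
  then show ?thesis
    using tab_g_iterate(1)[OF q S p L, of "p div kappa q p S"]
      tab_g_iterate(2)[OF q S p L, of _ "p div kappa q p S"] p
    by (intro tableau_determined_by_weights[OF q S(1) L]) auto
qed

text \<open>The nonzero weight of the entry 1 is multiplied by the power \<open>l * kappa\<close> of
  a primitive \<open>p\<close>-th root of unity, and this exponent lies strictly between 0 and
  \<open>p\<close>.\<close>

lemma tab_g_free:
  assumes q: "0 < q" "q \<noteq> 1" and S: "book q S" "card S = n" and p: "1 \<le> p" and n: "1 \<le> n"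
    and L: "L \<in> standard_tableaux n S" and l: "0 < l" "l < p div kappa q p S"
  shows "(tab_g q p n S (kappa q p S) ^^ l) L \<noteq> L"
proof
  assume fx: "(tab_g q p n S (kappa q p S) ^^ l) L = L"
  define m where "m = l * kappa q p S"
  have "m < p div kappa q p S * kappa q p S" "0 < m"
    using l stabilizer_eq_multiples_kappa(1)[OF q S p] by (auto simp: m_def)
  then have m: "0 < m" "m < p"
    using stabilizer_eq_multiples_kappa(2)[OF q S p] by simp_all
  have "cis (- (2 * pi / real p)) ^ m * weight q L 1 = weight q L 1"
    using tab_g_iterate(2)[OF q S p L, of 1 l] n fx by (simp add: m_def)
  then have "cis (- (2 * pi / real p)) ^ m = 1" by (simp add: weight_def)
  then have "inverse (cis (- (2 * pi / real p)) ^ m) = 1" by simp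
  then have e: "cis (2 * pi * real m / real p) = cis (2 * pi * real 0 / real p)"
    unfolding power_inverse[symmetric] cis_inverse by (simp add: DeMoivre field_simps)
  have "inj_on (\<lambda>k. cis (2 * pi * real k / real p)) {..<p}"
    using bij_betw_roots_unity[of p] m by (auto simp: bij_betw_def)
  from inj_onD[OF this e] m show False by auto
qed

lemma tab_g_bij:
  assumes q: "0 < q" "q \<noteq> 1" and S: "book q S" "card S = n" and p: "1 \<le> p"
    and k: "book_eq ((shape_g q p ^^ k) S) S" and fin: "finite (standard_tableaux n S)"
  shows "bij_betw (tab_g q p n S k) (standard_tableaux n S) (standard_tableaux n S)"
proof -
  have "inj_on (tab_g q p n S k) (standard_tableaux n S)"
  proof (rule inj_onI)
    fix L L' assume L: "L \<in> standard_tableaux n S" and L': "L' \<in> standard_tableaux n S"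
      and e: "tab_g q p n S k L = tab_g q p n S k L'"
    show "L = L'"
    proof (rule tableau_determined_by_weights[OF q S(1) L' L])
      fix i assume i: "i \<in> {1..n}"
      show "weight q L i = weight q L' i"
        using tab_g_tableau(2)[OF q S(1) L k i] tab_g_tableau(2)[OF q S(1) L' k i] e by simp
    qed
  qed
  moreover have "tab_g q p n S k ` standard_tableaux n S \<subseteq> standard_tableaux n S"
    using tab_g_tableau(1)[OF q S(1) _ k] by blast
  ultimately show ?thesis using fin by (simp add: bij_betw_def endo_inj_surj)
qed

text \<open>The two conditions are agreement on \<epsilon>_i - \<epsilon>_(i-1) and on p
  \<epsilon>_1. The second makes the quotient of the first entries a \<open>p\<close>-th root of
  unity, the first spreads this quotient to all entries.\<close>

lemma same_ratios_rotated:
  fixes p :: nat and z z' :: "nat \<Rightarrow> complex"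
  assumes p: "1 \<le> p" and nz: "\<And>i. i \<in> {1..n} \<Longrightarrow> z i \<noteq> 0 \<and> z' i \<noteq> 0" and n: "1 \<le> n"
    and ratio: "\<And>i. i \<in> {2..n} \<Longrightarrow> z i / z (i - 1) = z' i / z' (i - 1)"
    and first: "z 1 ^ p = z' 1 ^ p"
  obtains k where "\<And>i. i \<in> {1..n} \<Longrightarrow> z' i = cis (- (2 * pi / real p)) ^ k * z i"
proof -
  have "(z 1 / z' 1) ^ p = 1" using first nz[of 1] n by (simp add: power_divide)
  then obtain k where k: "z 1 / z' 1 = cis (2 * pi * real k / real p)"
    using bij_betw_roots_unity[of p] p by (force simp: bij_betw_def)
  have "cis (2 * pi * real k / real p) * cis (- (2 * pi / real p)) ^ k = 1"
    by (simp add: DeMoivre cis_mult)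
  then have k1: "z' 1 = cis (- (2 * pi / real p)) ^ k * z 1"
    using nz[of 1] n k by (simp add: field_simps)
  have "1 \<le> i \<Longrightarrow> i \<le> n \<longrightarrow> z' i = cis (- (2 * pi / real p)) ^ k * z i" for i
  proof (induction i rule: nat_induct_at_least)
    case base then show ?case using k1 by simp
  next
    case (Suc i)
    show ?case
    proof
      assume i: "Suc i \<le> n"
      have "z (Suc i) / z i = z' (Suc i) / z' i" using ratio[of "Suc i"] i Suc by simp
      moreover have "z i \<noteq> 0" "z' i \<noteq> 0" using nz[of i] i Suc by auto
      ultimately show "z' (Suc i) = cis (- (2 * pi / real p)) ^ k * z (Suc i)"
        using Suc i by (simp add: field_simps)
    qed
  qed
  then show ?thesis using that by auto
qed

section \<open>The affine Hecke algebra and its automorphism\<close>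

lemma group_algebra_simps:
  "carrier (group_algebra G) = {f. Poly_Mapping.keys f \<subseteq> carrier G}"
  "f \<oplus>\<^bsub>group_algebra G\<^esub> h = f + h" "\<zero>\<^bsub>group_algebra G\<^esub> = 0"
  "\<one>\<^bsub>group_algebra G\<^esub> = Poly_Mapping.single \<one>\<^bsub>G\<^esub> 1"
  by (simp_all add: group_algebra_def)

lemma group_algebra_mult_single:
  "Poly_Mapping.single a x \<otimes>\<^bsub>group_algebra G\<^esub> Poly_Mapping.single b y
     = Poly_Mapping.single (a \<otimes>\<^bsub>G\<^esub> b) (x * y)"
  by (simp add: group_algebra_def)

lemma group_algebra_induct [consumes 1, case_names single add]:
  assumes "f \<in> carrier (group_algebra G)"
    and "\<And>a x. a \<in> carrier G \<Longrightarrow> P (Poly_Mapping.single a x)"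
    and "\<And>f h. f \<in> carrier (group_algebra G) \<Longrightarrow> h \<in> carrier (group_algebra G) \<Longrightarrow> P f \<Longrightarrow> P h \<Longrightarrow> P (f + h)"
    and "group G"
  shows "P f"
proof -
  interpret group G by fact
  have P0: "P 0" using assms(2)[OF one_closed, of 0] by simp
  have dec: "f = (\<Sum>a\<in>Poly_Mapping.keys f. Poly_Mapping.single a (Poly_Mapping.lookup f a))"
    by (intro poly_mapping_eqI) (simp add: lookup_sum lookup_single when_def in_keys_iff sum.delta)
  have "(\<Sum>a\<in>A. Poly_Mapping.single a (Poly_Mapping.lookup f a)) \<in> carrier (group_algebra G)
     \<and> P (\<Sum>a\<in>A. Poly_Mapping.single a (Poly_Mapping.lookup f a))" if "finite A" "A \<subseteq> carrier G" for A
    using that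
  proof (induction A rule: finite_induct)
    case empty
    then show ?case using P0 by (simp add: group_algebra_simps)
  next
    case (insert b F)
    have s: "Poly_Mapping.single b (Poly_Mapping.lookup f b) \<in> carrier (group_algebra G)"
      using insert.prems by (simp add: group_algebra_simps)
    have IH: "(\<Sum>a\<in>F. Poly_Mapping.single a (Poly_Mapping.lookup f a)) \<in> carrier (group_algebra G)"
       "P (\<Sum>a\<in>F. Poly_Mapping.single a (Poly_Mapping.lookup f a))"
      using insert by auto
    have "P (Poly_Mapping.single b (Poly_Mapping.lookup f b))" using insert.prems by (intro assms(2)) simp
    then show ?case
      unfolding sum.insert[OF insert.hyps(1,2)]
      using assms(3)[OF s IH(1)] IH(2) s IH(1) ring.ring_simprules(1)[OF ring_group_algebra[OF assms(4)] s IH(1)]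
      by (simp add: group_algebra_simps(2))
  qed
  from this[OF finite_keys, of f] assms(1) show ?thesis
    by (subst dec) (simp add: group_algebra_simps)
qed

section \<open>Twisting a group algebra by a character of the group\<close>

definition char_twist :: "('g \<Rightarrow> complex) \<Rightarrow> ('g \<Rightarrow>\<^sub>0 complex) \<Rightarrow> ('g \<Rightarrow>\<^sub>0 complex)" where
  "char_twist \<chi> = Poly_Mapping.mapp (\<lambda>a c. \<chi> a * c)"

lemma lookup_char_twist [simp]: "Poly_Mapping.lookup (char_twist \<chi> f) a = \<chi> a * Poly_Mapping.lookup f a"
  by (simp add: char_twist_def lookup_mapp when_def in_keys_iff)

lemma char_twist_single [simp]:
  "char_twist \<chi> (Poly_Mapping.single a x) = Poly_Mapping.single a (\<chi> a * x)"
  by (intro poly_mapping_eqI) (simp add: lookup_single when_def)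

lemma char_twist_add: "char_twist \<chi> (f + h) = char_twist \<chi> f + char_twist \<chi> h"
  by (intro poly_mapping_eqI) (simp add: lookup_add algebra_simps)

lemma char_twist_diff: "char_twist \<chi> (f - h) = char_twist \<chi> f - char_twist \<chi> h"
  by (intro poly_mapping_eqI) (simp add: lookup_minus algebra_simps)

lemma char_twist_closed:
  "f \<in> carrier (group_algebra G) \<Longrightarrow> char_twist \<chi> f \<in> carrier (group_algebra G)"
  using keys_mapp_subset[of "\<lambda>a c. \<chi> a * c" f] by (auto simp: group_algebra_simps char_twist_def)

lemma char_twist_twist:
  assumes "\<And>a. \<chi> a * \<psi> a = 1" shows "char_twist \<chi> (char_twist \<psi> f) = f"
  by (intro poly_mapping_eqI) (simp add: assms mult.assoc[symmetric])

lemma char_twist_mult: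
  assumes G: "group G" and \<chi>: "\<And>a b. a \<in> carrier G \<Longrightarrow> b \<in> carrier G \<Longrightarrow> \<chi> (a \<otimes>\<^bsub>G\<^esub> b) = \<chi> a * \<chi> b"
    and f: "f \<in> carrier (group_algebra G)" and h: "h \<in> carrier (group_algebra G)"
  shows "char_twist \<chi> (f \<otimes>\<^bsub>group_algebra G\<^esub> h) = char_twist \<chi> f \<otimes>\<^bsub>group_algebra G\<^esub> char_twist \<chi> h"
proof -
  interpret A: ring "group_algebra G" by (rule ring_group_algebra[OF G])
  have sc: "Poly_Mapping.single a x \<in> carrier (group_algebra G)" if "a \<in> carrier G" for a and x :: complex
    using that by (simp add: group_algebra_simps)
  have 1: "char_twist \<chi> (Poly_Mapping.single a x \<otimes>\<^bsub>group_algebra G\<^esub> h)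
      = char_twist \<chi> (Poly_Mapping.single a x) \<otimes>\<^bsub>group_algebra G\<^esub> char_twist \<chi> h"
    if a: "a \<in> carrier G" for a x
    using h
  proof (induction h rule: group_algebra_induct)
    case (single b y)
    then show ?case using a by (simp add: group_algebra_mult_single \<chi> mult_ac)
  next
    case (add f h)
    then show ?case
      using A.r_distr[OF add(1,2) sc[OF a, of x]]
        A.r_distr[OF char_twist_closed[OF add(1), of \<chi>] char_twist_closed[OF add(2), of \<chi>]
          char_twist_closed[OF sc[OF a, of x], of \<chi>]]
      by (simp add: group_algebra_simps(2) char_twist_add)
  qed (rule G)
  from f show ?thesis
  proof (induction f rule: group_algebra_induct)
    case (single a x) then show ?case by (rule 1)
  next
    case (add f k)
    then show ?case
      using A.l_distr[OF add(1,2) h]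
        A.l_distr[OF char_twist_closed[OF add(1), of \<chi>] char_twist_closed[OF add(2), of \<chi>]
          char_twist_closed[OF h, of \<chi>]]
      by (simp add: group_algebra_simps(2) char_twist_add)
  qed (rule G)
qed

section \<open>The exponent sum of X on the affine braid group\<close>

lemma group_braid_group: "group (braid_group n)"
  unfolding braid_group_def by (rule group_presented_group)

lemma braid_elt_closed: "s \<in> braid_gens n \<Longrightarrow> braid_elt n s \<in> carrier (braid_group n)"
  by (auto simp: braid_elt_def braid_group_def presented_group_def words_def)

lemma braid_elt_gens_closed [simp]:
  "braid_elt n Xgen \<in> carrier (braid_group n)"
  "i \<in> {2..n} \<Longrightarrow> braid_elt n (Tgen i) \<in> carrier (braid_group n)"
  by (auto intro!: braid_elt_closed simp: braid_gens_def)

text \<open>The exponent sum of \<open>Xgen\<close>. Each braid relation has as many letters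
  \<open>Xgen\<close> on the left as on the right, so this descends to a homomorphism from the braid
  group to the integers; z to this degree is then a character for every nonzero z.\<close>

definition word_degree :: "braid_gen word \<Rightarrow> int" where
  "word_degree w = (\<Sum>(s, b)\<leftarrow>w. if s = Xgen then (if b then 1 else - 1) else 0)"

lemma word_degree_append [simp]: "word_degree (u @ v) = word_degree u + word_degree v"
  by (simp add: word_degree_def)

lemma word_degree_pres_eq:
  "pres_eq (braid_gens n) (braid_rel n) u v \<Longrightarrow> word_degree u = word_degree v"
proof (induction rule: pres_eq.induct)
  case (relator u v)
  from relator(1) show ?case by cases (auto simp: word_degree_def)
qed (auto simp: word_degree_def)

definition braid_degree :: "braid_gen word set \<Rightarrow> int" where
  "braid_degree A = word_degree (SOME w. w \<in> A)"

lemma braid_degree_class: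
  assumes "w \<in> words (braid_gens n)"
  shows "braid_degree (pres_class (braid_gens n) (braid_rel n) w) = word_degree w"
proof -
  have "w \<in> pres_class (braid_gens n) (braid_rel n) w"
    using assms by (simp add: pres_class_def pres_eq.refl)
  then have "(SOME u. u \<in> pres_class (braid_gens n) (braid_rel n) w) \<in> pres_class (braid_gens n) (braid_rel n) w"
    by (rule someI)
  then show ?thesis unfolding braid_degree_def by (simp add: pres_class_def word_degree_pres_eq)
qed

lemma braid_degree_mult:
  assumes "a \<in> carrier (braid_group n)" "b \<in> carrier (braid_group n)"
  shows "braid_degree (a \<otimes>\<^bsub>braid_group n\<^esub> b) = braid_degree a + braid_degree b"
proof -
  obtain u v where u: "u \<in> words (braid_gens n)" "a = pres_class (braid_gens n) (braid_rel n) u"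
    and v: "v \<in> words (braid_gens n)" "b = pres_class (braid_gens n) (braid_rel n) v"
    using assms by (auto simp: braid_group_def presented_group_def)
  then show ?thesis
    by (simp add: braid_group_def pres_mult braid_degree_class words_append)
qed

lemma braid_degree_gens:
  "braid_degree (braid_elt n Xgen) = 1"
  "i \<in> {2..n} \<Longrightarrow> braid_degree (braid_elt n (Tgen i)) = 0"
  unfolding braid_elt_def
  by (subst braid_degree_class; auto simp: words_def braid_gens_def word_degree_def)+

lemma braid_degree_one: "braid_degree \<one>\<^bsub>braid_group n\<^esub> = 0"
  using braid_degree_class[of "[]" n]
  by (simp add: braid_group_def presented_group_def words_def word_degree_def)

section \<open>Descent of the degree twist to the Hecke algebra\<close>

definition hecke_relators :: "nat \<Rightarrow> real \<Rightarrow> (braid_gen word set \<Rightarrow>\<^sub>0 complex) set" where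
  "hecke_relators n q = {Poly_Mapping.single (braid_elt n (Tgen i) \<otimes>\<^bsub>braid_group n\<^esub> braid_elt n (Tgen i)) 1
          - (Poly_Mapping.single (braid_elt n (Tgen i)) (of_real (q - inverse q))
             + Poly_Mapping.single \<one>\<^bsub>braid_group n\<^esub> 1) | i. i \<in> {2..n}}"

lemma hecke_relators_closed: "hecke_relators n q \<subseteq> carrier (group_algebra (braid_group n))"
proof -
  interpret B: group "braid_group n" by (rule group_braid_group)
  show ?thesis
    unfolding hecke_relators_def group_algebra_simps
    by (auto dest!: subsetD[OF keys_diff] subsetD[OF keys_add] split: if_splits)
qed

lemma hecke_ideal_ideal: "ideal (hecke_ideal n q) (group_algebra (braid_group n))"
  using ring.genideal_ideal[OF ring_group_algebra[OF group_braid_group] hecke_relators_closed]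
  by (simp add: hecke_ideal_def hecke_relators_def)

lemma hecke_ideal_minimal:
  assumes "ideal J (group_algebra (braid_group n))" "hecke_relators n q \<subseteq> J"
  shows "hecke_ideal n q \<subseteq> J"
  using assms unfolding hecke_ideal_def genideal_def hecke_relators_def by blast

lemma hecke_ideal_closed: "f \<in> hecke_ideal n q \<Longrightarrow> f \<in> carrier (group_algebra (braid_group n))"
  using hecke_ideal_ideal[of n q] by (meson ideal.Icarr)

lemma hecke_of_hom: "hecke_of n q \<in> ring_hom (group_algebra (braid_group n)) (hecke n q)"
  using ideal.rcos_ring_hom[OF hecke_ideal_ideal, of n q]
  unfolding hecke_def hecke_of_def by (simp add: fun_eq_iff ring_hom_def)

lemma hecke_carrier: "carrier (hecke n q) = hecke_of n q ` carrier (group_algebra (braid_group n))"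
  by (auto simp: hecke_def FactRing_def A_RCOSETS_def' hecke_of_def)

definition degree_twist :: "complex \<Rightarrow> (braid_gen word set \<Rightarrow>\<^sub>0 complex) \<Rightarrow> (braid_gen word set \<Rightarrow>\<^sub>0 complex)" where
  "degree_twist z = char_twist (\<lambda>a. z powi braid_degree a)"

lemma degree_twist_inverse:
  "z \<noteq> 0 \<Longrightarrow> degree_twist z (degree_twist (inverse z) f) = f"
  unfolding degree_twist_def by (intro char_twist_twist) (simp add: power_int_inverse)

lemma degree_twist_hom:
  assumes "z \<noteq> 0"
  shows "degree_twist z \<in> ring_hom (group_algebra (braid_group n)) (group_algebra (braid_group n))"
proof (rule ring_hom_memI)
  let ?A = "group_algebra (braid_group n)"
  show "degree_twist z f \<in> carrier ?A" if "f \<in> carrier ?A" for f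
    using that unfolding degree_twist_def by (rule char_twist_closed)
  show "degree_twist z (f \<otimes>\<^bsub>?A\<^esub> h) = degree_twist z f \<otimes>\<^bsub>?A\<^esub> degree_twist z h"
    if "f \<in> carrier ?A" "h \<in> carrier ?A" for f h
    unfolding degree_twist_def
    by (rule char_twist_mult[OF group_braid_group])
       (use that assms in \<open>auto simp: braid_degree_mult power_int_add\<close>)
  show "degree_twist z (f \<oplus>\<^bsub>?A\<^esub> h) = degree_twist z f \<oplus>\<^bsub>?A\<^esub> degree_twist z h" for f h
    by (simp add: group_algebra_simps degree_twist_def char_twist_add)
  show "degree_twist z \<one>\<^bsub>?A\<^esub> = \<one>\<^bsub>?A\<^esub>"
    by (simp add: group_algebra_simps degree_twist_def braid_degree_one)
qed

text \<open>The quadratic relators involve only braids of degree 0 and are fixed by the twist. So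
  the preimage of the ideal is an ideal that contains them; equality follows by applying this to the
  inverse of \<open>z\<close> as well.\<close>

lemma degree_twist_ideal:
  assumes "z \<noteq> 0" shows "degree_twist z ` hecke_ideal n q = hecke_ideal n q"
proof -
  let ?A = "group_algebra (braid_group n)"
  note rA = ring_group_algebra[OF group_braid_group, of n]
  have sub: "degree_twist z ` hecke_ideal n q \<subseteq> hecke_ideal n q" if z: "z \<noteq> 0" for z
  proof -
    have "ideal {f \<in> carrier ?A. degree_twist z f \<in> hecke_ideal n q} ?A"
      by (rule ring_hom_ring.ideal_vimage[OF ring_hom_ringI2[OF rA rA degree_twist_hom[OF z]] hecke_ideal_ideal])
    moreover have "hecke_relators n q \<subseteq> {f \<in> carrier ?A. degree_twist z f \<in> hecke_ideal n q}"
    proof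
      fix f assume f: "f \<in> hecke_relators n q"
      have "degree_twist z f = f"
        using f by (auto simp: hecke_relators_def degree_twist_def char_twist_add char_twist_diff
          braid_degree_one braid_degree_mult braid_degree_gens)
      moreover have "f \<in> hecke_ideal n q"
        using f ring.genideal_self[OF rA hecke_relators_closed, of q]
        by (auto simp: hecke_ideal_def hecke_relators_def)
      ultimately show "f \<in> {f \<in> carrier ?A. degree_twist z f \<in> hecke_ideal n q}"
        using hecke_ideal_closed by auto
    qed
    ultimately show ?thesis using hecke_ideal_minimal by blast
  qed
  show ?thesis
  proof
    show "hecke_ideal n q \<subseteq> degree_twist z ` hecke_ideal n q"
    proof
      fix f assume "f \<in> hecke_ideal n q"
      then have "degree_twist (inverse z) f \<in> hecke_ideal n q" using sub[of "inverse z"] assms by auto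
      then show "f \<in> degree_twist z ` hecke_ideal n q"
        using degree_twist_inverse[OF assms, of f] by (metis image_eqI)
    qed
  qed (rule sub[OF assms])
qed

text \<open>Elements of the quotient are cosets, hence sets, and the induced automorphism can be
  written as the direct image.\<close>

lemma degree_twist_hecke_of:
  assumes "z \<noteq> 0"
  shows "degree_twist z ` hecke_of n q f = hecke_of n q (degree_twist z f)"
proof -
  have c: "hecke_of n q f = (\<lambda>h. h + f) ` hecke_ideal n q" for f
    unfolding hecke_of_def by (auto simp: a_r_coset_def' group_algebra_simps)
  have "degree_twist z ` hecke_of n q f = (\<lambda>h. h + degree_twist z f) ` degree_twist z ` hecke_ideal n q"
    unfolding c image_image by (simp add: degree_twist_def char_twist_add)
  then show ?thesis by (simp add: degree_twist_ideal[OF assms] c)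
qed

lemma degree_twist_ring_iso:
  assumes "z \<noteq> 0"
  shows "(`) (degree_twist z) \<in> ring_iso (hecke n q) (hecke n q)"
proof -
  let ?A = "group_algebra (braid_group n)" and ?H = "hecke n q"
  interpret A: ring ?A by (rule ring_group_algebra[OF group_braid_group])
  note \<pi> = ring_hom_closed[OF hecke_of_hom] ring_hom_mult[OF hecke_of_hom, symmetric]
     ring_hom_add[OF hecke_of_hom, symmetric] ring_hom_one[OF hecke_of_hom, symmetric]
  note \<phi> = ring_hom_closed[OF degree_twist_hom] ring_hom_mult[OF degree_twist_hom]
     ring_hom_add[OF degree_twist_hom] ring_hom_one[OF degree_twist_hom]
  have "(`) (degree_twist z) \<in> ring_hom ?H ?H"
  proof (rule ring_hom_memI)
    fix x y assume "x \<in> carrier ?H" "y \<in> carrier ?H"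
    then obtain f h where f: "f \<in> carrier ?A" "x = hecke_of n q f" and h: "h \<in> carrier ?A" "y = hecke_of n q h"
      unfolding hecke_carrier by blast
    show "degree_twist z ` x \<in> carrier ?H"
      using f \<phi>(1)[OF assms f(1)] by (simp add: degree_twist_hecke_of[OF assms] \<pi>(1))
    show "degree_twist z ` (x \<otimes>\<^bsub>?H\<^esub> y) = degree_twist z ` x \<otimes>\<^bsub>?H\<^esub> degree_twist z ` y"
      using f h \<phi>(1)[OF assms f(1)] \<phi>(1)[OF assms h(1)]
      by (simp only: \<pi>(2) degree_twist_hecke_of[OF assms] \<phi>(2)[OF assms])
    show "degree_twist z ` (x \<oplus>\<^bsub>?H\<^esub> y) = degree_twist z ` x \<oplus>\<^bsub>?H\<^esub> degree_twist z ` y"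
      using f h \<phi>(1)[OF assms f(1)] \<phi>(1)[OF assms h(1)]
      by (simp only: \<pi>(3) degree_twist_hecke_of[OF assms] \<phi>(3)[OF assms])
  next
    show "degree_twist z ` \<one>\<^bsub>?H\<^esub> = \<one>\<^bsub>?H\<^esub>"
      by (simp only: \<pi>(4) degree_twist_hecke_of[OF assms] \<phi>(4)[OF assms])
  qed
  moreover have "bij_betw ((`) (degree_twist z)) (carrier ?H) (carrier ?H)"
  proof (rule bij_betwI[of _ _ _ "(`) (degree_twist (inverse z))"])
    have "(`) (degree_twist z) \<in> carrier ?H \<rightarrow> carrier ?H" if "z \<noteq> 0" for z
      using \<phi>(1)[OF that, of _ n] by (auto simp: hecke_carrier degree_twist_hecke_of that)
    then show "(`) (degree_twist z) \<in> carrier ?H \<rightarrow> carrier ?H"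
      "(`) (degree_twist (inverse z)) \<in> carrier ?H \<rightarrow> carrier ?H" using assms by simp_all
    show "degree_twist (inverse z) ` degree_twist z ` x = x" for x
      using degree_twist_inverse[of "inverse z"] assms by (simp add: image_image)
    show "degree_twist z ` degree_twist (inverse z) ` x = x" for x
      using degree_twist_inverse[of z] assms by (simp add: image_image)
  qed
  ultimately show ?thesis by (simp add: ring_iso_def)
qed

section \<open>The elements X^\<lambda> of the braid group\<close>

lemma foldr_mult_one:
  assumes "monoid G" "\<And>k. k \<in> set xs \<Longrightarrow> f k = \<one>\<^bsub>G\<^esub>"
  shows "foldr (\<lambda>k x. f k \<otimes>\<^bsub>G\<^esub> x) xs \<one>\<^bsub>G\<^esub> = \<one>\<^bsub>G\<^esub>"
  using assms by (induction xs) (auto simp: monoid.l_one monoid.one_closed)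

lemma foldr_mult_single:
  assumes "monoid G" "distinct xs" "i \<in> set xs" "\<And>k. k \<in> set xs \<Longrightarrow> k \<noteq> i \<Longrightarrow> f k = \<one>\<^bsub>G\<^esub>"
    "f i \<in> carrier G"
  shows "foldr (\<lambda>k x. f k \<otimes>\<^bsub>G\<^esub> x) xs \<one>\<^bsub>G\<^esub> = f i"
  using assms(2-5)
proof (induction xs)
  case (Cons a xs)
  show ?case
  proof (cases "a = i")
    case True
    then have "foldr (\<lambda>k x. f k \<otimes>\<^bsub>G\<^esub> x) xs \<one>\<^bsub>G\<^esub> = \<one>\<^bsub>G\<^esub>"
      using Cons.prems by (intro foldr_mult_one[OF assms(1)]) auto
    then show ?thesis using True Cons.prems assms(1) by (simp add: monoid.r_one)
  next
    case False
    then show ?thesis using Cons assms(1) by (simp add: monoid.l_one)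
  qed
qed simp

lemma braid_Xeps_closed: "i \<le> n \<Longrightarrow> braid_Xeps n i \<in> carrier (braid_group n)"
proof -
  interpret B: group "braid_group n" by (rule group_braid_group)
  show "i \<le> n \<Longrightarrow> braid_Xeps n i \<in> carrier (braid_group n)"
    by (induction n i rule: braid_Xeps.induct) (auto simp: group.is_monoid group_braid_group monoid.m_closed)
qed

lemma braid_X_closed: "braid_X n lam \<in> carrier (braid_group n)"
proof -
  interpret B: group "braid_group n" by (rule group_braid_group)
  have *: "set xs \<subseteq> {..n} \<Longrightarrow> foldr (\<lambda>i x. (braid_Xeps n i [^]\<^bsub>braid_group n\<^esub> lam i) \<otimes>\<^bsub>braid_group n\<^esub> x)
       xs \<one>\<^bsub>braid_group n\<^esub> \<in> carrier (braid_group n)" for xs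
    by (induction xs) (auto simp: braid_Xeps_closed)
  show ?thesis unfolding braid_X_def by (rule *) auto
qed

lemma braid_X_eps:
  assumes "i \<in> {1..n}" shows "braid_X n (eps i) = braid_Xeps n i"
proof -
  interpret B: group "braid_group n" by (rule group_braid_group)
  have "braid_X n (eps i) = braid_Xeps n i [^]\<^bsub>braid_group n\<^esub> eps i i"
    unfolding braid_X_def
    by (rule foldr_mult_single[OF B.is_monoid]) (use assms in \<open>auto simp: eps_def braid_Xeps_closed\<close>)
  then show ?thesis using assms by (simp add: eps_def braid_Xeps_closed)
qed

section \<open>Scalars, generators and induction in the Hecke algebra\<close>

definition hecke_braid :: "nat \<Rightarrow> real \<Rightarrow> braid_gen word set \<Rightarrow> hecke_elt" where
  "hecke_braid n q a = hecke_of n q (Poly_Mapping.single a 1)"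

lemma hecke_braid_simps:
  "hecke_T n q i = hecke_braid n q (braid_elt n (Tgen i))"
  "hecke_X n q lam = hecke_braid n q (braid_X n lam)"
  by (simp_all add: hecke_T_def hecke_X_def hecke_braid_def)

lemma single_closed: "a \<in> carrier G \<Longrightarrow> Poly_Mapping.single a x \<in> carrier (group_algebra G)"
  by (simp add: group_algebra_simps)

lemma hecke_braid_closed: "a \<in> carrier (braid_group n) \<Longrightarrow> hecke_braid n q a \<in> carrier (hecke n q)"
  unfolding hecke_braid_def by (intro ring_hom_closed[OF hecke_of_hom] single_closed)

lemma hecke_braid_mult:
  assumes "a \<in> carrier (braid_group n)" "b \<in> carrier (braid_group n)"
  shows "hecke_braid n q (a \<otimes>\<^bsub>braid_group n\<^esub> b) = hecke_braid n q a \<otimes>\<^bsub>hecke n q\<^esub> hecke_braid n q b"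
  using ring_hom_mult[OF hecke_of_hom single_closed[OF assms(1)] single_closed[OF assms(2)], of q 1 1]
  by (simp add: hecke_braid_def group_algebra_mult_single)

lemma hecke_braid_one: "hecke_braid n q \<one>\<^bsub>braid_group n\<^esub> = \<one>\<^bsub>hecke n q\<^esub>"
  using ring_hom_one[OF hecke_of_hom, of n q] by (simp add: hecke_braid_def group_algebra_simps)

lemma hecke_scalar_closed: "hecke_scalar n q z \<in> carrier (hecke n q)"
  unfolding hecke_scalar_def
  by (intro ring_hom_closed[OF hecke_of_hom] single_closed monoid.one_closed group.is_monoid group_braid_group)

lemma hecke_scalar_one: "hecke_scalar n q 1 = \<one>\<^bsub>hecke n q\<^esub>"
  using hecke_braid_one[of n q] by (simp add: hecke_scalar_def hecke_braid_def)

lemma hecke_scalar_add: "hecke_scalar n q (a + b) = hecke_scalar n q a \<oplus>\<^bsub>hecke n q\<^esub> hecke_scalar n q b"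
proof -
  interpret B: group "braid_group n" by (rule group_braid_group)
  show ?thesis
    using ring_hom_add[OF hecke_of_hom single_closed[OF B.one_closed] single_closed[OF B.one_closed], of q a b]
    by (simp add: hecke_scalar_def group_algebra_simps(2) single_add)
qed

lemma hecke_scalar_mult: "hecke_scalar n q (a * b) = hecke_scalar n q a \<otimes>\<^bsub>hecke n q\<^esub> hecke_scalar n q b"
proof -
  interpret B: group "braid_group n" by (rule group_braid_group)
  show ?thesis
    using ring_hom_mult[OF hecke_of_hom single_closed[OF B.one_closed] single_closed[OF B.one_closed], of q a b]
    by (simp add: hecke_scalar_def group_algebra_mult_single)
qed

lemma hecke_of_single:
  assumes "a \<in> carrier (braid_group n)"
  shows "hecke_of n q (Poly_Mapping.single a z) = hecke_scalar n q z \<otimes>\<^bsub>hecke n q\<^esub> hecke_braid n q a"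
    and "hecke_of n q (Poly_Mapping.single a z) = hecke_braid n q a \<otimes>\<^bsub>hecke n q\<^esub> hecke_scalar n q z"
proof -
  interpret B: group "braid_group n" by (rule group_braid_group)
  show "hecke_of n q (Poly_Mapping.single a z) = hecke_scalar n q z \<otimes>\<^bsub>hecke n q\<^esub> hecke_braid n q a"
    using ring_hom_mult[OF hecke_of_hom single_closed[OF B.one_closed] single_closed[OF assms], of q z 1] assms
    by (simp add: hecke_scalar_def hecke_braid_def group_algebra_mult_single)
  show "hecke_of n q (Poly_Mapping.single a z) = hecke_braid n q a \<otimes>\<^bsub>hecke n q\<^esub> hecke_scalar n q z"
    using ring_hom_mult[OF hecke_of_hom single_closed[OF assms] single_closed[OF B.one_closed], of q 1 z] assms
    by (simp add: hecke_scalar_def hecke_braid_def group_algebra_mult_single)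
qed

lemma hecke_induct [consumes 1, case_names single add]:
  assumes "x \<in> carrier (hecke n q)"
    and "\<And>z a. a \<in> carrier (braid_group n) \<Longrightarrow> P (hecke_scalar n q z \<otimes>\<^bsub>hecke n q\<^esub> hecke_braid n q a)"
    and "\<And>x y. x \<in> carrier (hecke n q) \<Longrightarrow> y \<in> carrier (hecke n q) \<Longrightarrow> P x \<Longrightarrow> P y
      \<Longrightarrow> P (x \<oplus>\<^bsub>hecke n q\<^esub> y)"
  shows "P x"
proof -
  obtain f where f: "f \<in> carrier (group_algebra (braid_group n))" "x = hecke_of n q f"
    using assms(1) hecke_carrier by auto
  have "P (hecke_of n q f)" using f(1)
  proof (induction f rule: group_algebra_induct)
    case (single a x) then show ?case using assms(2) hecke_of_single(1) by simp
  next
    case (add f h)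
    then have "P (hecke_of n q f \<oplus>\<^bsub>hecke n q\<^esub> hecke_of n q h)"
      by (intro assms(3) ring_hom_closed[OF hecke_of_hom])
    then show ?case using ring_hom_add[OF hecke_of_hom add(1,2), of q] by (simp add: group_algebra_simps)
  qed (rule group_braid_group)
  then show ?thesis using f by simp
qed

lemma hecke_scalar_central:
  assumes "x \<in> carrier (hecke n q)"
  shows "hecke_scalar n q z \<otimes>\<^bsub>hecke n q\<^esub> x = x \<otimes>\<^bsub>hecke n q\<^esub> hecke_scalar n q z"
proof -
  interpret H: ring "hecke n q" by (rule ring_hecke)
  show ?thesis using assms
  proof (induction x rule: hecke_induct)
    case (single w a)
    note c = hecke_scalar_closed[of n q z] hecke_scalar_closed[of n q w] hecke_braid_closed[OF single, of q]
    have "hecke_scalar n q z \<otimes>\<^bsub>hecke n q\<^esub> (hecke_scalar n q w \<otimes>\<^bsub>hecke n q\<^esub> hecke_braid n q a)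
        = hecke_scalar n q (z * w) \<otimes>\<^bsub>hecke n q\<^esub> hecke_braid n q a"
      using c by (simp add: hecke_scalar_mult H.m_assoc)
    also have "\<dots> = hecke_braid n q a \<otimes>\<^bsub>hecke n q\<^esub> hecke_scalar n q (w * z)"
      using hecke_of_single[OF single] by (simp add: mult.commute)
    also have "\<dots> = (hecke_braid n q a \<otimes>\<^bsub>hecke n q\<^esub> hecke_scalar n q w) \<otimes>\<^bsub>hecke n q\<^esub> hecke_scalar n q z"
      using c by (simp add: hecke_scalar_mult H.m_assoc)
    also have "hecke_braid n q a \<otimes>\<^bsub>hecke n q\<^esub> hecke_scalar n q w = hecke_scalar n q w \<otimes>\<^bsub>hecke n q\<^esub> hecke_braid n q a"
      using hecke_of_single[OF single] by simp
    finally show ?case .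
  next
    case (add x y)
    then show ?case by (simp add: H.r_distr H.l_distr hecke_scalar_closed)
  qed
qed

text \<open>Braid words contain inverse letters. The closure condition on two-sided inverses takes
  care of them, so that a property has to be verified directly only for scalars, the T_i and
  X^(\<epsilon>_1).\<close>

lemma hecke_generated_induct [consumes 2, case_names scalar T X add mult inverse]:
  assumes x: "x \<in> carrier (hecke n q)" and n: "1 \<le> n"
    and scalar: "\<And>z. P (hecke_scalar n q z)"
    and T: "\<And>i. i \<in> {2..n} \<Longrightarrow> P (hecke_T n q i)"
    and X: "P (hecke_X n q (eps 1))"
    and add: "\<And>x y. x \<in> carrier (hecke n q) \<Longrightarrow> y \<in> carrier (hecke n q) \<Longrightarrow> P x \<Longrightarrow> P y
      \<Longrightarrow> P (x \<oplus>\<^bsub>hecke n q\<^esub> y)"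
    and mult: "\<And>x y. x \<in> carrier (hecke n q) \<Longrightarrow> y \<in> carrier (hecke n q) \<Longrightarrow> P x \<Longrightarrow> P y
      \<Longrightarrow> P (x \<otimes>\<^bsub>hecke n q\<^esub> y)"
    and inverse: "\<And>x y. x \<in> carrier (hecke n q) \<Longrightarrow> y \<in> carrier (hecke n q) \<Longrightarrow> P x
      \<Longrightarrow> x \<otimes>\<^bsub>hecke n q\<^esub> y = \<one>\<^bsub>hecke n q\<^esub> \<Longrightarrow> y \<otimes>\<^bsub>hecke n q\<^esub> x = \<one>\<^bsub>hecke n q\<^esub> \<Longrightarrow> P y"
  shows "P x"
proof -
  interpret B: group "braid_group n" by (rule group_braid_group)
  define cl where "cl = pres_class (braid_gens n) (braid_rel n)"
  have clmult: "cl (u @ v) = cl u \<otimes>\<^bsub>braid_group n\<^esub> cl v"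
    if "u \<in> words (braid_gens n)" "v \<in> words (braid_gens n)" for u v
    using that by (simp add: cl_def braid_group_def pres_mult)
  have clc: "cl w \<in> carrier (braid_group n)" if "w \<in> words (braid_gens n)" for w
    using that by (simp add: cl_def braid_group_def presented_group_def)
  have cl1: "cl [] = \<one>\<^bsub>braid_group n\<^esub>" by (simp add: cl_def braid_group_def presented_group_def)
  have sw: "[(s, b)] \<in> words (braid_gens n)" if "s \<in> braid_gens n" for s b
    using that by (simp add: words_def)
  have pos: "P (hecke_braid n q (cl [(s, True)]))" if s: "s \<in> braid_gens n" for s
  proof -
    consider i where "i \<in> {2..n}" "s = Tgen i" | "s = Xgen" using s by (auto simp: braid_gens_def)
    then show ?thesis
    proof cases
      case 1 then show ?thesis using T[of i] by (simp add: hecke_braid_simps braid_elt_def cl_def)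
    next
      case 2
      have "braid_X n (eps 1) = braid_elt n Xgen" using braid_X_eps[of 1 n] n by simp
      then show ?thesis using 2 X by (simp add: hecke_braid_simps braid_elt_def cl_def)
    qed
  qed
  have letter: "P (hecke_braid n q (cl [(s, b)]))" if s: "s \<in> braid_gens n" for s b
  proof (cases b)
    case True then show ?thesis using pos[OF s] by simp
  next
    case False
    have "cl ([(s, b)] @ [(s, \<not> b)]) = cl []" for b
      using pres_eq.cancel[OF s, of "braid_rel n" b] sw[OF s]
      unfolding cl_def by (subst pres_class_eq_iff) (auto simp: words_append words_def)
    then have inv: "cl [(s, b)] \<otimes>\<^bsub>braid_group n\<^esub> cl [(s, \<not> b)] = \<one>\<^bsub>braid_group n\<^esub>" for b
      using clmult[OF sw[OF s] sw[OF s]] cl1 by simp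
    show ?thesis
    proof (rule inverse[OF _ _ pos[OF s]])
      show "hecke_braid n q (cl [(s, True)]) \<otimes>\<^bsub>hecke n q\<^esub> hecke_braid n q (cl [(s, b)]) = \<one>\<^bsub>hecke n q\<^esub>"
        using inv[of True] hecke_braid_mult[OF clc[OF sw[OF s]] clc[OF sw[OF s]], of q True False] False
        by (simp add: hecke_braid_one)
      show "hecke_braid n q (cl [(s, b)]) \<otimes>\<^bsub>hecke n q\<^esub> hecke_braid n q (cl [(s, True)]) = \<one>\<^bsub>hecke n q\<^esub>"
        using inv[of False] hecke_braid_mult[OF clc[OF sw[OF s]] clc[OF sw[OF s]], of q False True] False
        by (simp add: hecke_braid_one)
    qed (intro hecke_braid_closed clc sw s)+
  qed
  have word: "w \<in> words (braid_gens n) \<Longrightarrow> P (hecke_braid n q (cl w))" for w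
  proof (induction w)
    case Nil
    then show ?case using scalar[of 1] by (simp add: cl1 hecke_braid_one hecke_scalar_one)
  next
    case (Cons a w)
    obtain s b where a: "a = (s, b)" by (cases a)
    have s: "s \<in> braid_gens n" and w: "w \<in> words (braid_gens n)" using Cons.prems a by (auto simp: words_def)
    have "cl (a # w) = cl [(s, b)] \<otimes>\<^bsub>braid_group n\<^esub> cl w" using clmult[OF sw[OF s] w] a by simp
    then have "hecke_braid n q (cl (a # w)) = hecke_braid n q (cl [(s, b)]) \<otimes>\<^bsub>hecke n q\<^esub> hecke_braid n q (cl w)"
      using hecke_braid_mult[OF clc[OF sw[OF s]] clc[OF w]] by simp
    moreover have "P (hecke_braid n q (cl [(s, b)]) \<otimes>\<^bsub>hecke n q\<^esub> hecke_braid n q (cl w))"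
      by (intro mult hecke_braid_closed clc sw s w letter Cons.IH)
    ultimately show ?case by simp
  qed
  from x show ?thesis
  proof (induction x rule: hecke_induct)
    case (single z a)
    obtain w where w: "w \<in> words (braid_gens n)" "a = cl w"
      using single by (auto simp: braid_group_def presented_group_def cl_def)
    show ?case
      by (intro mult hecke_scalar_closed hecke_braid_closed single scalar) (use word w in simp)
  next
    case (add x y) then show ?case using assms(6) by blast
  qed
qed

text \<open>\<open>hecke_g\<close> is a choice, and the direct image under the degree twist by \<xi>
  shows that there is something to choose from. The four properties hold for whichever automorphism
  is chosen.\<close>

lemma hecke_g_properties:
  assumes "1 \<le> n"
  shows "hecke_g n q p \<in> ring_iso (hecke n q) (hecke n q)"
    and "hecke_g n q p (hecke_scalar n q z) = hecke_scalar n q z"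
    and "hecke_g n q p (hecke_X n q (eps 1)) =
          hecke_scalar n q (cis (2 * pi / real p)) \<otimes>\<^bsub>hecke n q\<^esub> hecke_X n q (eps 1)"
    and "i \<in> {2..n} \<Longrightarrow> hecke_g n q p (hecke_T n q i) = hecke_T n q i"
proof -
  define \<sigma> where "\<sigma> = ((`) (degree_twist (cis (2 * pi / real p))) :: hecke_elt \<Rightarrow> hecke_elt)"
  have X1: "braid_X n (eps 1) = braid_elt n Xgen" using braid_X_eps[of 1 n] assms by simp
  have "\<sigma> \<in> ring_iso (hecke n q) (hecke n q)"
    unfolding \<sigma>_def by (rule degree_twist_ring_iso) simp
  moreover have "\<sigma> (hecke_scalar n q z) = hecke_scalar n q z" for z
    unfolding \<sigma>_def hecke_scalar_def
    by (simp add: degree_twist_hecke_of) (simp add: degree_twist_def braid_degree_one)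
  moreover have "\<sigma> (hecke_X n q (eps 1)) = hecke_scalar n q (cis (2 * pi / real p)) \<otimes>\<^bsub>hecke n q\<^esub> hecke_X n q (eps 1)"
  proof -
    have "\<sigma> (hecke_X n q (eps 1)) = hecke_of n q (Poly_Mapping.single (braid_elt n Xgen) (cis (2 * pi / real p)))"
      unfolding \<sigma>_def hecke_X_def X1
      by (simp add: degree_twist_hecke_of) (simp add: degree_twist_def braid_degree_gens)
    also have "\<dots> = hecke_scalar n q (cis (2 * pi / real p)) \<otimes>\<^bsub>hecke n q\<^esub> hecke_X n q (eps 1)"
      unfolding hecke_braid_simps X1 by (rule hecke_of_single) simp
    finally show ?thesis .
  qed
  moreover have "\<forall>i\<in>{2..n}. \<sigma> (hecke_T n q i) = hecke_T n q i"
  proof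
    fix i assume "i \<in> {2..n}"
    then show "\<sigma> (hecke_T n q i) = hecke_T n q i"
      unfolding \<sigma>_def hecke_T_def
      by (simp add: degree_twist_hecke_of del: atLeastAtMost_iff) (simp add: degree_twist_def braid_degree_gens)
  qed
  ultimately have "\<exists>\<sigma>. \<sigma> \<in> ring_iso (hecke n q) (hecke n q)
      \<and> (\<forall>z. \<sigma> (hecke_scalar n q z) = hecke_scalar n q z)
      \<and> \<sigma> (hecke_X n q (eps 1)) =
          hecke_scalar n q (cis (2 * pi / real p)) \<otimes>\<^bsub>hecke n q\<^esub> hecke_X n q (eps 1)
      \<and> (\<forall>i\<in>{2..n}. \<sigma> (hecke_T n q i) = hecke_T n q i)" by blast
  from someI_ex[OF this, folded hecke_g_def]
  show "hecke_g n q p \<in> ring_iso (hecke n q) (hecke n q)"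
    "hecke_g n q p (hecke_scalar n q z) = hecke_scalar n q z"
    "hecke_g n q p (hecke_X n q (eps 1)) =
          hecke_scalar n q (cis (2 * pi / real p)) \<otimes>\<^bsub>hecke n q\<^esub> hecke_X n q (eps 1)"
    "i \<in> {2..n} \<Longrightarrow> hecke_g n q p (hecke_T n q i) = hecke_T n q i" by blast+
qed

lemma hecke_X_step:
  assumes "i \<in> {2..n}"
  shows "hecke_X n q (eps i) = hecke_T n q i \<otimes>\<^bsub>hecke n q\<^esub> hecke_X n q (eps (i - 1)) \<otimes>\<^bsub>hecke n q\<^esub> hecke_T n q i"
proof -
  interpret B: group "braid_group n" by (rule group_braid_group)
  obtain k where k: "i = Suc (Suc k)" using assms by (cases i; cases "i - 1") auto
  have 1: "braid_X n (eps i) = braid_elt n (Tgen i) \<otimes>\<^bsub>braid_group n\<^esub> braid_X n (eps (i - 1))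
      \<otimes>\<^bsub>braid_group n\<^esub> braid_elt n (Tgen i)"
    using braid_X_eps[of i n] braid_X_eps[of "i - 1" n] assms k by simp
  have c: "braid_elt n (Tgen i) \<in> carrier (braid_group n)" using assms by simp
  show ?thesis
    unfolding hecke_braid_simps 1 using c braid_X_closed by (simp only: hecke_braid_mult B.m_closed)
qed

lemma hecke_T_closed: "i \<in> {2..n} \<Longrightarrow> hecke_T n q i \<in> carrier (hecke n q)"
  unfolding hecke_braid_simps by (intro hecke_braid_closed) simp

lemma hecke_X_closed: "hecke_X n q lam \<in> carrier (hecke n q)"
  unfolding hecke_braid_simps by (intro hecke_braid_closed braid_X_closed)

text \<open>The recursion X^(\<epsilon>_i) = T_i X^(\<epsilon>_(i-1)) T_i passes the factor \<xi> on
  unchanged, because scalars are central and the T_i are fixed.\<close>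

lemma hecke_g_X:
  assumes n: "1 \<le> n" and i: "i \<in> {1..n}"
  shows "hecke_g n q p (hecke_X n q (eps i)) =
    hecke_scalar n q (cis (2 * pi / real p)) \<otimes>\<^bsub>hecke n q\<^esub> hecke_X n q (eps i)"
proof -
  interpret H: ring "hecke n q" by (rule ring_hecke)
  let ?z = "hecke_scalar n q (cis (2 * pi / real p))"
  have hom: "hecke_g n q p \<in> ring_hom (hecke n q) (hecke n q)"
    using hecke_g_properties(1)[OF n] by (simp add: ring_iso_def)
  have "1 \<le> i \<Longrightarrow> i \<le> n \<longrightarrow> hecke_g n q p (hecke_X n q (eps i)) = ?z \<otimes>\<^bsub>hecke n q\<^esub> hecke_X n q (eps i)"
  proof (induction i rule: nat_induct_at_least)
    case base
    show ?case using hecke_g_properties(3)[OF n] by simp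
  next
    case (Suc i)
    show ?case
    proof
      assume "Suc i \<le> n"
      then have i: "Suc i \<in> {2..n}" "i \<le> n" using Suc by auto
      note c = hecke_T_closed[OF i(1), of q] hecke_X_closed[of n q "eps i"]
        hecke_scalar_closed[of n q "cis (2 * pi / real p)"]
      have "hecke_g n q p (hecke_X n q (eps (Suc i)))
          = hecke_T n q (Suc i) \<otimes>\<^bsub>hecke n q\<^esub> (?z \<otimes>\<^bsub>hecke n q\<^esub> hecke_X n q (eps i)) \<otimes>\<^bsub>hecke n q\<^esub> hecke_T n q (Suc i)"
        using Suc.IH i hecke_X_step[OF i(1)] c
        by (simp add: ring_hom_mult[OF hom] hecke_g_properties(4)[OF n] del: atLeastAtMost_iff)
      also have "\<dots> = (?z \<otimes>\<^bsub>hecke n q\<^esub> hecke_T n q (Suc i)) \<otimes>\<^bsub>hecke n q\<^esub> hecke_X n q (eps i) \<otimes>\<^bsub>hecke n q\<^esub> hecke_T n q (Suc i)"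
        using c hecke_scalar_central[OF c(1), of "cis (2 * pi / real p)"] by (simp add: H.m_assoc[symmetric])
      also have "\<dots> = ?z \<otimes>\<^bsub>hecke n q\<^esub> hecke_X n q (eps (Suc i))"
        using c hecke_X_step[OF i(1)] by (simp add: H.m_assoc)
      finally show "hecke_g n q p (hecke_X n q (eps (Suc i))) = ?z \<otimes>\<^bsub>hecke n q\<^esub> hecke_X n q (eps (Suc i))" .
    qed
  qed
  then show ?thesis using i by simp
qed

section \<open>Modules with a finite basis\<close>

locale based_module = left_module R M
  for R :: "('a, 'm) ring_scheme" and M :: "('a, 'b, 'k) module_scheme" +
  fixes \<iota> :: "complex \<Rightarrow> 'a" and I :: "'i set" and v :: "'i \<Rightarrow> 'b"
  assumes scalar_closed [simp]: "\<iota> z \<in> carrier R"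
    and scalar_add: "\<iota> (a + b) = \<iota> a \<oplus>\<^bsub>R\<^esub> \<iota> b"
    and scalar_mult: "\<iota> (a * b) = \<iota> a \<otimes>\<^bsub>R\<^esub> \<iota> b"
    and scalar_one: "\<iota> 1 = \<one>\<^bsub>R\<^esub>"
    and scalar_central: "x \<in> carrier R \<Longrightarrow> \<iota> z \<otimes>\<^bsub>R\<^esub> x = x \<otimes>\<^bsub>R\<^esub> \<iota> z"
    and basis: "finite_basis \<iota> M I v"
begin

text \<open>Coefficients are total functions of which only the values on \<open>I\<close> count.
  This spares the extensional functions required by \<open>coords\<close>; equality of vectors
  becomes equality on \<open>I\<close>.\<close>

definition vec :: "('i \<Rightarrow> complex) \<Rightarrow> 'b" where
  "vec a = (\<Oplus>\<^bsub>M\<^esub>i\<in>I. \<iota> (a i) \<odot>\<^bsub>M\<^esub> v i)"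

lemma finite_I: "finite I" and v_closed: "i \<in> I \<Longrightarrow> v i \<in> carrier M"
  using basis by (auto simp: finite_basis_def)

lemma smult_zero_right: "x \<in> carrier R \<Longrightarrow> x \<odot>\<^bsub>M\<^esub> \<zero>\<^bsub>M\<^esub> = \<zero>\<^bsub>M\<^esub>"
  using smult_r_distr[of x "\<zero>\<^bsub>M\<^esub>" "\<zero>\<^bsub>M\<^esub>"] smult_closed[of x "\<zero>\<^bsub>M\<^esub>"]
  by (metis M.add.r_cancel_one' M.l_zero M.zero_closed)

lemma smult_zero_left: "m \<in> carrier M \<Longrightarrow> \<zero>\<^bsub>R\<^esub> \<odot>\<^bsub>M\<^esub> m = \<zero>\<^bsub>M\<^esub>"
  using smult_l_distr[of "\<zero>\<^bsub>R\<^esub>" "\<zero>\<^bsub>R\<^esub>" m] smult_closed[of "\<zero>\<^bsub>R\<^esub>" m]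
  by (metis M.add.r_cancel_one' R.l_zero R.zero_closed)

lemma scalar_zero: "\<iota> 0 = \<zero>\<^bsub>R\<^esub>"
  using scalar_add[of 0 0] by (metis R.add.r_cancel_one' add_0 scalar_closed)

lemma smult_finsum:
  assumes "x \<in> carrier R" "finite A" "f \<in> A \<rightarrow> carrier M"
  shows "x \<odot>\<^bsub>M\<^esub> (\<Oplus>\<^bsub>M\<^esub>i\<in>A. f i) = (\<Oplus>\<^bsub>M\<^esub>i\<in>A. x \<odot>\<^bsub>M\<^esub> f i)"
  using assms(2,3)
proof (induction A rule: finite_induct)
  case empty
  then show ?case by (simp add: smult_zero_right[OF assms(1)])
next
  case (insert i A)
  have "f \<in> A \<rightarrow> carrier M" "f i \<in> carrier M" using insert.prems by auto
  moreover have "(\<lambda>i. x \<odot>\<^bsub>M\<^esub> f i) \<in> A \<rightarrow> carrier M" "x \<odot>\<^bsub>M\<^esub> f i \<in> carrier M"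
    using insert.prems smult_closed[OF assms(1)] by auto
  ultimately show ?case
    using insert.hyps insert.IH by (simp add: M.finsum_insert smult_r_distr[OF assms(1)])
qed

lemma scalar_smult_closed [simp]: "m \<in> carrier M \<Longrightarrow> \<iota> z \<odot>\<^bsub>M\<^esub> m \<in> carrier M"
  by (simp add: smult_closed)

lemma vec_closed [simp]: "vec a \<in> carrier M"
  unfolding vec_def using v_closed by (intro M.finsum_closed) auto

lemma vec_cong: "(\<And>i. i \<in> I \<Longrightarrow> a i = b i) \<Longrightarrow> vec a = vec b"
  unfolding vec_def by (intro M.finsum_cong') (auto simp: v_closed)

lemma vec_add: "vec a \<oplus>\<^bsub>M\<^esub> vec b = vec (\<lambda>i. a i + b i)"
proof -
  have "vec (\<lambda>i. a i + b i) = (\<Oplus>\<^bsub>M\<^esub>i\<in>I. \<iota> (a i) \<odot>\<^bsub>M\<^esub> v i \<oplus>\<^bsub>M\<^esub> \<iota> (b i) \<odot>\<^bsub>M\<^esub> v i)"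
    unfolding vec_def by (intro M.finsum_cong') (auto simp: v_closed scalar_add smult_l_distr)
  also have "\<dots> = vec a \<oplus>\<^bsub>M\<^esub> vec b"
    unfolding vec_def by (intro M.finsum_addf) (auto simp: v_closed)
  finally show ?thesis by simp
qed

lemma scalar_smult_smult: "m \<in> carrier M \<Longrightarrow> \<iota> a \<odot>\<^bsub>M\<^esub> (\<iota> b \<odot>\<^bsub>M\<^esub> m) = \<iota> (a * b) \<odot>\<^bsub>M\<^esub> m"
  by (simp add: scalar_mult smult_assoc)

lemma vec_smult: "\<iota> z \<odot>\<^bsub>M\<^esub> vec a = vec (\<lambda>i. z * a i)"
proof -
  have "\<iota> z \<odot>\<^bsub>M\<^esub> vec a = (\<Oplus>\<^bsub>M\<^esub>i\<in>I. \<iota> z \<odot>\<^bsub>M\<^esub> (\<iota> (a i) \<odot>\<^bsub>M\<^esub> v i))"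
    unfolding vec_def by (rule smult_finsum) (auto simp: finite_I v_closed)
  also have "\<dots> = vec (\<lambda>i. z * a i)"
    unfolding vec_def by (intro M.finsum_cong') (auto simp: v_closed scalar_smult_smult)
  finally show ?thesis .
qed

lemma coords_vec: "coords \<iota> M I v (vec a) (restrict a I)"
proof -
  have "vec a = vec (restrict a I)" by (rule vec_cong) simp
  then show ?thesis by (simp add: coords_def vec_def)
qed

lemma vec_eq_iff: "vec a = vec b \<longleftrightarrow> (\<forall>i\<in>I. a i = b i)"
proof
  assume e: "vec a = vec b"
  have "\<exists>!c. coords \<iota> M I v (vec a) c" using basis by (simp add: finite_basis_def)
  then have "restrict a I = restrict b I" using coords_vec[of a] coords_vec[of b] e by auto
  then show "\<forall>i\<in>I. a i = b i" by (metis restrict_apply')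
qed (auto intro: vec_cong)

lemma vec_surj:
  assumes "m \<in> carrier M" obtains a where "m = vec a"
proof -
  have "\<exists>!c. coords \<iota> M I v m c" using basis assms by (simp add: finite_basis_def)
  then obtain c where "coords \<iota> M I v m c" by blast
  then show ?thesis using that[of c] by (simp add: coords_def vec_def)
qed

lemma vec_zero: "vec (\<lambda>i. 0) = \<zero>\<^bsub>M\<^esub>"
proof -
  have "vec (\<lambda>i. 0) = \<iota> 0 \<odot>\<^bsub>M\<^esub> vec (\<lambda>i. 0)" by (simp add: vec_smult)
  then show ?thesis by (simp add: scalar_zero smult_zero_left)
qed

lemma vec_single: "i \<in> I \<Longrightarrow> vec (\<lambda>k. if k = i then 1 else 0) = v i"
proof -
  assume i: "i \<in> I"
  have "vec (\<lambda>k. if k = i then 1 else 0) = (\<Oplus>\<^bsub>M\<^esub>k\<in>I. if i = k then v k else \<zero>\<^bsub>M\<^esub>)"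
    unfolding vec_def
    by (intro M.finsum_cong') (auto simp: v_closed scalar_zero scalar_one smult_zero_left smult_one)
  also have "\<dots> = v i" using i by (intro M.finsum_singleton) (auto simp: finite_I v_closed)
  finally show ?thesis .
qed

lemma vec_scaled_single: "i \<in> I \<Longrightarrow> \<iota> z \<odot>\<^bsub>M\<^esub> v i = vec (\<lambda>k. if k = i then z else 0)"
  unfolding vec_single[symmetric] vec_smult by (rule vec_cong) simp

lemma vec_finsum: "finite A \<Longrightarrow> (\<Oplus>\<^bsub>M\<^esub>j\<in>A. vec (F j)) = vec (\<lambda>k. \<Sum>j\<in>A. F j k)"
  by (induction A rule: finite_induct) (simp_all add: vec_zero M.finsum_insert vec_add)

lemma linear_combination_vec:
  assumes "\<And>i. i \<in> I \<Longrightarrow> w i = vec (W i)"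
  shows "(\<Oplus>\<^bsub>M\<^esub>i\<in>I. \<iota> (a i) \<odot>\<^bsub>M\<^esub> w i) = vec (\<lambda>k. \<Sum>i\<in>I. a i * W i k)"
proof -
  have "(\<Oplus>\<^bsub>M\<^esub>i\<in>I. \<iota> (a i) \<odot>\<^bsub>M\<^esub> w i) = (\<Oplus>\<^bsub>M\<^esub>i\<in>I. vec (\<lambda>k. a i * W i k))"
    by (intro M.finsum_cong') (auto simp: assms vec_smult)
  then show ?thesis by (simp add: vec_finsum finite_I)
qed

text \<open>\<open>W i\<close> is the column of the matrix of \<open>x\<close> at the basis vector
  \<open>v i\<close>; centrality of scalars makes the action of \<open>x\<close> linear.\<close>

lemma smult_vec:
  assumes x: "x \<in> carrier R" and W: "\<And>i. i \<in> I \<Longrightarrow> x \<odot>\<^bsub>M\<^esub> v i = vec (W i)"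
  shows "x \<odot>\<^bsub>M\<^esub> vec a = vec (\<lambda>k. \<Sum>i\<in>I. a i * W i k)"
proof -
  have "x \<odot>\<^bsub>M\<^esub> vec a = (\<Oplus>\<^bsub>M\<^esub>i\<in>I. x \<odot>\<^bsub>M\<^esub> (\<iota> (a i) \<odot>\<^bsub>M\<^esub> v i))"
    unfolding vec_def by (rule smult_finsum) (auto simp: finite_I v_closed x)
  also have "\<dots> = (\<Oplus>\<^bsub>M\<^esub>i\<in>I. \<iota> (a i) \<odot>\<^bsub>M\<^esub> (x \<odot>\<^bsub>M\<^esub> v i))"
  proof (intro M.finsum_cong')
    fix i assume "i \<in> I"
    then show "x \<odot>\<^bsub>M\<^esub> (\<iota> (a i) \<odot>\<^bsub>M\<^esub> v i) = \<iota> (a i) \<odot>\<^bsub>M\<^esub> (x \<odot>\<^bsub>M\<^esub> v i)"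
      using smult_assoc[of x "\<iota> (a i)" "v i"] smult_assoc[of "\<iota> (a i)" x "v i"] x
      by (simp add: v_closed scalar_central)
  qed (auto simp: v_closed smult_closed x)
  finally show ?thesis using linear_combination_vec[OF W] by simp
qed

lemma smult_vec_eigen:
  assumes x: "x \<in> carrier R" and "\<And>i. i \<in> I \<Longrightarrow> x \<odot>\<^bsub>M\<^esub> v i = \<iota> (e i) \<odot>\<^bsub>M\<^esub> v i"
  shows "x \<odot>\<^bsub>M\<^esub> vec a = vec (\<lambda>k. e k * a k)"
proof -
  have "x \<odot>\<^bsub>M\<^esub> vec a = vec (\<lambda>k. \<Sum>i\<in>I. a i * (if k = i then e i else 0))"
    by (rule smult_vec[OF x]) (simp add: assms(2) vec_scaled_single)
  also have "\<dots> = vec (\<lambda>k. e k * a k)"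
    by (rule vec_cong) (simp add: if_distrib sum.delta finite_I mult.commute cong: if_cong)
  finally show ?thesis .
qed

lemma linear_ext_vec:
  assumes "\<And>i. i \<in> I \<Longrightarrow> w i = vec (W i)"
  shows "linear_ext \<iota> M I v w (vec a) = vec (\<lambda>k. \<Sum>i\<in>I. a i * W i k)"
proof -
  have "\<exists>!c. coords \<iota> M I v (vec a) c" using basis by (simp add: finite_basis_def)
  then have "(THE c. coords \<iota> M I v (vec a) c) = restrict a I" using coords_vec[of a] the1_equality by metis
  then have "linear_ext \<iota> M I v w (vec a) = vec (\<lambda>k. \<Sum>i\<in>I. restrict a I i * W i k)"
    unfolding linear_ext_def by (simp only: linear_combination_vec[OF assms])
  also have "\<dots> = vec (\<lambda>k. \<Sum>i\<in>I. a i * W i k)" by simp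
  finally show ?thesis .
qed

lemma minus_smult:
  assumes "x \<in> carrier R" "m \<in> carrier M"
  shows "(\<ominus>\<^bsub>R\<^esub> x) \<odot>\<^bsub>M\<^esub> m = \<iota> (- 1) \<odot>\<^bsub>M\<^esub> (x \<odot>\<^bsub>M\<^esub> m)"
proof -
  have "\<iota> (- 1) \<otimes>\<^bsub>R\<^esub> x \<oplus>\<^bsub>R\<^esub> x = (\<iota> (- 1) \<oplus>\<^bsub>R\<^esub> \<iota> 1) \<otimes>\<^bsub>R\<^esub> x"
    using assms by (simp add: R.l_distr scalar_one)
  also have "\<dots> = \<zero>\<^bsub>R\<^esub>"
    using assms by (simp add: scalar_add[symmetric] scalar_zero)
  finally have "\<ominus>\<^bsub>R\<^esub> x = \<iota> (- 1) \<otimes>\<^bsub>R\<^esub> x"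
    using assms by (intro R.minus_equality) auto
  then show ?thesis using assms by (simp add: smult_assoc)
qed

lemma uminus_eq_smult: "m \<in> carrier M \<Longrightarrow> \<iota> (- 1) \<odot>\<^bsub>M\<^esub> m \<oplus>\<^bsub>M\<^esub> m = \<zero>\<^bsub>M\<^esub>"
  using smult_l_distr[of "\<iota> (- 1)" "\<iota> 1" m]
  by (simp add: scalar_add[symmetric] scalar_zero smult_zero_left) (simp add: scalar_one smult_one)

lemma linear_eq_on_basis:
  assumes f: "\<And>m. m \<in> carrier M \<Longrightarrow> f m \<in> carrier M"
      "\<And>m m'. m \<in> carrier M \<Longrightarrow> m' \<in> carrier M \<Longrightarrow> f (m \<oplus>\<^bsub>M\<^esub> m') = f m \<oplus>\<^bsub>M\<^esub> f m'"
      "\<And>z m. m \<in> carrier M \<Longrightarrow> f (\<iota> z \<odot>\<^bsub>M\<^esub> m) = \<iota> z \<odot>\<^bsub>M\<^esub> f m"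
    and h: "\<And>m. m \<in> carrier M \<Longrightarrow> h m \<in> carrier M"
      "\<And>m m'. m \<in> carrier M \<Longrightarrow> m' \<in> carrier M \<Longrightarrow> h (m \<oplus>\<^bsub>M\<^esub> m') = h m \<oplus>\<^bsub>M\<^esub> h m'"
      "\<And>z m. m \<in> carrier M \<Longrightarrow> h (\<iota> z \<odot>\<^bsub>M\<^esub> m) = \<iota> z \<odot>\<^bsub>M\<^esub> h m"
    and eq: "\<And>i. i \<in> I \<Longrightarrow> f (v i) = h (v i)" and m: "m \<in> carrier M"
  shows "f m = h m"
proof -
  have zero: "f \<zero>\<^bsub>M\<^esub> = \<zero>\<^bsub>M\<^esub>" "h \<zero>\<^bsub>M\<^esub> = \<zero>\<^bsub>M\<^esub>"
    using f(3)[of "\<zero>\<^bsub>M\<^esub>" 0] h(3)[of "\<zero>\<^bsub>M\<^esub>" 0] f(1)[of "\<zero>\<^bsub>M\<^esub>"] h(1)[of "\<zero>\<^bsub>M\<^esub>"]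
    by (simp_all add: scalar_zero smult_zero_left)
  obtain a where a: "m = vec a" using vec_surj[OF m] .
  have "f (\<Oplus>\<^bsub>M\<^esub>i\<in>A. \<iota> (a i) \<odot>\<^bsub>M\<^esub> v i) = h (\<Oplus>\<^bsub>M\<^esub>i\<in>A. \<iota> (a i) \<odot>\<^bsub>M\<^esub> v i)"
    if "finite A" "A \<subseteq> I" for A
    using that
  proof (induction A rule: finite_induct)
    case empty then show ?case by (simp add: zero)
  next
    case (insert i A)
    have "(\<lambda>i. \<iota> (a i) \<odot>\<^bsub>M\<^esub> v i) \<in> A \<rightarrow> carrier M" "v i \<in> carrier M"
      using insert.prems v_closed by auto
    then show ?case
      using insert by (simp add: M.finsum_insert f h M.finsum_closed eq)
  qed
  from this[OF finite_I order_refl] show ?thesis by (simp add: a vec_def)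
qed

end

section \<open>Isotypic parts under a cyclic permutation of the basis\<close>

text \<open>In the application \<open>\<gamma>\<close> is \<open>g\<^sup>\<kappa>\<close> acting on tableaux, \<open>Xs\<close> consists of the \<open>X\<^sup>\<lambda>\<close> with
  \<open>\<lambda> \<in> L\<^sub>p\<close>, the \<open>T j\<close> are the \<open>T\<^sub>i\<close>, and \<open>s\<close> swaps two entries, with \<open>u = 0\<close> if the
  result is not standard.\<close>

locale cyclic_module = based_module R M \<iota> I v
  for R :: "('a, 'm) ring_scheme" and M :: "('a, 'b, 'k) module_scheme"
    and \<iota> :: "complex \<Rightarrow> 'a" and I :: "'i set" and v :: "'i \<Rightarrow> 'b" +
  fixes \<gamma> :: "'i \<Rightarrow> 'i" and c :: nat and \<chi> :: complex
    and Xs :: "'a set" and e :: "'a \<Rightarrow> 'i \<Rightarrow> complex"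
    and J :: "'j set" and T :: "'j \<Rightarrow> 'a" and t u :: "'j \<Rightarrow> 'i \<Rightarrow> complex" and s :: "'j \<Rightarrow> 'i \<Rightarrow> 'i"
  assumes nonempty: "I \<noteq> {}"
    and \<gamma>_bij: "bij_betw \<gamma> I I" and c_pos: "0 < c"
    and \<gamma>_period: "i \<in> I \<Longrightarrow> (\<gamma> ^^ c) i = i"
    and \<gamma>_free: "i \<in> I \<Longrightarrow> 0 < l \<Longrightarrow> l < c \<Longrightarrow> (\<gamma> ^^ l) i \<noteq> i"
    and \<chi>_period: "\<chi> ^ c = 1"
    and X_closed: "x \<in> Xs \<Longrightarrow> x \<in> carrier R"
    and X_eigen: "x \<in> Xs \<Longrightarrow> i \<in> I \<Longrightarrow> x \<odot>\<^bsub>M\<^esub> v i = \<iota> (e x i) \<odot>\<^bsub>M\<^esub> v i"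
    and X_invariant: "x \<in> Xs \<Longrightarrow> i \<in> I \<Longrightarrow> e x (\<gamma> i) = e x i"
    and X_separates: "i \<in> I \<Longrightarrow> k \<in> I \<Longrightarrow> (\<And>x. x \<in> Xs \<Longrightarrow> e x i = e x k) \<Longrightarrow> \<exists>l. k = (\<gamma> ^^ l) i"
    and T_closed: "j \<in> J \<Longrightarrow> T j \<in> carrier R"
    and s_closed: "j \<in> J \<Longrightarrow> i \<in> I \<Longrightarrow> s j i \<in> I"
    and T_basis: "j \<in> J \<Longrightarrow> i \<in> I \<Longrightarrow>
      T j \<odot>\<^bsub>M\<^esub> v i = \<iota> (t j i) \<odot>\<^bsub>M\<^esub> v i \<oplus>\<^bsub>M\<^esub> \<iota> (u j i) \<odot>\<^bsub>M\<^esub> v (s j i)"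
    and t_invariant: "j \<in> J \<Longrightarrow> i \<in> I \<Longrightarrow> t j (\<gamma> i) = t j i"
    and u_invariant: "j \<in> J \<Longrightarrow> i \<in> I \<Longrightarrow> u j (\<gamma> i) = u j i"
    and s_equivariant: "j \<in> J \<Longrightarrow> i \<in> I \<Longrightarrow> u j i \<noteq> 0 \<Longrightarrow> s j (\<gamma> i) = \<gamma> (s j i)"
    and connected: "i \<in> I \<Longrightarrow> k \<in> I \<Longrightarrow> Q i \<Longrightarrow>
      (\<And>i j. i \<in> I \<Longrightarrow> j \<in> J \<Longrightarrow> Q i \<Longrightarrow> u j i \<noteq> 0 \<Longrightarrow> Q (s j i)) \<Longrightarrow> Q k"
begin

section \<open>Orbits and covariant coordinates\<close>

lemma iterate_closed: "i \<in> I \<Longrightarrow> (\<gamma> ^^ l) i \<in> I"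
  by (induction l) (use \<gamma>_bij in \<open>auto simp: bij_betw_def\<close>)

lemma iterate_multiple: "i \<in> I \<Longrightarrow> (\<gamma> ^^ (l * c)) i = i"
  by (induction l) (simp_all add: funpow_add \<gamma>_period)

lemma iterate_mod: "i \<in> I \<Longrightarrow> (\<gamma> ^^ (l mod c)) i = (\<gamma> ^^ l) i"
proof -
  assume i: "i \<in> I"
  have "(\<gamma> ^^ (l mod c + l div c * c)) i = (\<gamma> ^^ (l mod c)) i"
    unfolding funpow_add o_apply iterate_multiple[OF i] ..
  then show ?thesis by simp
qed

lemma chi_mod: "\<chi> ^ (l mod c) = \<chi> ^ l"
proof -
  have "\<chi> ^ (l mod c + l div c * c) = \<chi> ^ (l mod c)"
    unfolding power_add mult.commute[of _ c] power_mult \<chi>_period by simp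
  then show ?thesis by (simp only: mod_div_mult_eq)
qed

lemma iterate_inj:
  assumes i: "i \<in> I" and eq: "(\<gamma> ^^ l) i = (\<gamma> ^^ m) i" and "l < c" "m < c"
  shows "l = m"
proof -
  have "\<not> l < m" if "(\<gamma> ^^ l) i = (\<gamma> ^^ m) i" "m < c" for l m
  proof
    assume lm: "l < m"
    \<comment> \<open>Both sides are to be moved by the inverse of \<gamma>^l, which is available as
      \<gamma>^(c-l); this reduces equality of iterates to a return to \<open>i\<close>.\<close>
    have "(\<gamma> ^^ (m - l)) i = (\<gamma> ^^ (m - l + c)) i" by (simp add: funpow_add \<gamma>_period i)
    also have "m - l + c = (c - l) + m" using lm that by simp
    also have "(\<gamma> ^^ ((c - l) + m)) i = (\<gamma> ^^ ((c - l) + l)) i" unfolding funpow_add using that by simp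
    also have "\<dots> = i" using lm that \<gamma>_period[OF i] by simp
    finally show False using \<gamma>_free[OF i, of "m - l"] lm that by auto
  qed
  from this[OF eq] this[OF eq[symmetric]] assms show ?thesis by auto
qed

lemma \<gamma>_inj: "i \<in> I \<Longrightarrow> k \<in> I \<Longrightarrow> \<gamma> i = \<gamma> k \<longleftrightarrow> i = k"
  using \<gamma>_bij by (auto simp: bij_betw_def dest: inj_onD)

text \<open>These are the coordinates of \<open>p\<^sub>j v i\<close>.\<close>

definition symm :: "'i \<Rightarrow> 'i \<Rightarrow> complex" where
  "symm i k = (\<Sum>l<c. if k = (\<gamma> ^^ l) i then \<chi> ^ l else 0)"

text \<open>By freeness exactly one of the exponents below \<open>c\<close> reaches a given point of
  the orbit, and \<chi>^c = 1 makes the value independent of \<open>m\<close> modulo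
  \<open>c\<close>.\<close>

lemma symm_orbit: "i \<in> I \<Longrightarrow> symm i ((\<gamma> ^^ m) i) = \<chi> ^ m"
proof -
  assume i: "i \<in> I"
  have "symm i ((\<gamma> ^^ (m mod c)) i) = (\<Sum>l<c. if l = m mod c then \<chi> ^ l else 0)"
    unfolding symm_def using c_pos iterate_inj[OF i, of _ "m mod c"] by (intro sum.cong) auto
  also have "\<dots> = \<chi> ^ (m mod c)" using c_pos by simp
  finally show ?thesis by (simp add: iterate_mod[OF i] chi_mod)
qed

lemma symm_self: "i \<in> I \<Longrightarrow> symm i i = 1"
  using symm_orbit[of i 0] by simp

lemma symm_outside: "(\<And>l. k \<noteq> (\<gamma> ^^ l) i) \<Longrightarrow> symm i k = 0"
  by (simp add: symm_def)

text \<open>These are the coordinates of the eigenvectors, with eigenvalue \<chi>^-1, of the linear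
  map sending \<open>v i\<close> to \<open>v (\<gamma> i)\<close>, because that map composes
  coordinates with the inverse of \<gamma>.\<close>

definition covariant :: "('i \<Rightarrow> complex) \<Rightarrow> bool" where
  "covariant a \<longleftrightarrow> (\<forall>i\<in>I. a (\<gamma> i) = \<chi> * a i)"

lemma orbit_shift: "i \<in> I \<Longrightarrow> k \<in> I \<Longrightarrow> \<gamma> k = (\<gamma> ^^ m) i \<Longrightarrow> \<exists>l. k = (\<gamma> ^^ l) i"
proof -
  assume i: "i \<in> I" and k: "k \<in> I" and "\<gamma> k = (\<gamma> ^^ m) i"
  then have "\<gamma> k = (\<gamma> ^^ (m + c)) i" by (simp add: funpow_add \<gamma>_period)
  also have "m + c = Suc (m + c - 1)" using c_pos by simp
  finally have "\<gamma> k = \<gamma> ((\<gamma> ^^ (m + c - 1)) i)" by simp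
  then show ?thesis using \<gamma>_inj[OF k iterate_closed[OF i]] by blast
qed

lemma covariant_symm: "i \<in> I \<Longrightarrow> covariant (symm i)"
  unfolding covariant_def
proof
  fix k assume i: "i \<in> I" and k: "k \<in> I"
  show "symm i (\<gamma> k) = \<chi> * symm i k"
  proof (cases "\<exists>l. k = (\<gamma> ^^ l) i")
    case True
    then obtain l where l: "k = (\<gamma> ^^ l) i" by blast
    then show ?thesis using symm_orbit[OF i, of l] symm_orbit[OF i, of "Suc l"] by simp
  next
    case False
    then have "\<And>l. \<gamma> k \<noteq> (\<gamma> ^^ l) i" using orbit_shift[OF i k] by blast
    then show ?thesis using symm_outside[of k i] symm_outside[of "\<gamma> k" i] False by simp
  qed
qed

lemma covariant_orbit: "covariant a \<Longrightarrow> i \<in> I \<Longrightarrow> a ((\<gamma> ^^ l) i) = \<chi> ^ l * a i"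
  by (induction l) (simp_all add: covariant_def iterate_closed)

lemma covariant_one_orbit:
  assumes "covariant a" "i \<in> I" "k \<in> I" "(\<And>l. k \<noteq> (\<gamma> ^^ l) i) \<Longrightarrow> a k = 0"
  shows "a k = a i * symm i k"
proof (cases "\<exists>l. k = (\<gamma> ^^ l) i")
  case True
  then show ?thesis using covariant_orbit[OF assms(1,2)] symm_orbit[OF assms(2)] by auto
next
  case False
  then show ?thesis using assms(4) symm_outside[of k i] by auto
qed

section \<open>Representatives of the orbits\<close>

definition orbit :: "'i \<Rightarrow> 'i set" where
  "orbit i = range (\<lambda>l. (\<gamma> ^^ l) i)"

lemma self_in_orbit: "i \<in> orbit i"
  unfolding orbit_def by (rule range_eqI[of _ _ 0]) simp

lemma orbit_eq:
  assumes "i \<in> I" "k \<in> orbit i" shows "orbit k = orbit i"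
proof -
  obtain l where l: "k = (\<gamma> ^^ l) i" using assms(2) by (auto simp: orbit_def)
  have "(\<gamma> ^^ m) k = (\<gamma> ^^ (m + l)) i" for m by (simp add: l funpow_add)
  then have 1: "orbit k \<subseteq> orbit i" by (auto simp: orbit_def)
  have "(\<gamma> ^^ m) i = (\<gamma> ^^ (m + (l * c - l))) k" for m
  proof -
    have "(\<gamma> ^^ (m + (l * c - l))) k = (\<gamma> ^^ (m + (l * c - l) + l)) i" by (simp add: l funpow_add)
    also have "m + (l * c - l) + l = m + l * c" using c_pos by (cases c) auto
    finally show ?thesis by (simp add: funpow_add iterate_multiple assms(1))
  qed
  then have "orbit i \<subseteq> orbit k" unfolding orbit_def by (metis image_subsetI rangeI)
  with 1 show ?thesis by blast
qed

text \<open>The choice depends only on the orbit as a set, so all points of one orbit yield the same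
  representative.\<close>

definition transversal :: "'i set" where
  "transversal = (\<lambda>i. SOME k. k \<in> orbit i) ` I"

lemma rep_in_orbit: "(SOME k. k \<in> orbit i) \<in> orbit i"
  by (rule someI[of _ i]) (rule self_in_orbit)

lemma orbit_subset: "i \<in> I \<Longrightarrow> orbit i \<subseteq> I"
  by (auto simp: orbit_def iterate_closed)

lemma transversal_subset: "transversal \<subseteq> I"
  using rep_in_orbit orbit_subset by (auto simp: transversal_def)

lemma transversal_finite: "finite transversal"
  using finite_I by (simp add: transversal_def)

lemma transversal_covers: "k \<in> I \<Longrightarrow> \<exists>r\<in>transversal. k \<in> orbit r"
proof
  assume k: "k \<in> I"
  show "(SOME i. i \<in> orbit k) \<in> transversal" using k by (simp add: transversal_def)
  show "k \<in> orbit (SOME i. i \<in> orbit k)"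
    using orbit_eq[OF k rep_in_orbit] self_in_orbit by blast
qed

lemma transversal_unique:
  assumes "r \<in> transversal" "r' \<in> transversal" "r' \<in> orbit r"
  shows "r' = r"
proof -
  obtain i i' where i: "i \<in> I" "r = (SOME k. k \<in> orbit i)" and i': "i' \<in> I" "r' = (SOME k. k \<in> orbit i')"
    using assms by (auto simp: transversal_def)
  have "orbit r = orbit i" "orbit r' = orbit i'"
    using orbit_eq[OF i(1) rep_in_orbit] orbit_eq[OF i'(1) rep_in_orbit] i i' by auto
  moreover have "orbit r' = orbit r" using orbit_eq assms transversal_subset by blast
  ultimately show ?thesis using i i' by simp
qed

lemma symm_transversal:
  assumes "r \<in> transversal" "r' \<in> transversal"
  shows "symm r r' = (if r' = r then 1 else 0)"
proof (cases "r' = r")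
  case False
  then have "r' \<notin> orbit r" using transversal_unique assms by blast
  then show ?thesis using False symm_outside[of r' r] by (auto simp: orbit_def)
qed (use symm_self assms transversal_subset in auto)

text \<open>\<open>symm r\<close> vanishes off the orbit of \<open>r\<close>, so at \<open>k\<close>
  only the representative of the orbit of \<open>k\<close> contributes, and covariance fixes the
  value along this orbit.\<close>

lemma covariant_decomposition:
  assumes a: "covariant a" and k: "k \<in> I"
  shows "a k = (\<Sum>r\<in>transversal. a r * symm r k)"
proof -
  obtain r where r: "r \<in> transversal" "k \<in> orbit r" using transversal_covers[OF k] by blast
  then obtain l where l: "k = (\<gamma> ^^ l) r" by (auto simp: orbit_def)
  have rI: "r \<in> I" using r transversal_subset by blast
  have "symm r' k = 0" if "r' \<in> transversal" "r' \<noteq> r" for r'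
  proof (rule symm_outside)
    fix m show "k \<noteq> (\<gamma> ^^ m) r'"
    proof
      assume "k = (\<gamma> ^^ m) r'"
      then have "k \<in> orbit r'" by (auto simp: orbit_def)
      then have "orbit r' = orbit r" using orbit_eq r that transversal_subset by blast
      then have "r' \<in> orbit r" using self_in_orbit by blast
      then show False using transversal_unique r that by blast
    qed
  qed
  then have "(\<Sum>r'\<in>transversal. a r' * symm r' k) = (\<Sum>r'\<in>transversal. if r' = r then a r * symm r k else 0)"
    by (intro sum.cong) auto
  also have "\<dots> = a r * symm r k" using r transversal_finite by simp
  finally show ?thesis using covariant_orbit[OF a rI, of l] symm_orbit[OF rI, of l] l by simp
qed

section \<open>The submodule of covariant vectors\<close>

definition sub :: "'b set" where
  "sub = vec ` Collect covariant"

lemma vec_in_sub: "vec a \<in> sub \<longleftrightarrow> covariant a"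
proof
  assume "vec a \<in> sub"
  then obtain b where b: "covariant b" "vec a = vec b" by (auto simp: sub_def)
  then have "\<forall>i\<in>I. a i = b i" by (simp add: vec_eq_iff)
  then show "covariant a" using b \<gamma>_bij unfolding covariant_def by (metis bij_betwE)
qed (simp add: sub_def)

lemma sub_subset: "sub \<subseteq> carrier M"
  by (auto simp: sub_def)

lemma sub_zero: "\<zero>\<^bsub>M\<^esub> \<in> sub"
  unfolding vec_zero[symmetric] vec_in_sub by (simp add: covariant_def)

lemma sub_add: "m \<in> sub \<Longrightarrow> m' \<in> sub \<Longrightarrow> m \<oplus>\<^bsub>M\<^esub> m' \<in> sub"
  by (auto simp: sub_def vec_add) (auto simp: covariant_def algebra_simps)

lemma sub_scalar: "m \<in> sub \<Longrightarrow> \<iota> z \<odot>\<^bsub>M\<^esub> m \<in> sub"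
  by (auto simp: sub_def vec_smult) (auto simp: covariant_def algebra_simps)

lemma X_vec: "x \<in> Xs \<Longrightarrow> x \<odot>\<^bsub>M\<^esub> vec a = vec (\<lambda>k. e x k * a k)"
  by (rule smult_vec_eigen[OF X_closed X_eigen])

lemma sub_X: "x \<in> Xs \<Longrightarrow> m \<in> sub \<Longrightarrow> x \<odot>\<^bsub>M\<^esub> m \<in> sub"
proof -
  assume x: "x \<in> Xs" and "m \<in> sub"
  then obtain a where a: "m = vec a" "covariant a" by (auto simp: sub_def)
  then show ?thesis using x by (simp add: X_vec vec_in_sub) (simp add: covariant_def X_invariant)
qed

text \<open>The two contributions are added because \<open>s j i\<close> may equal \<open>i\<close>;
  in the application this is the dummy value when the swap is not standard, with
  \<open>u j i = 0\<close>.\<close>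

definition T_matrix :: "'j \<Rightarrow> 'i \<Rightarrow> 'i \<Rightarrow> complex" where
  "T_matrix j i k = (if k = i then t j i else 0) + (if k = s j i then u j i else 0)"

lemma T_vec: "j \<in> J \<Longrightarrow> T j \<odot>\<^bsub>M\<^esub> vec a = vec (\<lambda>k. \<Sum>i\<in>I. a i * T_matrix j i k)"
  by (rule smult_vec[OF T_closed]) (auto simp: T_basis vec_scaled_single s_closed vec_add T_matrix_def intro!: vec_cong)

lemma T_matrix_equivariant:
  "j \<in> J \<Longrightarrow> i \<in> I \<Longrightarrow> k \<in> I \<Longrightarrow> T_matrix j (\<gamma> i) (\<gamma> k) = T_matrix j i k"
  unfolding T_matrix_def
  by (cases "u j i = 0") (simp_all add: t_invariant u_invariant s_equivariant \<gamma>_inj s_closed)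

lemma sub_T: "j \<in> J \<Longrightarrow> m \<in> sub \<Longrightarrow> T j \<odot>\<^bsub>M\<^esub> m \<in> sub"
proof -
  assume j: "j \<in> J" and "m \<in> sub"
  then obtain a where a: "m = vec a" "covariant a" by (auto simp: sub_def)
  have "(\<Sum>i\<in>I. a i * T_matrix j i (\<gamma> k)) = \<chi> * (\<Sum>i\<in>I. a i * T_matrix j i k)" if k: "k \<in> I" for k
  proof -
    \<comment> \<open>The matrix is unchanged when row and column are both moved by \<gamma>, so
      reindexing the sum by \<gamma> brings the factor \<chi> out of \<open>a\<close>.\<close>
    have "(\<Sum>i\<in>I. a i * T_matrix j i (\<gamma> k)) = (\<Sum>i\<in>I. a (\<gamma> i) * T_matrix j (\<gamma> i) (\<gamma> k))"
      by (rule sum.reindex_bij_betw[OF \<gamma>_bij, symmetric])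
    also have "\<dots> = (\<Sum>i\<in>I. \<chi> * (a i * T_matrix j i k))"
      using a(2) by (intro sum.cong) (auto simp: covariant_def T_matrix_equivariant j k)
    finally show ?thesis by (simp add: sum_distrib_left)
  qed
  then show ?thesis using j by (simp add: a(1) T_vec vec_in_sub) (simp add: covariant_def)
qed

definition gens :: "'a set" where
  "gens = range \<iota> \<union> T ` J \<union> Xs"

abbreviation subalgebra :: "('a, 'm) ring_scheme" where
  "subalgebra \<equiv> R\<lparr>carrier := generate_ring R gens\<rparr>"

abbreviation submod :: "('a, 'b, 'k) module_scheme" where
  "submod \<equiv> M\<lparr>carrier := sub\<rparr>"

lemma gens_closed: "gens \<subseteq> carrier R"
  using T_closed X_closed by (auto simp: gens_def)

lemma generated_closed: "x \<in> generate_ring R gens \<Longrightarrow> x \<in> carrier R"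
  using R.generate_ring_in_carrier[OF gens_closed] .

lemma sub_generated: "x \<in> generate_ring R gens \<Longrightarrow> m \<in> sub \<Longrightarrow> x \<odot>\<^bsub>M\<^esub> m \<in> sub"
proof (induction arbitrary: m rule: generate_ring.induct)
  case one
  then show ?case using smult_one sub_subset by auto
next
  case (incl h)
  then show ?case using sub_scalar sub_T sub_X by (auto simp: gens_def)
next
  case (a_inv h)
  then show ?case using minus_smult[of h m] generated_closed sub_subset sub_scalar by auto
next
  case (eng_add h k)
  then show ?case using smult_l_distr[of h k m] generated_closed sub_subset sub_add by auto
next
  case (eng_mult h k)
  then show ?case using smult_assoc[of h k m] generated_closed sub_subset by auto
qed

lemma abelian_group_submod: "abelian_group submod"
proof (rule abelian_groupI; (simp add: sub_zero)?)
  show "x \<oplus>\<^bsub>M\<^esub> y \<in> sub" if "x \<in> sub" "y \<in> sub" for x y using that by (rule sub_add)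
  show "x \<oplus>\<^bsub>M\<^esub> y \<oplus>\<^bsub>M\<^esub> z = x \<oplus>\<^bsub>M\<^esub> (y \<oplus>\<^bsub>M\<^esub> z)" if "x \<in> sub" "y \<in> sub" "z \<in> sub" for x y z
    using that sub_subset by (intro M.a_assoc) auto
  show "x \<oplus>\<^bsub>M\<^esub> y = y \<oplus>\<^bsub>M\<^esub> x" if "x \<in> sub" "y \<in> sub" for x y
    using that sub_subset by (intro M.a_comm) auto
  show "\<zero>\<^bsub>M\<^esub> \<oplus>\<^bsub>M\<^esub> x = x" if "x \<in> sub" for x using that sub_subset by (intro M.l_zero) auto
  show "\<exists>y\<in>sub. y \<oplus>\<^bsub>M\<^esub> x = \<zero>\<^bsub>M\<^esub>" if "x \<in> sub" for x
    using that sub_subset uminus_eq_smult[of x] sub_scalar by (intro bexI[of _ "\<iota> (- 1) \<odot>\<^bsub>M\<^esub> x"]) auto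
qed

lemma left_module_submod: "left_module subalgebra submod"
proof (intro left_module.intro left_module_axioms.intro abelian_group_submod)
  show "ring subalgebra" by (rule R.generate_ring_is_ring[OF gens_closed])
qed (use sub_subset generated_closed in \<open>auto simp: sub_generated smult_one intro!: smult_l_distr smult_r_distr smult_assoc\<close>)

lemma finsum_submod:
  assumes "finite A" "f \<in> A \<rightarrow> sub"
  shows "(\<Oplus>\<^bsub>submod\<^esub>i\<in>A. f i) = (\<Oplus>\<^bsub>M\<^esub>i\<in>A. f i)"
proof -
  interpret N: abelian_group submod by (rule abelian_group_submod)
  show ?thesis using assms
  proof (induction A rule: finite_induct)
    case empty then show ?case using N.finsum_empty M.finsum_empty by simp
  next
    case (insert i A)
    have f: "f \<in> A \<rightarrow> sub" "f i \<in> sub" using insert.prems by auto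
    then have "f \<in> A \<rightarrow> carrier M" "f i \<in> carrier M" using sub_subset by auto
    moreover have "(\<Oplus>\<^bsub>submod\<^esub>i\<in>insert i A. f i) = f i \<oplus>\<^bsub>submod\<^esub> (\<Oplus>\<^bsub>submod\<^esub>i\<in>A. f i)"
      using insert.hyps f by (intro N.finsum_insert) auto
    ultimately show ?case using insert.IH[OF f(1)] insert.hyps by (simp add: M.finsum_insert)
  qed
qed

section \<open>The eigenbasis and simplicity\<close>

lemma symm_combination:
  assumes "r \<in> transversal"
  shows "vec (\<lambda>k. \<Sum>r\<in>transversal. a r * symm r k) = vec b \<Longrightarrow> a r = b r"
proof -
  assume "vec (\<lambda>k. \<Sum>r\<in>transversal. a r * symm r k) = vec b"
  moreover have rI: "r \<in> I" using assms transversal_subset by blast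
  ultimately have "b r = (\<Sum>r'\<in>transversal. a r' * symm r' r)" by (simp add: vec_eq_iff)
  also have "\<dots> = (\<Sum>r'\<in>transversal. if r' = r then a r else 0)"
    using assms by (intro sum.cong) (auto simp: symm_transversal)
  finally show "a r = b r" using assms transversal_finite by simp
qed

lemma vec_symm_inj: "inj_on (\<lambda>r. vec (symm r)) transversal"
proof (rule inj_onI)
  fix r r' assume r: "r \<in> transversal" "r' \<in> transversal" and eq: "vec (symm r) = vec (symm r')"
  have "symm r r = symm r' r" using eq r transversal_subset by (auto simp: vec_eq_iff)
  then show "r = r'" using r by (auto simp: symm_transversal split: if_splits)
qed

text \<open>The notion of a calibrated module asks for a basis that is a set indexed by itself, so
  the coefficients have to be transported along the injection of the representatives into the
  module.\<close>

lemma sub_basis: "finite_basis \<iota> submod ((\<lambda>r. vec (symm r)) ` transversal) (\<lambda>b. b)"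
  unfolding finite_basis_def
proof (intro conjI ballI)
  let ?B = "(\<lambda>r. vec (symm r)) ` transversal"
  show "finite ?B" using transversal_finite by simp
  have B: "?B \<subseteq> sub" using transversal_subset by (auto simp: vec_in_sub covariant_symm)
  then show "(\<lambda>b. b) \<in> ?B \<rightarrow> carrier submod" by auto
  have comb: "(\<Oplus>\<^bsub>submod\<^esub>b\<in>?B. \<iota> (\<alpha> b) \<odot>\<^bsub>submod\<^esub> b)
      = vec (\<lambda>k. \<Sum>r\<in>transversal. \<alpha> (vec (symm r)) * symm r k)" for \<alpha>
  proof -
    have "(\<Oplus>\<^bsub>submod\<^esub>b\<in>?B. \<iota> (\<alpha> b) \<odot>\<^bsub>submod\<^esub> b) = (\<Oplus>\<^bsub>M\<^esub>b\<in>?B. \<iota> (\<alpha> b) \<odot>\<^bsub>M\<^esub> b)"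
      using B transversal_finite by (subst finsum_submod) (auto intro: sub_scalar)
    also have "\<dots> = (\<Oplus>\<^bsub>M\<^esub>r\<in>transversal. \<iota> (\<alpha> (vec (symm r))) \<odot>\<^bsub>M\<^esub> vec (symm r))"
      by (rule M.finsum_reindex[OF _ vec_symm_inj]) auto
    also have "\<dots> = vec (\<lambda>k. \<Sum>r\<in>transversal. \<alpha> (vec (symm r)) * symm r k)"
      unfolding vec_smult by (rule vec_finsum[OF transversal_finite])
    finally show ?thesis .
  qed
  fix m assume "m \<in> carrier submod"
  then obtain a where a: "m = vec a" "covariant a" by (auto simp: sub_def)
  define \<alpha> where "\<alpha> = restrict (\<lambda>b. a (inv_into transversal (\<lambda>r. vec (symm r)) b)) ?B"
  have \<alpha>: "\<alpha> (vec (symm r)) = a r" if "r \<in> transversal" for r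
    using that by (simp add: \<alpha>_def inv_into_f_f[OF vec_symm_inj])
  show "\<exists>!\<alpha>. coords \<iota> submod ?B (\<lambda>b. b) m \<alpha>"
  proof (rule ex1I[of _ \<alpha>])
    have "m = vec (\<lambda>k. \<Sum>r\<in>transversal. \<alpha> (vec (symm r)) * symm r k)"
      unfolding a(1) by (rule vec_cong) (simp add: \<alpha> covariant_decomposition[OF a(2), symmetric])
    then show "coords \<iota> submod ?B (\<lambda>b. b) m \<alpha>" unfolding coords_def comb by (simp add: \<alpha>_def)
    fix \<beta> assume "coords \<iota> submod ?B (\<lambda>b. b) m \<beta>"
    then have \<beta>: "\<beta> \<in> extensional ?B" and eq: "vec (\<lambda>k. \<Sum>r\<in>transversal. \<beta> (vec (symm r)) * symm r k) = vec a"
      unfolding coords_def comb by (simp_all add: a(1))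
    show "\<beta> = \<alpha>"
    proof (rule extensionalityI[OF \<beta>])
      show "\<alpha> \<in> extensional ?B" by (simp add: \<alpha>_def)
      fix b assume "b \<in> ?B"
      then obtain r where r: "r \<in> transversal" "b = vec (symm r)" by blast
      then show "\<beta> b = \<alpha> b" using symm_combination[OF r(1) eq] \<alpha> by simp
    qed
  qed
qed

theorem calibrated_submod: "calibrated \<iota> Xs submod"
  unfolding calibrated_def
proof (intro exI[of _ "(\<lambda>r. vec (symm r)) ` transversal"] conjI ballI sub_basis)
  fix b x assume "b \<in> (\<lambda>r. vec (symm r)) ` transversal" and x: "x \<in> Xs"
  then obtain r where r: "r \<in> I" "b = vec (symm r)" using transversal_subset by auto
  have inv: "e x ((\<gamma> ^^ l) r) = e x r" for l
    by (induction l) (simp_all add: X_invariant x iterate_closed r)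
  have "x \<odot>\<^bsub>M\<^esub> b = \<iota> (e x r) \<odot>\<^bsub>M\<^esub> b"
    unfolding r X_vec[OF x] vec_smult
  proof (rule vec_cong)
    fix k
    show "e x k * symm r k = e x r * symm r k"
    proof (cases "\<exists>l. k = (\<gamma> ^^ l) r")
      case True then show ?thesis using inv by auto
    next
      case False then show ?thesis using symm_outside[of k r] by auto
    qed
  qed
  then show "\<exists>z. x \<odot>\<^bsub>submod\<^esub> b = \<iota> z \<odot>\<^bsub>submod\<^esub> b" by auto
qed

text \<open>Symmetrization commutes with \<open>T j\<close>: along the orbit of \<open>i\<close> the
  coefficients are constant, and \<open>s j\<close> follows \<gamma> whenever the off-diagonal
  coefficient is nonzero. So \<open>T j\<close> acts on symmetrized vectors by the formula for basis
  vectors.\<close>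

lemma T_symm:
  assumes j: "j \<in> J" and i: "i \<in> I"
  shows "T j \<odot>\<^bsub>M\<^esub> vec (symm i) = vec (\<lambda>k. t j i * symm i k + u j i * symm (s j i) k)"
  unfolding T_vec[OF j]
proof (rule vec_cong)
  fix k assume k: "k \<in> I"
  have orb: "t j ((\<gamma> ^^ l) i) = t j i \<and> u j ((\<gamma> ^^ l) i) = u j i
      \<and> (u j i \<noteq> 0 \<longrightarrow> s j ((\<gamma> ^^ l) i) = (\<gamma> ^^ l) (s j i))" for l
    by (induction l) (auto simp: t_invariant u_invariant s_equivariant j iterate_closed i)
  have "(\<Sum>k'\<in>I. symm i k' * T_matrix j k' k)
      = (\<Sum>k'\<in>I. \<Sum>l<c. if k' = (\<gamma> ^^ l) i then \<chi> ^ l * T_matrix j k' k else 0)"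
    unfolding symm_def sum_distrib_right by (intro sum.cong) auto
  also have "\<dots> = (\<Sum>l<c. \<Sum>k'\<in>I. if k' = (\<gamma> ^^ l) i then \<chi> ^ l * T_matrix j k' k else 0)"
    by (rule sum.swap)
  also have "\<dots> = (\<Sum>l<c. \<chi> ^ l * T_matrix j ((\<gamma> ^^ l) i) k)"
    using finite_I iterate_closed[OF i] by simp
  also have "\<dots> = (\<Sum>l<c. t j i * (if k = (\<gamma> ^^ l) i then \<chi> ^ l else 0)
      + u j i * (if k = (\<gamma> ^^ l) (s j i) then \<chi> ^ l else 0))"
  proof (rule sum.cong)
    fix l
    show "\<chi> ^ l * T_matrix j ((\<gamma> ^^ l) i) k = t j i * (if k = (\<gamma> ^^ l) i then \<chi> ^ l else 0)
      + u j i * (if k = (\<gamma> ^^ l) (s j i) then \<chi> ^ l else 0)"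
      using orb[of l] by (cases "u j i = 0") (auto simp: T_matrix_def algebra_simps)
  qed simp
  also have "\<dots> = t j i * symm i k + u j i * symm (s j i) k"
    by (simp add: symm_def sum.distrib sum_distrib_left)
  finally show "(\<Sum>k'\<in>I. symm i k' * T_matrix j k' k) = t j i * symm i k + u j i * symm (s j i) k" .
qed

text \<open>Induction on the size of the support. As long as it meets a second orbit, some
  \<open>x\<close> has different eigenvalues on the two orbits, and \<open>x - e x i\<close> removes
  \<open>i\<close> while keeping a point of the other one.\<close>

lemma submodule_contains_symm:
  assumes N: "submodule N subalgebra submod" and "vec a \<in> N" "i \<in> I" "a i \<noteq> 0"
  shows "\<exists>i\<in>I. vec (symm i) \<in> N"
proof -
  interpret N: submodule N subalgebra submod by fact
  have NS: "N \<subseteq> sub" using N.subset by simp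
  have sc: "\<iota> z \<odot>\<^bsub>M\<^esub> m \<in> N" if "m \<in> N" for z m
    using N.smult_closed[of "\<iota> z" m] that generate_ring.incl[of "\<iota> z" gens R] by (simp add: gens_def)
  have X: "x \<odot>\<^bsub>M\<^esub> m \<in> N" if "m \<in> N" "x \<in> Xs" for x m
    using N.smult_closed[of x m] that generate_ring.incl[of x gens R] by (simp add: gens_def)
  have ad: "m \<oplus>\<^bsub>M\<^esub> m' \<in> N" if "m \<in> N" "m' \<in> N" for m m'
    using N.m_closed[OF that] by simp
  show ?thesis using assms(2-4)
  proof (induction "card {k \<in> I. a k \<noteq> 0}" arbitrary: a i rule: less_induct)
    case less
    have cov: "covariant a" using less.prems NS vec_in_sub by blast
    show ?case
    proof (cases "\<exists>k\<in>I. a k \<noteq> 0 \<and> (\<forall>l. k \<noteq> (\<gamma> ^^ l) i)")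
      case False
      then have "vec a = vec (\<lambda>k. a i * symm i k)"
        using covariant_one_orbit[OF cov less.prems(2)] by (intro vec_cong) blast
      then have "\<iota> (inverse (a i)) \<odot>\<^bsub>M\<^esub> vec a = vec (symm i)"
        using less.prems(3) by (simp add: vec_smult) (simp add: mult.assoc[symmetric])
      then show ?thesis using sc[OF less.prems(1)] less.prems(2) by metis
    next
      case True
      then obtain k where k: "k \<in> I" "a k \<noteq> 0" "\<And>l. k \<noteq> (\<gamma> ^^ l) i" by blast
      then obtain x where x: "x \<in> Xs" "e x i \<noteq> e x k" using X_separates[OF less.prems(2) k(1)] by blast
      define b where "b k = (e x k - e x i) * a k" for k
      have "vec b = x \<odot>\<^bsub>M\<^esub> vec a \<oplus>\<^bsub>M\<^esub> \<iota> (- e x i) \<odot>\<^bsub>M\<^esub> vec a"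
        unfolding X_vec[OF x(1)] vec_smult vec_add by (rule vec_cong) (simp add: b_def algebra_simps)
      then have "vec b \<in> N" using ad[OF X[OF less.prems(1) x(1)] sc[OF less.prems(1)]] by simp
      moreover have "b k \<noteq> 0" using k x by (simp add: b_def)
      moreover have "card {k \<in> I. b k \<noteq> 0} < card {k \<in> I. a k \<noteq> 0}"
      proof (rule psubset_card_mono)
        show "finite {k \<in> I. a k \<noteq> 0}" using finite_I by simp
        have "b i = 0" by (simp add: b_def)
        then show "{k \<in> I. b k \<noteq> 0} \<subset> {k \<in> I. a k \<noteq> 0}" using less.prems(2,3) by (auto simp: b_def)
      qed
      ultimately show ?thesis using less.hyps[of b k] k(1) by blast
    qed
  qed
qed

theorem simple_submod: "simple_module subalgebra submod"
  unfolding simple_module_def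
proof (intro conjI allI impI left_module_submod)
  obtain i where i: "i \<in> I" using nonempty by blast
  have "vec (symm i) \<noteq> \<zero>\<^bsub>M\<^esub>"
    unfolding vec_zero[symmetric] vec_eq_iff using symm_self[OF i] i by (auto intro!: bexI[of _ i])
  moreover have "vec (symm i) \<in> sub" using covariant_symm[OF i] by (simp add: vec_in_sub)
  ultimately show "carrier submod \<noteq> {\<zero>\<^bsub>submod\<^esub>}" by auto
next
  fix N assume N: "submodule N subalgebra submod"
  interpret N: submodule N subalgebra submod by fact
  have NS: "N \<subseteq> sub" using N.subset by simp
  have sc: "\<iota> z \<odot>\<^bsub>M\<^esub> m \<in> N" if "m \<in> N" for z m
    using N.smult_closed[of "\<iota> z" m] that generate_ring.incl[of "\<iota> z" gens R] by (simp add: gens_def)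
  have T: "T j \<odot>\<^bsub>M\<^esub> m \<in> N" if "m \<in> N" "j \<in> J" for j m
    using N.smult_closed[of "T j" m] that generate_ring.incl[of "T j" gens R] by (simp add: gens_def)
  have ad: "m \<oplus>\<^bsub>M\<^esub> m' \<in> N" if "m \<in> N" "m' \<in> N" for m m'
    using N.m_closed[OF that] by simp
  have z: "\<zero>\<^bsub>M\<^esub> \<in> N" using N.one_closed by simp
  show "N = {\<zero>\<^bsub>submod\<^esub>} \<or> N = carrier submod"
  proof (cases "N \<subseteq> {\<zero>\<^bsub>M\<^esub>}")
    case True then show ?thesis using z by auto
  next
    case False
    then obtain m where m: "m \<in> N" "m \<noteq> \<zero>\<^bsub>M\<^esub>" by blast
    obtain a where a: "m = vec a" using vec_surj m NS sub_subset by blast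
    then obtain i where "i \<in> I" "a i \<noteq> 0" using m vec_zero vec_eq_iff[of a "\<lambda>i. 0"] by auto
    then obtain i where i: "i \<in> I" "vec (symm i) \<in> N" using submodule_contains_symm[OF N, of a i] m a by blast
    have all: "vec (symm k) \<in> N" if "k \<in> I" for k
    proof (rule connected[OF i(1) that, of "\<lambda>k. vec (symm k) \<in> N"])
      show "vec (symm i) \<in> N" by fact
      fix i j assume ij: "i \<in> I" "j \<in> J" and mem: "vec (symm i) \<in> N" and u: "u j i \<noteq> 0"
      \<comment> \<open>The formula for the action of \<open>T j\<close>, solved for the neighbour;
        dividing by \<open>u j i\<close> is where the nonzero matrix coefficient enters.\<close>
      have "vec (symm (s j i)) = \<iota> (inverse (u j i)) \<odot>\<^bsub>M\<^esub> (T j \<odot>\<^bsub>M\<^esub> vec (symm i) \<oplus>\<^bsub>M\<^esub> \<iota> (- t j i) \<odot>\<^bsub>M\<^esub> vec (symm i))"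
        unfolding T_symm[OF ij(2,1)] vec_smult vec_add using u by (intro vec_cong) simp
      then show "vec (symm (s j i)) \<in> N" using sc[OF ad[OF T[OF mem ij(2)] sc[OF mem]]] by simp
    qed
    have "sub \<subseteq> N"
    proof
      fix m assume "m \<in> sub"
      then obtain a where a: "m = vec a" "covariant a" by (auto simp: sub_def)
      have "vec (\<lambda>k. \<Sum>r\<in>A. a r * symm r k) \<in> N" if "finite A" "A \<subseteq> I" for A
        using that
      proof (induction A rule: finite_induct)
        case empty then show ?case using z by (simp add: vec_zero)
      next
        case (insert r A)
        have "\<iota> (a r) \<odot>\<^bsub>M\<^esub> vec (symm r) \<oplus>\<^bsub>M\<^esub> vec (\<lambda>k. \<Sum>r\<in>A. a r * symm r k) \<in> N"
          using insert by (intro ad sc all) auto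
        then show ?case using insert.hyps by (simp add: vec_smult vec_add)
      qed
      from this[OF transversal_finite transversal_subset]
      show "m \<in> N" unfolding a(1) using vec_cong[of a, OF covariant_decomposition[OF a(2)]] by simp
    qed
    then show ?thesis using NS by auto
  qed
qed

text \<open>Matches the image of a projection with the covariant vectors: a covariant vector is the
  symmetrization of its own coordinates restricted to the representatives.\<close>

lemma symmetrization_image:
  "(\<lambda>a. vec (\<lambda>k. \<Sum>i\<in>I. a i * symm i k)) ` UNIV = sub"
proof
  have "covariant (\<lambda>k. \<Sum>i\<in>I. a i * symm i k)" for a
    using covariant_symm by (auto simp: covariant_def sum_distrib_left mult_ac intro!: sum.cong)
  then show "(\<lambda>a. vec (\<lambda>k. \<Sum>i\<in>I. a i * symm i k)) ` UNIV \<subseteq> sub" by (auto simp: vec_in_sub)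
  show "sub \<subseteq> (\<lambda>a. vec (\<lambda>k. \<Sum>i\<in>I. a i * symm i k)) ` UNIV"
  proof
    fix m assume "m \<in> sub"
    then obtain a where a: "m = vec a" "covariant a" by (auto simp: sub_def)
    have "(\<Sum>r\<in>transversal. a r * symm r k) = (\<Sum>i\<in>I. (if i \<in> transversal then a i else 0) * symm i k)" for k
      using finite_I transversal_subset by (intro sum.mono_neutral_cong_left) auto
    then have "m = vec (\<lambda>k. \<Sum>i\<in>I. (if i \<in> transversal then a i else 0) * symm i k)"
      unfolding a(1) using covariant_decomposition[OF a(2)] by (intro vec_cong) simp
    then show "m \<in> (\<lambda>a. vec (\<lambda>k. \<Sum>i\<in>I. a i * symm i k)) ` UNIV"
      by (rule image_eqI[where x = "\<lambda>i. if i \<in> transversal then a i else 0"]) simp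
  qed
qed

end

section \<open>The calibrated module of a placed skew shape\<close>

lemma hecke_g_power:
  assumes "1 \<le> n"
  shows "(hecke_g n q p ^^ k) \<in> ring_iso (hecke n q) (hecke n q)"
    and "(hecke_g n q p ^^ k) (hecke_scalar n q z) = hecke_scalar n q z"
    and "i \<in> {1..n} \<Longrightarrow> (hecke_g n q p ^^ k) (hecke_X n q (eps i)) =
          hecke_scalar n q (cis (2 * pi / real p) ^ k) \<otimes>\<^bsub>hecke n q\<^esub> hecke_X n q (eps i)"
    and "i \<in> {2..n} \<Longrightarrow> (hecke_g n q p ^^ k) (hecke_T n q i) = hecke_T n q i"
proof -
  interpret H: ring "hecke n q" by (rule ring_hecke)
  note g = hecke_g_properties[OF assms, where q = q and p = p] hecke_g_X[OF assms, where q = q and p = p]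
  have hom: "hecke_g n q p \<in> ring_hom (hecke n q) (hecke n q)"
    and bij: "bij_betw (hecke_g n q p) (carrier (hecke n q)) (carrier (hecke n q))"
    using g(1) by (auto simp: ring_iso_def)
  show "(hecke_g n q p ^^ k) \<in> ring_iso (hecke n q) (hecke n q)"
  proof (induction k)
    case 0
    show ?case by (auto simp: ring_iso_def ring_hom_def bij_betw_def)
  next
    case (Suc k)
    then have "(hecke_g n q p ^^ k) \<in> ring_hom (hecke n q) (hecke n q)"
      "bij_betw (hecke_g n q p ^^ k) (carrier (hecke n q)) (carrier (hecke n q))"
      by (auto simp: ring_iso_def)
    then show ?case
      using ring_hom_trans[OF _ hom] bij_betw_trans[OF _ bij] unfolding ring_iso_def funpow.simps by blast
  qed
  show "(hecke_g n q p ^^ k) (hecke_scalar n q z) = hecke_scalar n q z"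
    by (induction k) (simp_all add: g)
  show "(hecke_g n q p ^^ k) (hecke_X n q (eps i)) =
          hecke_scalar n q (cis (2 * pi / real p) ^ k) \<otimes>\<^bsub>hecke n q\<^esub> hecke_X n q (eps i)" if i: "i \<in> {1..n}"
  proof (induction k)
    case 0
    show ?case by (simp add: hecke_scalar_one hecke_X_closed)
  next
    case (Suc k)
    then show ?case
      using g(5)[OF i] ring_hom_mult[OF hom hecke_scalar_closed hecke_X_closed]
      by (simp add: g(2) hecke_scalar_mult H.m_assoc[symmetric] hecke_X_closed hecke_scalar_closed power_Suc2 del: power_Suc)
  qed
  show "(hecke_g n q p ^^ k) (hecke_T n q i) = hecke_T n q i" if i: "i \<in> {2..n}"
    by (induction k) (simp_all add: g(4)[OF i])
qed

text \<open>The group acts on boxes and the swap on positions, so they commute for arbitrary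
  fillings. This is what allows standardness of a swap to be transported along the action.\<close>

lemma tab_g_swap:
  assumes "i \<in> {2..n}"
  shows "tab_g q p n S k (swap_tab i L) = swap_tab i (tab_g q p n S k L)"
  using assms by (auto simp: tab_g_def swap_tab_def Let_def restrict_def fun_eq_iff)

section \<open>The lattice L_p and the nonvanishing of the matrix coefficients\<close>

lemma sum_eps: "i \<in> {1..n} \<Longrightarrow> (\<Sum>k\<in>{1..n}. eps i k) = 1"
  by (simp add: eps_def)

text \<open>The sum of the coordinates is the exponent with which a common factor of all weights
  enters the eigenvalue of X^\<lambda>.\<close>

lemma lattice_Lp_sum:
  assumes "lam \<in> lattice_Lp p n" shows "int p dvd (\<Sum>k\<in>{1..n}. lam k)"
proof -
  obtain a b where lam: "lam = (\<lambda>k. (\<Sum>i=2..n. a i * (eps i k - eps (i - 1) k))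
       + (\<Sum>i=1..n. b i * int p * eps i k))"
    using assms by (auto simp: lattice_Lp_def)
  have "(\<Sum>k\<in>{1..n}. lam k) = (\<Sum>i=2..n. \<Sum>k\<in>{1..n}. a i * (eps i k - eps (i - 1) k))
      + (\<Sum>i=1..n. \<Sum>k\<in>{1..n}. b i * int p * eps i k)"
    unfolding lam sum.distrib by (intro arg_cong2[where f = "(+)"] sum.swap)
  also have "(\<Sum>i=2..n. \<Sum>k\<in>{1..n}. a i * (eps i k - eps (i - 1) k)) = 0"
  proof (rule sum.neutral, rule ballI)
    fix i assume "i \<in> {2..n}"
    then have "i \<in> {1..n}" "i - 1 \<in> {1..n}" by auto
    then show "(\<Sum>k\<in>{1..n}. a i * (eps i k - eps (i - 1) k)) = 0"
      unfolding sum_distrib_left[symmetric] sum_subtractf by (simp only: sum_eps) simp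
  qed
  also have "(\<Sum>i=1..n. \<Sum>k\<in>{1..n}. b i * int p * eps i k) = (\<Sum>i=1..n. b i * int p)"
    unfolding sum_distrib_left[symmetric] by (intro sum.cong) (simp_all only: sum_eps mult_1_right)
  finally show ?thesis by (simp add: dvd_sum)
qed

lemma eps_diff_in_Lp:
  assumes "i \<in> {2..n}" shows "(\<lambda>k. eps i k - eps (i - 1) k) \<in> lattice_Lp p n"
  unfolding lattice_Lp_def
proof (intro CollectI exI)
  show "(\<lambda>k. eps i k - eps (i - 1) k) = (\<lambda>k. (\<Sum>l=2..n. (if l = i then 1 else 0) * (eps l k - eps (l - 1) k))
       + (\<Sum>l=1..n. (\<lambda>_. 0) l * int p * eps l k))"
    using assms by (simp add: if_distrib[of "\<lambda>x. x * _"] cong: if_cong)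
qed

lemma p_eps_in_Lp:
  assumes "1 \<le> n" shows "(\<lambda>k. int p * eps 1 k) \<in> lattice_Lp p n"
  unfolding lattice_Lp_def
proof (intro CollectI exI)
  show "(\<lambda>k. int p * eps 1 k) = (\<lambda>k. (\<Sum>l=2..n. (\<lambda>_. 0) l * (eps l k - eps (l - 1) k))
       + (\<Sum>l=1..n. (if l = 1 then 1 else 0) * int p * eps l k))"
    using assms by (simp add: if_distrib[of "\<lambda>x. x * _"] cong: if_cong)
qed

lemma card_multiples_below:
  fixes \<kappa> p :: nat assumes "1 \<le> \<kappa>" "\<kappa> dvd p"
  shows "card {k. k < p \<and> \<kappa> dvd k} = p div \<kappa>"
proof -
  obtain c where c: "p = \<kappa> * c" using assms by auto
  have "{k. k < p \<and> \<kappa> dvd k} = (\<lambda>l. \<kappa> * l) ` {..<c}" using assms by (auto simp: c)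
  moreover have "inj_on (\<lambda>l. \<kappa> * l) {..<c}" using assms by (auto intro: inj_onI)
  ultimately show ?thesis using assms by (simp add: card_image c)
qed

text \<open>The coefficient vanishes only if the ratio of the two weights is q^2, that is, if the
  boxes lie on neighbouring diagonals; then their order is forced and the swap is not
  standard.\<close>

lemma swap_coefficient_nonzero:
  assumes q: "0 < q" "q \<noteq> 1" and S: "book q S" and L: "L \<in> standard_tableaux n S" and i: "i \<in> {2..n}"
    and sw: "swap_tab i L \<in> standard_tableaux n S"
  shows "of_real (inverse q) + T_diag q i L \<noteq> 0"
proof
  assume z: "of_real (inverse q) + T_diag q i L = 0"
  have i': "i - 1 \<in> {1..n}" "i \<in> {1..n}" using i by auto
  define w where "w = qpow q (content (L (i - 1)) - content (L i))"
  \<comment> \<open>For \<open>w = 1\<close> the quotient in \<open>T_diag\<close> is a division by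
    zero with value 0, which would leave the nonzero coefficient \<open>inverse q\<close>.\<close>
  have "w \<noteq> 1"
  proof
    assume "w = 1"
    then have "T_diag q i L = 0" by (simp add: T_diag_def w_def)
    with z q show False by simp
  qed
  define Q where "Q = complex_of_real q"
  have Q: "Q \<noteq> 0" using q by (simp add: Q_def)
  have "T_diag q i L = (Q - inverse Q) / (1 - w)" by (simp add: T_diag_def w_def Q_def)
  then have "(inverse Q + (Q - inverse Q) / (1 - w)) * (1 - w) = 0" using z by (simp add: Q_def)
  then have "inverse Q * (1 - w) + (Q - inverse Q) = 0"
    using \<open>w \<noteq> 1\<close> by (simp add: distrib_right)
  then have "w = Q * Q" using Q by (simp add: field_simps)
  then have "w = of_real (q\<^sup>2)" by (simp add: Q_def power2_eq_square)
  moreover have "qpow q 1 = of_real (q\<^sup>2)"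
    unfolding qpow_def mult_1_right exp_of_real by (subst exp_ln) (use q in simp_all)
  moreover have "qpow q (content (L i) + 1) = qpow q (content (L i)) * qpow q 1"
    by (simp add: qpow_def distrib_left exp_add)
  ultimately have eq: "qpow q (content (L (i - 1))) = qpow q (content (L i) + 1)"
    unfolding w_def qpow_diff by (simp add: field_simps)
  obtain \<beta> r s where b: "L i = (\<beta>, r, s)" by (cases "L i")
  have "\<beta> \<in> pages q" using tableau_in[OF L i'(2)] b book_page[OF S] by simp
  \<comment> \<open>The box to the right of \<open>L i\<close> need not belong to \<open>S\<close>,
    so a book consisting of this box alone is used for the comparison of contents.\<close>
  then have bk: "book q {(\<beta>, r, s + 1)}" unfolding book_def by auto
  have "content (L (i - 1)) = content (\<beta>, r, s + 1)"
    by (rule content_eq_of_qpow_eq[OF q S tableau_in[OF L i'(1)] bk])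
       (use eq b in \<open>simp_all add: algebra_simps\<close>)
  then have "content (L (i - 1)) = content (L i) + 1" by (simp add: b)
  with swap_tableau_content[OF S L i sw] show False by simp
qed

section \<open>The action of the stabilizer on the module\<close>

locale placed_module =
  fixes q :: real and n p :: nat and S :: "box set"
    and M :: "(hecke_elt, 'v) module" and v :: "(nat \<Rightarrow> box) \<Rightarrow> 'v"
  assumes q: "0 < q" "q \<noteq> 1" and n: "1 \<le> n" and p: "1 \<le> p"
    and shape: "placed_skew_shape q n S" and skew: "skew_module n q S M v"
begin

abbreviation "H \<equiv> hecke n q"
abbreviation "\<iota> \<equiv> hecke_scalar n q"
abbreviation "ST \<equiv> standard_tableaux n S"
abbreviation "\<kappa> \<equiv> kappa q p S"
abbreviation "\<zeta> \<equiv> cis (- (2 * pi / real p))"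
abbreviation "stab k \<equiv> book_eq ((shape_g q p ^^ k) S) S"

lemma bookS: "book q S" by (rule placed_skew_shape_book[OF shape])

lemma cardS: "card S = n" using shape by (simp add: placed_skew_shape_def)

sublocale based_module H M \<iota> ST v
proof (intro based_module.intro based_module_axioms.intro)
  show "left_module H M" "finite_basis \<iota> M ST v" using skew by (auto simp: skew_module_def)
qed (rule hecke_scalar_closed hecke_scalar_add hecke_scalar_mult hecke_scalar_one | erule hecke_scalar_central)+

lemma stab_iff: "stab k \<longleftrightarrow> \<kappa> dvd k"
  by (rule stabilizer_eq_multiples_kappa(3)[OF q bookS cardS p])

lemmas g_closed = tab_g_tableau(1)[OF q bookS] and g_weight = tab_g_tableau(2)[OF q bookS]

lemma X_basis: "L \<in> ST \<Longrightarrow> i \<in> {1..n} \<Longrightarrow> hecke_X n q (eps i) \<odot>\<^bsub>M\<^esub> v L = \<iota> (weight q L i) \<odot>\<^bsub>M\<^esub> v L"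
  using skew by (simp add: skew_module_def weight_def)

definition T_off :: "nat \<Rightarrow> (nat \<Rightarrow> box) \<Rightarrow> complex" where
  "T_off i L = (if swap_tab i L \<in> ST then of_real (inverse q) + T_diag q i L else 0)"

text \<open>The second case is a dummy, multiplied by \<open>T_off\<close> equal to 0; it keeps the
  map inside the standard tableaux and makes the formula for T_i uniform.\<close>

definition T_swap :: "nat \<Rightarrow> (nat \<Rightarrow> box) \<Rightarrow> (nat \<Rightarrow> box)" where
  "T_swap i L = (if swap_tab i L \<in> ST then swap_tab i L else L)"

lemma T_action:
  assumes "L \<in> ST" "i \<in> {2..n}"
  shows "hecke_T n q i \<odot>\<^bsub>M\<^esub> v L
    = \<iota> (T_diag q i L) \<odot>\<^bsub>M\<^esub> v L \<oplus>\<^bsub>M\<^esub> \<iota> (T_off i L) \<odot>\<^bsub>M\<^esub> v (T_swap i L)"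
proof -
  have "hecke_T n q i \<odot>\<^bsub>M\<^esub> v L =
            \<iota> (T_diag q i L) \<odot>\<^bsub>M\<^esub> v L
            \<oplus>\<^bsub>M\<^esub> \<iota> (of_real (inverse q) + T_diag q i L) \<odot>\<^bsub>M\<^esub>
                (if swap_tab i L \<in> ST then v (swap_tab i L) else \<zero>\<^bsub>M\<^esub>)"
    using skew assms unfolding skew_module_def by blast
  then show ?thesis
    using assms by (cases "swap_tab i L \<in> ST")
      (simp_all add: T_off_def T_swap_def smult_zero_right scalar_zero smult_zero_left v_closed)
qed

lemma T_swap_closed: "L \<in> ST \<Longrightarrow> T_swap i L \<in> ST"
  by (simp add: T_swap_def)

text \<open>The entry depends only on the ratio of two weights, in which the common rotation
  cancels.\<close>

lemma T_diag_invariant: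
  assumes k: "stab k" and L: "L \<in> ST" and i: "i \<in> {2..n}"
  shows "T_diag q i (tab_g q p n S k L) = T_diag q i L"
proof -
  have i': "i - 1 \<in> {1..n}" "i \<in> {1..n}" using i by auto
  have "qpow q (content (tab_g q p n S k L (i - 1)) - content (tab_g q p n S k L i))
     = qpow q (content (L (i - 1)) - content (L i))"
    using g_weight[OF L k i'(1)] g_weight[OF L k i'(2)] by (simp add: qpow_diff weight_def)
  then show ?thesis by (simp add: T_diag_def)
qed

lemma swap_invariant:
  assumes k: "stab k" and L: "L \<in> ST" and i: "i \<in> {2..n}"
  shows "swap_tab i (tab_g q p n S k L) \<in> ST \<longleftrightarrow> swap_tab i L \<in> ST"
proof
  assume "swap_tab i L \<in> ST"
  then show "swap_tab i (tab_g q p n S k L) \<in> ST"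
    using g_closed[OF _ k] tab_g_swap[OF i] by metis
next
  assume sw: "swap_tab i (tab_g q p n S k L) \<in> ST"
  \<comment> \<open>The exponent of the inverse: \<open>k' + k\<close> is a multiple of
    \<open>p\<close>. It carries standardness of the swap back.\<close>
  define k' where "k' = (p - 1) * k"
  have k': "stab k'" using k unfolding stab_iff k'_def by simp
  have e: "k' + k = p * k" using p by (cases p) (auto simp: k'_def)
  have "tab_g q p n S k' (tab_g q p n S k L) = L"
  proof (rule tableau_determined_by_weights[OF q bookS L g_closed[OF g_closed[OF L k] k']])
    fix l assume l: "l \<in> {1..n}"
    have "weight q (tab_g q p n S k' (tab_g q p n S k L)) l = \<zeta> ^ (k' + k) * weight q L l"
      using g_weight[OF g_closed[OF L k] k' l] g_weight[OF L k l] by (simp add: power_add)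
    also have "\<zeta> ^ (k' + k) = 1" unfolding e power_mult using p by simp
    finally show "weight q (tab_g q p n S k' (tab_g q p n S k L)) l = weight q L l" by simp
  qed
  then show "swap_tab i L \<in> ST"
    using g_closed[OF sw k'] tab_g_swap[OF i] by metis
qed

lemma T_off_invariant:
  "stab k \<Longrightarrow> L \<in> ST \<Longrightarrow> i \<in> {2..n} \<Longrightarrow> T_off i (tab_g q p n S k L) = T_off i L"
  by (simp add: T_off_def swap_invariant T_diag_invariant)

lemma T_swap_equivariant:
  "stab k \<Longrightarrow> L \<in> ST \<Longrightarrow> i \<in> {2..n} \<Longrightarrow> T_swap i (tab_g q p n S k L) = tab_g q p n S k (T_swap i L)"
  by (simp add: T_swap_def swap_invariant tab_g_swap)

lemma g_bij: "stab k \<Longrightarrow> bij_betw (tab_g q p n S k) ST ST"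
  by (rule tab_g_bij[OF q bookS cardS p _ finite_I])

lemma module_g_vec:
  assumes "stab k"
  shows "module_g n q p S M v k (vec a) = vec (\<lambda>L'. \<Sum>L\<in>ST. a L * (if L' = tab_g q p n S k L then 1 else 0))"
  unfolding module_g_def
  by (rule linear_ext_vec) (simp add: vec_single g_closed[OF _ assms])

text \<open>Writing the operator as composition of the coordinates with the inverse permutation
  makes linearity and bijectivity immediate; the sum in the preceding form is the one suited to
  \<open>proj\<close>.\<close>

lemma module_g_vec':
  assumes k: "stab k"
  shows "module_g n q p S M v k (vec a) = vec (\<lambda>L. a (inv_into ST (tab_g q p n S k) L))"
  unfolding module_g_vec[OF k]
proof (rule vec_cong)
  fix L' assume L': "L' \<in> ST"
  define L0 where "L0 = inv_into ST (tab_g q p n S k) L'"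
  have L0: "L0 \<in> ST" "tab_g q p n S k L0 = L'"
    using g_bij[OF k] L' unfolding L0_def by (auto simp: bij_betw_def inv_into_into f_inv_into_f)
  have "L' = tab_g q p n S k L \<longleftrightarrow> L = L0" if "L \<in> ST" for L
    using g_bij[OF k] L0 that by (auto simp: bij_betw_def dest: inj_onD)
  then have "(\<Sum>L\<in>ST. a L * (if L' = tab_g q p n S k L then 1 else 0)) = (\<Sum>L\<in>ST. if L = L0 then a L else 0)"
    by (intro sum.cong) auto
  then show "(\<Sum>L\<in>ST. a L * (if L' = tab_g q p n S k L then 1 else 0)) = a (inv_into ST (tab_g q p n S k) L')"
    using finite_I L0 by (simp add: L0_def[symmetric])
qed

lemma module_g_basis: "stab k \<Longrightarrow> L \<in> ST \<Longrightarrow> module_g n q p S M v k (v L) = v (tab_g q p n S k L)"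
proof -
  assume k: "stab k" and L: "L \<in> ST"
  have "module_g n q p S M v k (v L) = vec (\<lambda>L'. if L' = tab_g q p n S k L then 1 else 0)"
    unfolding vec_single[OF L, symmetric] module_g_vec[OF k]
    by (rule vec_cong) (use finite_I L in \<open>simp add: if_distrib[of "\<lambda>x. x * _"] cong: if_cong\<close>)
  then show ?thesis using vec_single g_closed[OF L k] by simp
qed

lemma module_g_linear:
  assumes k: "stab k"
  shows "m \<in> carrier M \<Longrightarrow> module_g n q p S M v k m \<in> carrier M"
    and "m \<in> carrier M \<Longrightarrow> m' \<in> carrier M \<Longrightarrow> module_g n q p S M v k (m \<oplus>\<^bsub>M\<^esub> m')
      = module_g n q p S M v k m \<oplus>\<^bsub>M\<^esub> module_g n q p S M v k m'"
    and "m \<in> carrier M \<Longrightarrow> module_g n q p S M v k (\<iota> z \<odot>\<^bsub>M\<^esub> m) = \<iota> z \<odot>\<^bsub>M\<^esub> module_g n q p S M v k m"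
proof -
  show "module_g n q p S M v k m \<in> carrier M" if "m \<in> carrier M"
    using vec_surj[OF that] module_g_vec'[OF k] by (metis vec_closed)
  show "module_g n q p S M v k (m \<oplus>\<^bsub>M\<^esub> m')
      = module_g n q p S M v k m \<oplus>\<^bsub>M\<^esub> module_g n q p S M v k m'" if m: "m \<in> carrier M" "m' \<in> carrier M"
  proof -
    obtain a a' where "m = vec a" "m' = vec a'" using vec_surj m by metis
    then show ?thesis by (simp add: vec_add module_g_vec'[OF k])
  qed
  show "module_g n q p S M v k (\<iota> z \<odot>\<^bsub>M\<^esub> m) = \<iota> z \<odot>\<^bsub>M\<^esub> module_g n q p S M v k m" if m: "m \<in> carrier M"
  proof -
    obtain a where "m = vec a" using vec_surj m by metis
    then show ?thesis by (simp add: vec_smult module_g_vec'[OF k])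
  qed
qed

lemma module_g_bij:
  assumes k: "stab k" shows "bij_betw (module_g n q p S M v k) (carrier M) (carrier M)"
proof -
  let ?g = "tab_g q p n S k"
  have "inj_on (module_g n q p S M v k) (carrier M)"
  proof (rule inj_onI)
    fix m m' assume m: "m \<in> carrier M" "m' \<in> carrier M" and eq: "module_g n q p S M v k m = module_g n q p S M v k m'"
    obtain a a' where a: "m = vec a" "m' = vec a'" using vec_surj m by metis
    have e: "a (inv_into ST ?g L) = a' (inv_into ST ?g L)" if "L \<in> ST" for L
      using eq that by (simp add: a module_g_vec'[OF k] vec_eq_iff)
    have "a L = a' L" if "L \<in> ST" for L
      using e[OF g_closed[OF that k]] g_bij[OF k] that by (simp add: bij_betw_def)
    then show "m = m'" unfolding a by (rule vec_cong)
  qed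
  moreover have "m \<in> module_g n q p S M v k ` carrier M" if m: "m \<in> carrier M" for m
  proof -
    obtain a where a: "m = vec a" using vec_surj m by metis
    have "module_g n q p S M v k (vec (\<lambda>L. a (?g L))) = m"
      unfolding a module_g_vec'[OF k] using g_bij[OF k]
      by (intro vec_cong) (auto simp: bij_betw_def f_inv_into_f)
    then show ?thesis by (metis imageI vec_closed)
  qed
  ultimately show ?thesis using module_g_linear(1)[OF k] by (auto simp: bij_betw_def)
qed

text \<open>It suffices to treat generators on basis vectors. For T_i the matrix is invariant under
  the action on tableaux; for X^(\<epsilon>_1) the factor \<xi>^k from the automorphism cancels the
  factor \<xi>^-k by which the weights are rotated.\<close>

lemma module_g_semilinear:
  assumes k: "stab k" and x: "x \<in> carrier H" and m: "m \<in> carrier M"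
  shows "module_g n q p S M v k (x \<odot>\<^bsub>M\<^esub> m) = (hecke_g n q p ^^ k) x \<odot>\<^bsub>M\<^esub> module_g n q p S M v k m"
proof -
  let ?\<tau> = "hecke_g n q p ^^ k" and ?\<phi> = "module_g n q p S M v k"
  note \<tau> = hecke_g_power[OF n, where q = q and p = p and k = k] and \<phi> = module_g_linear[OF k]
  have hom: "?\<tau> \<in> ring_hom H H" using \<tau>(1) by (simp add: ring_iso_def)
  note \<tau>c = ring_hom_closed[OF hom]
  have on_basis: "?\<phi> (x \<odot>\<^bsub>M\<^esub> m) = ?\<tau> x \<odot>\<^bsub>M\<^esub> ?\<phi> m"
    if x: "x \<in> carrier H" and eq: "\<And>L. L \<in> ST \<Longrightarrow> ?\<phi> (x \<odot>\<^bsub>M\<^esub> v L) = ?\<tau> x \<odot>\<^bsub>M\<^esub> ?\<phi> (v L)"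
      and m: "m \<in> carrier M" for x m
  proof (rule linear_eq_on_basis[where f = "\<lambda>m. ?\<phi> (x \<odot>\<^bsub>M\<^esub> m)" and h = "\<lambda>m. ?\<tau> x \<odot>\<^bsub>M\<^esub> ?\<phi> m", OF _ _ _ _ _ _ eq m])
    have sc: "y \<odot>\<^bsub>M\<^esub> (\<iota> z \<odot>\<^bsub>M\<^esub> m) = \<iota> z \<odot>\<^bsub>M\<^esub> (y \<odot>\<^bsub>M\<^esub> m)" if "y \<in> carrier H" "m \<in> carrier M" for y z m
      using that smult_assoc[of y "\<iota> z" m] smult_assoc[of "\<iota> z" y m] by (simp add: scalar_central)
    show "?\<phi> (x \<odot>\<^bsub>M\<^esub> (\<iota> z \<odot>\<^bsub>M\<^esub> m)) = \<iota> z \<odot>\<^bsub>M\<^esub> ?\<phi> (x \<odot>\<^bsub>M\<^esub> m)" if "m \<in> carrier M" for z m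
      using that x by (simp add: sc \<phi> smult_closed)
    show "?\<tau> x \<odot>\<^bsub>M\<^esub> ?\<phi> (\<iota> z \<odot>\<^bsub>M\<^esub> m) = \<iota> z \<odot>\<^bsub>M\<^esub> (?\<tau> x \<odot>\<^bsub>M\<^esub> ?\<phi> m)" if "m \<in> carrier M" for z m
      using that x by (simp add: sc \<phi> \<tau>c)
  qed (use x in \<open>simp_all add: \<phi> smult_closed smult_r_distr \<tau>c\<close>)
  show ?thesis using x n m
  proof (induction x arbitrary: m rule: hecke_generated_induct)
    case (scalar z)
    then show ?case by (simp add: \<phi> \<tau>)
  next
    case (T i)
    show ?case
    proof (rule on_basis[OF hecke_T_closed[OF T(1)] _ T(2)])
      fix L assume L: "L \<in> ST"
      note c = v_closed[OF L] v_closed[OF T_swap_closed[OF L, of i]]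
      have "?\<phi> (hecke_T n q i \<odot>\<^bsub>M\<^esub> v L) = \<iota> (T_diag q i L) \<odot>\<^bsub>M\<^esub> v (tab_g q p n S k L)
          \<oplus>\<^bsub>M\<^esub> \<iota> (T_off i L) \<odot>\<^bsub>M\<^esub> v (tab_g q p n S k (T_swap i L))"
        using c L T(1) by (simp add: T_action \<phi> module_g_basis[OF k] T_swap_closed del: atLeastAtMost_iff)
      also have "\<dots> = hecke_T n q i \<odot>\<^bsub>M\<^esub> v (tab_g q p n S k L)"
        using T_action[OF g_closed[OF L k] T(1)] L T(1) k
        by (simp add: T_diag_invariant T_off_invariant T_swap_equivariant del: atLeastAtMost_iff)
      finally show "?\<phi> (hecke_T n q i \<odot>\<^bsub>M\<^esub> v L) = ?\<tau> (hecke_T n q i) \<odot>\<^bsub>M\<^esub> ?\<phi> (v L)"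
        by (simp only: \<tau>(4)[OF T(1)] module_g_basis[OF k L])
    qed
  next
    case X
    have 1: "1 \<in> {1..n}" using n by simp
    show ?case
    proof (rule on_basis[OF hecke_X_closed _ X])
      fix L assume L: "L \<in> ST"
      note gL = g_closed[OF L k] and gw = g_weight[OF L k 1]
      have "?\<tau> (hecke_X n q (eps 1)) \<odot>\<^bsub>M\<^esub> ?\<phi> (v L)
          = \<iota> (cis (2 * pi / real p) ^ k) \<odot>\<^bsub>M\<^esub> (hecke_X n q (eps 1) \<odot>\<^bsub>M\<^esub> v (tab_g q p n S k L))"
        unfolding \<tau>(3)[OF 1] module_g_basis[OF k L]
        by (rule smult_assoc) (simp_all add: hecke_X_closed v_closed gL)
      also have "\<dots> = \<iota> (cis (2 * pi / real p) ^ k * (\<zeta> ^ k * weight q L 1)) \<odot>\<^bsub>M\<^esub> v (tab_g q p n S k L)"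
        unfolding X_basis[OF gL 1] gw by (rule scalar_smult_smult[OF v_closed[OF gL]])
      also have "cis (2 * pi / real p) ^ k * (\<zeta> ^ k * weight q L 1) = weight q L 1"
        by (simp add: mult.assoc[symmetric] power_mult_distrib[symmetric] cis_mult)
      also have "\<iota> (weight q L 1) \<odot>\<^bsub>M\<^esub> v (tab_g q p n S k L) = ?\<phi> (hecke_X n q (eps 1) \<odot>\<^bsub>M\<^esub> v L)"
        unfolding X_basis[OF L 1] using L by (simp add: \<phi> v_closed module_g_basis[OF k])
      finally show "?\<phi> (hecke_X n q (eps 1) \<odot>\<^bsub>M\<^esub> v L) = ?\<tau> (hecke_X n q (eps 1)) \<odot>\<^bsub>M\<^esub> ?\<phi> (v L)" by simp
    qed
  next
    case (add x y)
    then show ?case by (simp add: smult_l_distr \<phi> ring_hom_add[OF hom] \<tau>c smult_closed)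
  next
    case (mult x y)
    then show ?case by (simp add: smult_assoc \<phi> ring_hom_mult[OF hom] \<tau>c smult_closed)
  next
    case (inverse x y)
    \<comment> \<open>Semilinearity for \<open>x\<close> is applied to the vector
      \<open>y m\<close>, which is why the vector is arbitrary in the induction.\<close>
    have ym: "y \<odot>\<^bsub>M\<^esub> m \<in> carrier M" using inverse by (simp add: smult_closed)
    have "?\<phi> m = ?\<phi> (x \<odot>\<^bsub>M\<^esub> (y \<odot>\<^bsub>M\<^esub> m))"
      using inverse by (simp add: smult_assoc[symmetric] smult_one)
    also have "\<dots> = ?\<tau> x \<odot>\<^bsub>M\<^esub> ?\<phi> (y \<odot>\<^bsub>M\<^esub> m)" by (rule inverse.IH[OF ym])
    finally have "?\<tau> y \<odot>\<^bsub>M\<^esub> ?\<phi> m = (?\<tau> y \<otimes>\<^bsub>H\<^esub> ?\<tau> x) \<odot>\<^bsub>M\<^esub> ?\<phi> (y \<odot>\<^bsub>M\<^esub> m)"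
      using inverse ym by (simp add: smult_assoc \<tau>c \<phi>)
    also have "?\<tau> y \<otimes>\<^bsub>H\<^esub> ?\<tau> x = \<one>\<^bsub>H\<^esub>"
      using inverse ring_hom_mult[OF hom, of y x] ring_hom_one[OF hom] by simp
    finally show ?case using ym by (simp add: smult_one \<phi>)
  qed
qed

text \<open>An isomorphism sends \<open>v L\<close> to a nonzero vector that is a joint eigenvector
  of the X^(\<epsilon>_i) with weights rotated by \<xi>^-k. Any tableau in its support has these
  weights, and one such tableau already forces the books to agree.\<close>

lemma stab_of_isomorphic:
  assumes "module_isomorphic H (twisted_module H (hecke_g n q p ^^ k) M) M"
  shows "stab k"
proof -
  let ?\<tau> = "hecke_g n q p ^^ k"
  note \<tau> = hecke_g_power[OF n, where q = q and p = p and k = k]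
  obtain \<psi> where bij: "bij_betw \<psi> (carrier M) (carrier M)"
    and add: "\<And>x y. x \<in> carrier M \<Longrightarrow> y \<in> carrier M \<Longrightarrow> \<psi> (x \<oplus>\<^bsub>M\<^esub> y) = \<psi> x \<oplus>\<^bsub>M\<^esub> \<psi> y"
    and sm: "\<And>a x. a \<in> carrier H \<Longrightarrow> x \<in> carrier M \<Longrightarrow> \<psi> (inv_into (carrier H) ?\<tau> a \<odot>\<^bsub>M\<^esub> x) = a \<odot>\<^bsub>M\<^esub> \<psi> x"
    using assms by (auto simp: module_isomorphic_def twisted_module_def)
  have \<psi>c: "\<psi> x \<in> carrier M" if "x \<in> carrier M" for x using bij that by (rule bij_betwE[THEN bspec])
  have \<tau>bij: "bij_betw ?\<tau> (carrier H) (carrier H)" using \<tau>(1) by (simp add: ring_iso_def)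
  \<comment> \<open>Inserting the image of \<open>a\<close> under the automorphism removes the
    inverse that occurs in the definition of the twist.\<close>
  have sem: "\<psi> (a \<odot>\<^bsub>M\<^esub> x) = ?\<tau> a \<odot>\<^bsub>M\<^esub> \<psi> x" if "a \<in> carrier H" "x \<in> carrier M" for a x
    using sm[OF _ that(2), of "?\<tau> a"] that \<tau>bij by (auto simp: bij_betw_def inv_into_f_f)
  obtain L where L: "L \<in> ST" using standard_tableaux_nonempty[OF book_finite[OF bookS] cardS] by blast
  obtain a where a: "\<psi> (v L) = vec a" using vec_surj[OF \<psi>c[OF v_closed[OF L]]] .
  have "v L \<noteq> \<zero>\<^bsub>M\<^esub>"
    unfolding vec_single[OF L, symmetric] vec_zero[symmetric] vec_eq_iff using L by auto
  moreover have "\<psi> \<zero>\<^bsub>M\<^esub> = \<zero>\<^bsub>M\<^esub>"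
    using add[of "\<zero>\<^bsub>M\<^esub>" "\<zero>\<^bsub>M\<^esub>"] \<psi>c[of "\<zero>\<^bsub>M\<^esub>"] by (metis M.add.r_cancel_one' M.l_zero M.zero_closed)
  ultimately have "\<psi> (v L) \<noteq> \<zero>\<^bsub>M\<^esub>"
    using bij v_closed[OF L] by (metis M.zero_closed bij_betw_imp_inj_on inj_onD)
  then obtain L' where L': "L' \<in> ST" "a L' \<noteq> 0"
    unfolding a vec_zero[symmetric] vec_eq_iff by auto
  have "weight q L' i = \<zeta> ^ k * weight q L i" if i: "i \<in> {1..n}" for i
  proof -
    have "vec (\<lambda>K. weight q L i * a K) = \<psi> (hecke_X n q (eps i) \<odot>\<^bsub>M\<^esub> v L)"
      unfolding X_basis[OF L i] using sem[OF hecke_scalar_closed v_closed[OF L]] \<tau>(2) a by (simp add: vec_smult)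
    also have "\<dots> = (\<iota> (cis (2 * pi / real p) ^ k) \<otimes>\<^bsub>H\<^esub> hecke_X n q (eps i)) \<odot>\<^bsub>M\<^esub> vec a"
      using sem[OF hecke_X_closed v_closed[OF L]] \<tau>(3)[OF i] a by simp
    also have "\<dots> = \<iota> (cis (2 * pi / real p) ^ k) \<odot>\<^bsub>M\<^esub> vec (\<lambda>K. weight q K i * a K)"
      using smult_vec_eigen[OF hecke_X_closed X_basis[OF _ i]] by (simp add: smult_assoc hecke_X_closed)
    finally have "\<forall>K\<in>ST. weight q L i * a K = cis (2 * pi / real p) ^ k * (weight q K i * a K)"
      by (simp only: vec_smult vec_eq_iff)
    then have "weight q L i * a L' = cis (2 * pi / real p) ^ k * (weight q L' i * a L')"
      using L'(1) by (rule bspec)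
    then have "weight q L i = cis (2 * pi / real p) ^ k * weight q L' i" using L'(2) by simp
    then have "\<zeta> ^ k * weight q L i = (\<zeta> ^ k * cis (2 * pi / real p) ^ k) * weight q L' i" by simp
    also have "\<zeta> ^ k * cis (2 * pi / real p) ^ k = 1"
      by (simp add: power_mult_distrib[symmetric] cis_mult)
    finally show ?thesis by simp
  qed
  then show ?thesis by (rule book_eq_of_rotated_weights[OF q bookS L L'(1)])
qed

lemma isomorphic_of_stab:
  assumes k: "stab k"
  shows "module_isomorphic H (twisted_module H (hecke_g n q p ^^ k) M) M"
  unfolding module_isomorphic_def twisted_module_def
proof (intro exI conjI ballI)
  let ?\<tau> = "hecke_g n q p ^^ k"
  have \<tau>: "bij_betw ?\<tau> (carrier H) (carrier H)"
    using hecke_g_power(1)[OF n] by (simp add: ring_iso_def)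
  show "bij_betw (module_g n q p S M v k) (carrier (M\<lparr>smult := \<lambda>a. (\<odot>\<^bsub>M\<^esub>) (inv_into (carrier H) ?\<tau> a)\<rparr>)) (carrier M)"
    using module_g_bij[OF k] by simp
  fix x y assume "x \<in> carrier (M\<lparr>smult := \<lambda>a. (\<odot>\<^bsub>M\<^esub>) (inv_into (carrier H) ?\<tau> a)\<rparr>)"
     "y \<in> carrier (M\<lparr>smult := \<lambda>a. (\<odot>\<^bsub>M\<^esub>) (inv_into (carrier H) ?\<tau> a)\<rparr>)"
  then show "module_g n q p S M v k (x \<oplus>\<^bsub>M\<lparr>smult := \<lambda>a. (\<odot>\<^bsub>M\<^esub>) (inv_into (carrier H) ?\<tau> a)\<rparr>\<^esub> y)
     = module_g n q p S M v k x \<oplus>\<^bsub>M\<^esub> module_g n q p S M v k y"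
    by (simp add: module_g_linear(2)[OF k])
next
  let ?\<tau> = "hecke_g n q p ^^ k"
  have \<tau>: "bij_betw ?\<tau> (carrier H) (carrier H)"
    using hecke_g_power(1)[OF n] by (simp add: ring_iso_def)
  fix a x assume a: "a \<in> carrier H" and "x \<in> carrier (M\<lparr>smult := \<lambda>a. (\<odot>\<^bsub>M\<^esub>) (inv_into (carrier H) ?\<tau> a)\<rparr>)"
  then have x: "x \<in> carrier M" by simp
  have "inv_into (carrier H) ?\<tau> a \<in> carrier H" "?\<tau> (inv_into (carrier H) ?\<tau> a) = a"
    using \<tau> a by (auto simp: bij_betw_def inv_into_into f_inv_into_f)
  then show "module_g n q p S M v k (a \<odot>\<^bsub>M\<lparr>smult := \<lambda>a. (\<odot>\<^bsub>M\<^esub>) (inv_into (carrier H) ?\<tau> a)\<rparr>\<^esub> x)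
     = a \<odot>\<^bsub>M\<^esub> module_g n q p S M v k x"
    using module_g_semilinear[OF k _ x, of "inv_into (carrier H) ?\<tau> a"] by simp
qed

text \<open>Shows that the number of summands in \<open>proj\<close> is the length of the orbits of
  g^\<kappa> on tableaux, so the projection runs over every orbit exactly once.\<close>

lemma card_inertia: "card (inertia_group n q p M) = p div \<kappa>"
proof -
  have "inertia_group n q p M = {k. k < p \<and> \<kappa> dvd k}"
    unfolding inertia_group_def using stab_of_isomorphic isomorphic_of_stab stab_iff by blast
  then show ?thesis
    using card_multiples_below stabilizer_eq_multiples_kappa(1,2)[OF q bookS cardS p] by simp
qed

text \<open>The eigenvalues are given only for the X^(\<epsilon>_i), whereas X^\<lambda> is a
  product of integer powers formed in the braid group. The condition is therefore placed on group
  elements, and \<open>w \<noteq> 0\<close> is included so that it passes to inverses.\<close>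

definition eigen :: "(nat \<Rightarrow> box) \<Rightarrow> braid_gen word set \<Rightarrow> complex \<Rightarrow> bool" where
  "eigen L b w \<longleftrightarrow> b \<in> carrier (braid_group n) \<and> w \<noteq> 0 \<and> hecke_braid n q b \<odot>\<^bsub>M\<^esub> v L = \<iota> w \<odot>\<^bsub>M\<^esub> v L"

lemma eigen_one: "L \<in> ST \<Longrightarrow> eigen L \<one>\<^bsub>braid_group n\<^esub> 1"
  using group.is_monoid[OF group_braid_group] by (simp add: eigen_def hecke_braid_one hecke_scalar_one)

lemma eigen_mult:
  assumes L: "L \<in> ST" and "eigen L b w" "eigen L b' w'"
  shows "eigen L (b \<otimes>\<^bsub>braid_group n\<^esub> b') (w * w')"
proof -
  interpret B: group "braid_group n" by (rule group_braid_group)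
  have c: "b \<in> carrier (braid_group n)" "b' \<in> carrier (braid_group n)" using assms by (auto simp: eigen_def)
  note hc = hecke_braid_closed[OF c(1), of q] hecke_braid_closed[OF c(2), of q]
  have "hecke_braid n q (b \<otimes>\<^bsub>braid_group n\<^esub> b') \<odot>\<^bsub>M\<^esub> v L = hecke_braid n q b \<odot>\<^bsub>M\<^esub> (\<iota> w' \<odot>\<^bsub>M\<^esub> v L)"
    using assms hc by (simp add: hecke_braid_mult[OF c] smult_assoc v_closed eigen_def)
  also have "\<dots> = \<iota> w' \<odot>\<^bsub>M\<^esub> (\<iota> w \<odot>\<^bsub>M\<^esub> v L)"
    using assms hc smult_assoc[of "hecke_braid n q b" "\<iota> w'" "v L"] smult_assoc[of "\<iota> w'" "hecke_braid n q b" "v L"]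
    by (simp add: scalar_central v_closed eigen_def)
  also have "\<dots> = \<iota> (w * w') \<odot>\<^bsub>M\<^esub> v L"
    using L by (simp add: scalar_smult_smult v_closed mult.commute)
  finally show ?thesis using assms c by (simp add: eigen_def)
qed

lemma eigen_inv:
  assumes L: "L \<in> ST" and e: "eigen L b w"
  shows "eigen L (inv\<^bsub>braid_group n\<^esub> b) (inverse w)"
proof -
  interpret B: group "braid_group n" by (rule group_braid_group)
  have c: "b \<in> carrier (braid_group n)" "inv\<^bsub>braid_group n\<^esub> b \<in> carrier (braid_group n)"
    and w: "w \<noteq> 0" using assms by (auto simp: eigen_def)
  let ?y = "hecke_braid n q (inv\<^bsub>braid_group n\<^esub> b)"
  note hc = hecke_braid_closed[OF c(1), of q] hecke_braid_closed[OF c(2), of q]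
  have yv: "?y \<odot>\<^bsub>M\<^esub> v L \<in> carrier M" using hc L by (simp add: smult_closed v_closed)
  have one: "?y \<otimes>\<^bsub>H\<^esub> hecke_braid n q b = \<one>\<^bsub>H\<^esub>"
    using hecke_braid_mult[OF c(2,1), of q] c by (simp add: hecke_braid_one)
  have "v L = (?y \<otimes>\<^bsub>H\<^esub> hecke_braid n q b) \<odot>\<^bsub>M\<^esub> v L"
    by (simp only: one smult_one[OF v_closed[OF L]])
  also have "\<dots> = ?y \<odot>\<^bsub>M\<^esub> (hecke_braid n q b \<odot>\<^bsub>M\<^esub> v L)"
    by (rule smult_assoc[OF hc(2,1) v_closed[OF L]])
  also have "\<dots> = ?y \<odot>\<^bsub>M\<^esub> (\<iota> w \<odot>\<^bsub>M\<^esub> v L)" using e by (simp add: eigen_def)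
  also have "\<dots> = \<iota> w \<odot>\<^bsub>M\<^esub> (?y \<odot>\<^bsub>M\<^esub> v L)"
    using hc L smult_assoc[of ?y "\<iota> w" "v L"] smult_assoc[of "\<iota> w" ?y "v L"]
    by (simp add: scalar_central v_closed)
  finally have "\<iota> (inverse w) \<odot>\<^bsub>M\<^esub> v L = \<iota> (inverse w) \<odot>\<^bsub>M\<^esub> (\<iota> w \<odot>\<^bsub>M\<^esub> (?y \<odot>\<^bsub>M\<^esub> v L))" by simp
  also have "\<dots> = ?y \<odot>\<^bsub>M\<^esub> v L"
    using yv w by (simp add: scalar_smult_smult) (simp add: scalar_one smult_one)
  finally show ?thesis using c w by (simp add: eigen_def)
qed

lemma eigen_int_pow:
  assumes L: "L \<in> ST" and e: "eigen L b w"
  shows "eigen L (b [^]\<^bsub>braid_group n\<^esub> (k :: int)) (w powi k)"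
proof -
  interpret B: group "braid_group n" by (rule group_braid_group)
  have "eigen L (b [^]\<^bsub>braid_group n\<^esub> (k :: nat)) (w ^ k)" for k
  proof (induction k)
    case 0
    show ?case using eigen_one[OF L] by simp
  next
    case (Suc k)
    show ?case using eigen_mult[OF L Suc.IH e] by (simp add: power_commutes)
  qed
  note nat_pow = this
  show ?thesis
  proof (cases "k < 0")
    case True
    then have "b [^]\<^bsub>braid_group n\<^esub> k = inv\<^bsub>braid_group n\<^esub> (b [^]\<^bsub>braid_group n\<^esub> nat (- k))"
      by (subst int_pow_def2) (simp only: if_True)
    moreover have "w powi k = inverse (w ^ nat (- k))"
      using True by (simp add: power_int_def power_inverse)
    ultimately show ?thesis using eigen_inv[OF L nat_pow] by simp
  next
    case False
    then have "b [^]\<^bsub>braid_group n\<^esub> k = b [^]\<^bsub>braid_group n\<^esub> nat k"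
      by (subst int_pow_def2) (simp only: if_False)
    moreover have "w powi k = w ^ nat k" using False by (simp add: power_int_def)
    ultimately show ?thesis using nat_pow by simp
  qed
qed

lemma eigen_X:
  assumes L: "L \<in> ST"
  shows "eigen L (braid_X n lam) (\<Prod>i\<in>{1..n}. weight q L i powi lam i)"
proof -
  have "eigen L (foldr (\<lambda>i x. (braid_Xeps n i [^]\<^bsub>braid_group n\<^esub> lam i) \<otimes>\<^bsub>braid_group n\<^esub> x) xs \<one>\<^bsub>braid_group n\<^esub>)
     (\<Prod>i\<leftarrow>xs. weight q L i powi lam i)" if "set xs \<subseteq> {1..n}" for xs
    using that
  proof (induction xs)
    case Nil then show ?case using eigen_one[OF L] by simp
  next
    case (Cons i xs)
    then have i: "i \<in> {1..n}" by simp
    have "eigen L (braid_Xeps n i) (weight q L i)"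
      using X_basis[OF L i] braid_X_closed[of n "eps i"] braid_X_eps[OF i]
      by (simp add: eigen_def weight_def hecke_braid_simps)
    then show ?case using eigen_mult[OF L eigen_int_pow[OF L]] Cons by simp
  qed
  moreover have set: "set [1..<Suc n] = {1..n}" by (auto simp del: upt_Suc)
  ultimately have "eigen L (braid_X n lam) (\<Prod>i\<leftarrow>[1..<Suc n]. weight q L i powi lam i)"
    unfolding braid_X_def by blast
  moreover have "(\<Prod>i\<leftarrow>[1..<Suc n]. weight q L i powi lam i) = (\<Prod>i\<in>{1..n}. weight q L i powi lam i)"
    using prod.distinct_set_conv_list[OF distinct_upt, of "\<lambda>i. weight q L i powi lam i" 1 "Suc n"] set by simp
  ultimately show ?thesis by simp
qed

text \<open>The eigenvalue as a function of the algebra element and not of \<lambda>, as the set of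
  elements X^\<lambda> is what acts; the vector \<open>v L\<close> is nonzero, so the choice is
  unique.\<close>

definition X_value :: "hecke_elt \<Rightarrow> (nat \<Rightarrow> box) \<Rightarrow> complex" where
  "X_value x L = (SOME w. x \<odot>\<^bsub>M\<^esub> v L = \<iota> w \<odot>\<^bsub>M\<^esub> v L)"

lemma X_value:
  assumes L: "L \<in> ST"
  shows "X_value (hecke_X n q lam) L = (\<Prod>i\<in>{1..n}. weight q L i powi lam i)" (is "_ = ?w")
    and "hecke_X n q lam \<odot>\<^bsub>M\<^esub> v L = \<iota> (X_value (hecke_X n q lam) L) \<odot>\<^bsub>M\<^esub> v L"
proof -
  have 1: "hecke_X n q lam \<odot>\<^bsub>M\<^esub> v L = \<iota> ?w \<odot>\<^bsub>M\<^esub> v L"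
    using eigen_X[OF L] by (simp add: eigen_def hecke_braid_simps)
  then show 2: "hecke_X n q lam \<odot>\<^bsub>M\<^esub> v L = \<iota> (X_value (hecke_X n q lam) L) \<odot>\<^bsub>M\<^esub> v L"
    unfolding X_value_def by (rule someI)
  from 1 2 show "X_value (hecke_X n q lam) L = ?w"
    using L by (auto simp: vec_scaled_single vec_eq_iff)
qed

text \<open>Rotating all weights by \<xi>^-k multiplies the eigenvalue by the power of \<xi>^-k
  whose exponent is the coordinate sum of \<lambda>, a multiple of \<open>p\<close>.\<close>

lemma X_value_invariant:
  assumes L: "L \<in> ST" and lam: "lam \<in> lattice_Lp p n" and k: "stab k"
  shows "X_value (hecke_X n q lam) (tab_g q p n S k L) = X_value (hecke_X n q lam) L"
proof -
  obtain d where d: "(\<Sum>i\<in>{1..n}. lam i) = int p * d" using lattice_Lp_sum[OF lam] by blast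
  have prod: "(\<Prod>i\<in>A. (\<zeta> ^ k) powi lam i) = (\<zeta> ^ k) powi (\<Sum>i\<in>A. lam i)" if "finite A" for A
    using that by (induction A rule: finite_induct) (simp_all add: power_int_add)
  have "(\<zeta> ^ k) powi (int p * d) = ((\<zeta> ^ p) ^ k) powi d"
    by (simp only: power_int_mult power_int_of_nat power_mult[symmetric] mult.commute[of k p])
  then have one: "(\<zeta> ^ k) powi (int p * d) = 1" using p by simp
  have "X_value (hecke_X n q lam) (tab_g q p n S k L) = (\<Prod>i\<in>{1..n}. (\<zeta> ^ k * weight q L i) powi lam i)"
    unfolding X_value(1)[OF g_closed[OF L k]] by (intro prod.cong) (simp_all add: g_weight[OF L k])
  also have "\<dots> = (\<Prod>i\<in>{1..n}. (\<zeta> ^ k) powi lam i) * (\<Prod>i\<in>{1..n}. weight q L i powi lam i)"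
    by (simp only: power_int_mult_distrib prod.distrib)
  also have "(\<Prod>i\<in>{1..n}. (\<zeta> ^ k) powi lam i) = 1" using prod[of "{1..n}"] d one by simp
  finally show ?thesis by (simp add: X_value(1)[OF L])
qed

text \<open>Evaluation at \<epsilon>_i - \<epsilon>_(i-1) yields the ratios of consecutive weights
  and at p \<epsilon>_1 the \<open>p\<close>-th power of the first weight, which is enough to
  recover the rotation.\<close>

lemma X_value_separates:
  assumes L: "L \<in> ST" and L': "L' \<in> ST"
    and eq: "\<And>x. x \<in> hecke_X n q ` lattice_Lp p n \<Longrightarrow> X_value x L = X_value x L'"
  shows "\<exists>l. L' = (tab_g q p n S \<kappa> ^^ l) L"
proof -
  have eq': "(\<Prod>i\<in>{1..n}. weight q L i powi lam i) = (\<Prod>i\<in>{1..n}. weight q L' i powi lam i)"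
    if "lam \<in> lattice_Lp p n" for lam
    using eq[OF imageI[OF that]] by (simp add: X_value(1) L L')
  have w: "weight q K i \<noteq> 0" for K i by (simp add: weight_def)
  have ratio: "weight q L i / weight q L (i - 1) = weight q L' i / weight q L' (i - 1)" if i: "i \<in> {2..n}" for i
  proof -
    have "(\<Prod>k\<in>{1..n}. weight q K k powi (eps i k - eps (i - 1) k)) = weight q K i / weight q K (i - 1)" for K
    proof -
      have "(\<Prod>k\<in>{1..n}. weight q K k powi (eps i k - eps (i - 1) k))
         = (\<Prod>k\<in>{1..n}. (if k = i then weight q K k else 1) * (if k = i - 1 then inverse (weight q K k) else 1))"
        using i w by (intro prod.cong) (auto simp: eps_def power_int_minus)
      also have "\<dots> = weight q K i * inverse (weight q K (i - 1))"
        unfolding prod.distrib using i by (auto simp: prod.delta)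
      finally show ?thesis by (simp add: divide_inverse)
    qed
    then show ?thesis using eq'[OF eps_diff_in_Lp[OF i]] by simp
  qed
  have first: "weight q L 1 ^ p = weight q L' 1 ^ p"
  proof -
    have "(\<Prod>k\<in>{1..n}. weight q K k powi (int p * eps 1 k)) = weight q K 1 ^ p" for K
    proof -
      have "(\<Prod>k\<in>{1..n}. weight q K k powi (int p * eps 1 k)) = (\<Prod>k\<in>{1..n}. if k = 1 then weight q K k ^ p else 1)"
        by (intro prod.cong) (auto simp: eps_def)
      then show ?thesis using n by (simp add: prod.delta)
    qed
    then show ?thesis using eq'[OF p_eps_in_Lp[OF n]] by simp
  qed
  obtain k where k: "\<And>i. i \<in> {1..n} \<Longrightarrow> weight q L' i = \<zeta> ^ k * weight q L i"
    using same_ratios_rotated[OF p _ n ratio first] w by blast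
  have "\<kappa> dvd k" by (rule rotated_weights_kappa[OF q bookS cardS p L L' k])
  then obtain l where l: "k = l * \<kappa>" by (auto simp: dvd_def mult.commute)
  have "L' = (tab_g q p n S \<kappa> ^^ l) L"
    by (rule tableau_determined_by_weights[OF q bookS _ L'])
       (use tab_g_iterate(1)[OF q bookS cardS p L, of l] tab_g_iterate(2)[OF q bookS cardS p L, of _ l] k l in auto)
  then show ?thesis ..
qed

end

section \<open>The projection p_j and its image\<close>

locale placed_module_character = placed_module q n p S M v
  for q :: real and n p :: nat and S :: "box set"
    and M :: "(hecke_elt, 'v) module" and v :: "(nat \<Rightarrow> box) \<Rightarrow> 'v" +
  fixes j :: nat
begin

text \<open>The parameter \<chi> is \<xi>^(-j \<kappa>), the coefficient of g^\<kappa> in p_j. Its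
  power with exponent \<open>p div \<kappa>\<close> is 1 because \<kappa> divides
  \<open>p\<close>.\<close>

sublocale cyclic_module H M \<iota> ST v "tab_g q p n S \<kappa>" "p div \<kappa>" "\<zeta> ^ (j * \<kappa>)"
  "hecke_X n q ` lattice_Lp p n" X_value "{2..n}" "hecke_T n q" "T_diag q" T_off T_swap
proof (intro cyclic_module.intro cyclic_module_axioms.intro)
  show "based_module H M \<iota> ST v" by unfold_locales
  have \<kappa>: "stab \<kappa>" by (simp add: stab_iff)
  note kp = stabilizer_eq_multiples_kappa(1,2)[OF q bookS cardS p]
  show "ST \<noteq> {}" by (rule standard_tableaux_nonempty[OF book_finite[OF bookS] cardS])
  show "bij_betw (tab_g q p n S \<kappa>) ST ST" by (rule g_bij[OF \<kappa>])
  show "0 < p div \<kappa>" using kp p by (simp add: dvd_imp_le div_greater_zero_iff)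
  show "(tab_g q p n S \<kappa> ^^ (p div \<kappa>)) L = L" if "L \<in> ST" for L
    by (rule tab_g_period[OF q bookS cardS p that])
  show "(tab_g q p n S \<kappa> ^^ l) L \<noteq> L" if "L \<in> ST" "0 < l" "l < p div \<kappa>" for L l
    by (rule tab_g_free[OF q bookS cardS p n that])
  have "j * \<kappa> * (p div \<kappa>) = p * j" using kp by auto
  then show "(\<zeta> ^ (j * \<kappa>)) ^ (p div \<kappa>) = 1"
    unfolding power_mult[symmetric] using p by (simp only: power_mult root_of_unity_power power_one)
  show "x \<in> carrier H" if "x \<in> hecke_X n q ` lattice_Lp p n" for x using that hecke_X_closed by auto
  show "x \<odot>\<^bsub>M\<^esub> v L = \<iota> (X_value x L) \<odot>\<^bsub>M\<^esub> v L" if "x \<in> hecke_X n q ` lattice_Lp p n" "L \<in> ST" for x L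
    using that X_value(2) by auto
  show "X_value x (tab_g q p n S \<kappa> L) = X_value x L" if "x \<in> hecke_X n q ` lattice_Lp p n" "L \<in> ST" for x L
    using that X_value_invariant \<kappa> by auto
  show "\<exists>l. L' = (tab_g q p n S \<kappa> ^^ l) L" if "L \<in> ST" "L' \<in> ST"
    "\<And>x. x \<in> hecke_X n q ` lattice_Lp p n \<Longrightarrow> X_value x L = X_value x L'" for L L'
    by (rule X_value_separates[OF that])
  show "hecke_T n q i \<in> carrier H" if "i \<in> {2..n}" for i using that by (rule hecke_T_closed)
  show "T_swap i L \<in> ST" if "L \<in> ST" for i L using that by (rule T_swap_closed)
  show "hecke_T n q i \<odot>\<^bsub>M\<^esub> v L = \<iota> (T_diag q i L) \<odot>\<^bsub>M\<^esub> v L \<oplus>\<^bsub>M\<^esub> \<iota> (T_off i L) \<odot>\<^bsub>M\<^esub> v (T_swap i L)"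
    if "i \<in> {2..n}" "L \<in> ST" for i L using that by (intro T_action)
  show "T_diag q i (tab_g q p n S \<kappa> L) = T_diag q i L" if "i \<in> {2..n}" "L \<in> ST" for i L
    using that \<kappa> by (intro T_diag_invariant)
  show "T_off i (tab_g q p n S \<kappa> L) = T_off i L" if "i \<in> {2..n}" "L \<in> ST" for i L
    using that \<kappa> by (intro T_off_invariant)
  show "T_swap i (tab_g q p n S \<kappa> L) = tab_g q p n S \<kappa> (T_swap i L)" if "i \<in> {2..n}" "L \<in> ST" for i L
    using that \<kappa> by (intro T_swap_equivariant)
  show "Q L'" if "L \<in> ST" "L' \<in> ST" "Q L"
    and step: "\<And>L i. L \<in> ST \<Longrightarrow> i \<in> {2..n} \<Longrightarrow> Q L \<Longrightarrow> T_off i L \<noteq> 0 \<Longrightarrow> Q (T_swap i L)" for L L' Q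
  proof (rule tableaux_connected[where P = Q, OF that(1,2,3)])
    fix L i assume L: "L \<in> ST" "Q L" "i \<in> {2..n}" "swap_tab i L \<in> ST"
    have "T_off i L \<noteq> 0"
      using swap_coefficient_nonzero[OF q bookS L(1,3,4)] L(4) by (simp add: T_off_def)
    then show "Q (swap_tab i L)" using step[OF L(1,3,2)] L(4) by (simp add: T_swap_def)
  qed
qed

text \<open>By linearity p_j is determined by its values on the \<open>v L\<close>, and these are
  the vectors with coordinates \<open>symm L\<close>, since g^(l \<kappa>) acts on tableaux as the
  \<open>l\<close>-th iterate of g^\<kappa>.\<close>

lemma proj_vec: "proj n q p S M v j (vec a) = vec (\<lambda>L'. \<Sum>L\<in>ST. a L * symm L L')"
proof -
  have "cis (2 * pi / real p) powi (- (int j * int l * int \<kappa>)) = (\<zeta> ^ (j * \<kappa>)) ^ l" for l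
    unfolding cis_power_int power_mult[symmetric] DeMoivre by (simp add: mult_ac)
  moreover have "module_g n q p S M v (l * \<kappa>) (vec a)
      = vec (\<lambda>L'. \<Sum>L\<in>ST. a L * (if L' = (tab_g q p n S \<kappa> ^^ l) L then 1 else 0))" for l
  proof -
    have "stab (l * \<kappa>)" by (simp add: stab_iff)
    then show ?thesis
      using module_g_vec tab_g_iterate(3)[OF q bookS cardS p] by (simp cong: sum.cong)
  qed
  ultimately have "proj n q p S M v j (vec a) = (\<Oplus>\<^bsub>M\<^esub>l\<in>{..<p div \<kappa>}.
      vec (\<lambda>L'. (\<zeta> ^ (j * \<kappa>)) ^ l * (\<Sum>L\<in>ST. a L * (if L' = (tab_g q p n S \<kappa> ^^ l) L then 1 else 0))))"
    unfolding proj_def card_inertia by (simp only: vec_smult)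
  also have "\<dots> = vec (\<lambda>L'. \<Sum>l<p div \<kappa>. (\<zeta> ^ (j * \<kappa>)) ^ l
      * (\<Sum>L\<in>ST. a L * (if L' = (tab_g q p n S \<kappa> ^^ l) L then 1 else 0)))"
    by (rule vec_finsum) simp
  also have "\<dots> = vec (\<lambda>L'. \<Sum>L\<in>ST. a L * symm L L')"
  proof (rule vec_cong)
    fix L'
    have "(\<Sum>l<p div \<kappa>. (\<zeta> ^ (j * \<kappa>)) ^ l * (\<Sum>L\<in>ST. a L * (if L' = (tab_g q p n S \<kappa> ^^ l) L then 1 else 0)))
       = (\<Sum>l<p div \<kappa>. \<Sum>L\<in>ST. a L * (if L' = (tab_g q p n S \<kappa> ^^ l) L then (\<zeta> ^ (j * \<kappa>)) ^ l else 0))"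
      unfolding sum_distrib_left by (intro sum.cong) auto
    also have "\<dots> = (\<Sum>L\<in>ST. \<Sum>l<p div \<kappa>. a L * (if L' = (tab_g q p n S \<kappa> ^^ l) L then (\<zeta> ^ (j * \<kappa>)) ^ l else 0))"
      by (rule sum.swap)
    finally show "(\<Sum>l<p div \<kappa>. (\<zeta> ^ (j * \<kappa>)) ^ l * (\<Sum>L\<in>ST. a L * (if L' = (tab_g q p n S \<kappa> ^^ l) L then 1 else 0)))
       = (\<Sum>L\<in>ST. a L * symm L L')"
      by (simp only: symm_def sum_distrib_left)
  qed
  finally show ?thesis .
qed

lemma proj_module_eq: "proj_module n q p S M v j = submod"
proof -
  have "carrier M = range vec" using vec_surj vec_closed by blast
  then have "proj n q p S M v j ` carrier M = sub"
    unfolding symmetrization_image[symmetric] by (simp add: image_image proj_vec)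
  then show ?thesis by (simp add: proj_module_def)
qed

lemma hecke_p_eq: "hecke_p n q p = subalgebra"
  by (simp add: hecke_p_def gens_def)

end

theorem theorem3p15:
  fixes q :: real and n p j :: nat and S :: "box set"
    and M :: "(hecke_elt, 'v) module" and v :: "(nat \<Rightarrow> box) \<Rightarrow> 'v"
  assumes "0 < q" and "q \<noteq> 1" and "1 \<le> n" and "1 \<le> p"
    and "placed_skew_shape q n S"
    and "skew_module n q S M v"
    and "j \<le> card (inertia_group n q p M) - 1"
  shows "simple_module (hecke_p n q p) (proj_module n q p S M v j)
    \<and> calibrated (hecke_scalar n q) (hecke_X n q ` lattice_Lp p n)
          (proj_module n q p S M v j)"
proof -
  interpret placed_module_character q n p S M v j
    by unfold_locales (use assms in auto)
  show ?thesis
    unfolding proj_module_eq hecke_p_eq using simple_submod calibrated_submod by blast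
qed

end
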